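(* Let $k$ be an algebraically closed field, let $F$ be a finite field of characteristic different from that of $k$, let $m\ge1$, and let $\mathrm M_m(F)$ be the full linear monoid of all $m\times m$ matrices over $F$ under multiplication. Then $k\mathrm M_m(F)$ satisfies the group-injective condition.
   Context: For a monoid $M$ with group of units $G$ and a $kG$-module $W$, $\mathrm{Ind}(W)$ is the $kM$-module with underlying space $W$ on which $G$ acts as given and $M\setminus G$ acts as $0$. Group-injective condition for the monoid algebra $kM$: there is a projective indecomposable $kG$-module $P$ such that $\mathrm{Ind}(P)$ is an injective $kM$-module. Here $M=\mathrm M_m(F)$ and $G=\mathrm{GL}_m(F)$. *)

theory Defs
  imports "HOL-Algebra.Module" "HOL-Algebra.AbelCoset" "HOL-Computational_Algebra.Polynomial"
    "Jordan_Normal_Form.Matrix"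
begin

(* The library's locale "module" requires a commutative ring; these are its axioms over an
   arbitrary ring. *)

locale left_module = R?: ring R + M?: abelian_group M for R (structure) and M (structure) +
  assumes smult_closed [simp, intro]:
      "\<lbrakk>a \<in> carrier R; x \<in> carrier M\<rbrakk> \<Longrightarrow> a \<odot>\<^bsub>M\<^esub> x \<in> carrier M"
    and smult_l_distr:
      "\<lbrakk>a \<in> carrier R; b \<in> carrier R; x \<in> carrier M\<rbrakk> \<Longrightarrow>
      (a \<oplus> b) \<odot>\<^bsub>M\<^esub> x = a \<odot>\<^bsub>M\<^esub> x \<oplus>\<^bsub>M\<^esub> b \<odot>\<^bsub>M\<^esub> x"
    and smult_r_distr:
      "\<lbrakk>a \<in> carrier R; x \<in> carrier M; y \<in> carrier M\<rbrakk> \<Longrightarrow>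
      a \<odot>\<^bsub>M\<^esub> (x \<oplus>\<^bsub>M\<^esub> y) = a \<odot>\<^bsub>M\<^esub> x \<oplus>\<^bsub>M\<^esub> a \<odot>\<^bsub>M\<^esub> y"
    and smult_assoc:
      "\<lbrakk>a \<in> carrier R; b \<in> carrier R; x \<in> carrier M\<rbrakk> \<Longrightarrow>
      (a \<otimes> b) \<odot>\<^bsub>M\<^esub> x = a \<odot>\<^bsub>M\<^esub> (b \<odot>\<^bsub>M\<^esub> x)"
    and smult_one [simp]:
      "x \<in> carrier M \<Longrightarrow> \<one> \<odot>\<^bsub>M\<^esub> x = x"

definition lmod_hom ::
  "('r, 'z) ring_scheme \<Rightarrow> ('r, 'a) module \<Rightarrow> ('r, 'b) module \<Rightarrow> ('a \<Rightarrow> 'b) set" where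
  "lmod_hom R A B = {h \<in> carrier A \<rightarrow> carrier B.
     (\<forall>x\<in>carrier A. \<forall>y\<in>carrier A. h (x \<oplus>\<^bsub>A\<^esub> y) = h x \<oplus>\<^bsub>B\<^esub> h y) \<and>
     (\<forall>r\<in>carrier R. \<forall>x\<in>carrier A. h (r \<odot>\<^bsub>A\<^esub> x) = r \<odot>\<^bsub>B\<^esub> h x)}"

definition injective_wrt ::
  "'a itself \<Rightarrow> 'b itself \<Rightarrow> ('r, 'z) ring_scheme \<Rightarrow> ('r, 'w) module \<Rightarrow> bool" where
  "injective_wrt TA TB R W \<longleftrightarrow> left_module R W \<and>
     (\<forall>(A :: ('r, 'a) module) (B :: ('r, 'b) module) i f.
        left_module R A \<and> left_module R B \<and> i \<in> lmod_hom R A B \<and> inj_on i (carrier A) \<and>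
        f \<in> lmod_hom R A W \<longrightarrow>
        (\<exists>g\<in>lmod_hom R B W. \<forall>x\<in>carrier A. g (i x) = f x))"

definition projective_wrt ::
  "'a itself \<Rightarrow> 'b itself \<Rightarrow> ('r, 'z) ring_scheme \<Rightarrow> ('r, 'p) module \<Rightarrow> bool" where
  "projective_wrt TA TB R P \<longleftrightarrow> left_module R P \<and>
     (\<forall>(A :: ('r, 'a) module) (B :: ('r, 'b) module) p f.
        left_module R A \<and> left_module R B \<and> p \<in> lmod_hom R A B \<and> p ` carrier A = carrier B \<and>
        f \<in> lmod_hom R P B \<longrightarrow>
        (\<exists>g\<in>lmod_hom R P A. \<forall>x\<in>carrier P. p (g x) = f x))"

(* A definition cannot quantify over all types, so the test modules in the next two definitions
   have carriers in fixed types. These types are large enough: injective_module_any_type and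
   projective_module_any_type below give the extension and lifting properties for test modules
   with carriers in arbitrary types. *)

definition injective_module :: "('r, 'z) ring_scheme \<Rightarrow> ('r, 'w) module \<Rightarrow> bool" where
  "injective_module R W \<longleftrightarrow> injective_wrt TYPE('r) TYPE('r) R W"

definition projective_module :: "('r, 'z) ring_scheme \<Rightarrow> ('r, 'p) module \<Rightarrow> bool" where
  "projective_module R P \<longleftrightarrow> projective_wrt TYPE('p \<Rightarrow> 'r) TYPE('p) R P"

definition indecomposable_module :: "('r, 'z) ring_scheme \<Rightarrow> ('r, 'w) module \<Rightarrow> bool" where
  "indecomposable_module R W \<longleftrightarrow> left_module R W \<and> carrier W \<noteq> {\<zero>\<^bsub>W\<^esub>} \<and>
     (\<forall>U V. submodule U R W \<and> submodule V R W \<and>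
        U <+>\<^bsub>W\<^esub> V = carrier W \<and> U \<inter> V = {\<zero>\<^bsub>W\<^esub>} \<longrightarrow>
        U = {\<zero>\<^bsub>W\<^esub>} \<or> V = {\<zero>\<^bsub>W\<^esub>})"

context left_module
begin

lemma smult_l_null [simp]:
  assumes x: "x \<in> carrier M" shows "\<zero> \<odot>\<^bsub>M\<^esub> x = \<zero>\<^bsub>M\<^esub>"
proof -
  have "\<zero> \<odot>\<^bsub>M\<^esub> x \<oplus>\<^bsub>M\<^esub> \<zero> \<odot>\<^bsub>M\<^esub> x = \<zero> \<odot>\<^bsub>M\<^esub> x"
    using smult_l_distr[of \<zero> \<zero> x] x by simp
  then show ?thesis using x by (simp add: M.add.l_cancel_one)
qed

lemma smult_r_null [simp]:
  assumes a: "a \<in> carrier R" shows "a \<odot>\<^bsub>M\<^esub> \<zero>\<^bsub>M\<^esub> = \<zero>\<^bsub>M\<^esub>"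
proof -
  have "a \<odot>\<^bsub>M\<^esub> \<zero>\<^bsub>M\<^esub> \<oplus>\<^bsub>M\<^esub> a \<odot>\<^bsub>M\<^esub> \<zero>\<^bsub>M\<^esub> = a \<odot>\<^bsub>M\<^esub> \<zero>\<^bsub>M\<^esub>"
    using smult_r_distr[of a "\<zero>\<^bsub>M\<^esub>" "\<zero>\<^bsub>M\<^esub>"] a by simp
  then show ?thesis using a by (simp add: M.add.l_cancel_one)
qed

lemma smult_l_minus:
  assumes "a \<in> carrier R" "x \<in> carrier M"
  shows "(\<ominus> a) \<odot>\<^bsub>M\<^esub> x = \<ominus>\<^bsub>M\<^esub> (a \<odot>\<^bsub>M\<^esub> x)"
proof -
  have "(\<ominus> a) \<odot>\<^bsub>M\<^esub> x \<oplus>\<^bsub>M\<^esub> a \<odot>\<^bsub>M\<^esub> x = \<zero>\<^bsub>M\<^esub>"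
    using smult_l_distr[of "\<ominus> a" a x] assms by (simp add: R.l_neg)
  then show ?thesis using assms by (simp add: M.minus_equality)
qed

end

lemma left_moduleI:
  fixes R (structure) and M (structure)
  assumes "ring R" and "abelian_group M"
    and "\<And>a x. \<lbrakk>a \<in> carrier R; x \<in> carrier M\<rbrakk> \<Longrightarrow> a \<odot>\<^bsub>M\<^esub> x \<in> carrier M"
    and "\<And>a b x. \<lbrakk>a \<in> carrier R; b \<in> carrier R; x \<in> carrier M\<rbrakk> \<Longrightarrow>
      (a \<oplus> b) \<odot>\<^bsub>M\<^esub> x = a \<odot>\<^bsub>M\<^esub> x \<oplus>\<^bsub>M\<^esub> b \<odot>\<^bsub>M\<^esub> x"
    and "\<And>a x y. \<lbrakk>a \<in> carrier R; x \<in> carrier M; y \<in> carrier M\<rbrakk> \<Longrightarrow>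
      a \<odot>\<^bsub>M\<^esub> (x \<oplus>\<^bsub>M\<^esub> y) = a \<odot>\<^bsub>M\<^esub> x \<oplus>\<^bsub>M\<^esub> a \<odot>\<^bsub>M\<^esub> y"
    and "\<And>a b x. \<lbrakk>a \<in> carrier R; b \<in> carrier R; x \<in> carrier M\<rbrakk> \<Longrightarrow>
      (a \<otimes> b) \<odot>\<^bsub>M\<^esub> x = a \<odot>\<^bsub>M\<^esub> (b \<odot>\<^bsub>M\<^esub> x)"
    and "\<And>x. x \<in> carrier M \<Longrightarrow> \<one> \<odot>\<^bsub>M\<^esub> x = x"
  shows "left_module R M"
  using assms by (auto intro!: left_module.intro left_module_axioms.intro)

definition ideal_module :: "('r, 'z) ring_scheme \<Rightarrow> 'r set \<Rightarrow> ('r, 'r) module" where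
  "ideal_module R I = \<lparr>carrier = I, monoid.mult = monoid.mult R, one = one R, zero = zero R,
     add = add R, smult = monoid.mult R\<rparr>"

lemma left_module_ideal_module:
  fixes R (structure)
  assumes "ring R" and sub: "I \<subseteq> carrier R" and "\<zero> \<in> I"
    and add: "\<And>a b. \<lbrakk>a \<in> I; b \<in> I\<rbrakk> \<Longrightarrow> a \<oplus> b \<in> I"
    and mult: "\<And>a b. \<lbrakk>a \<in> carrier R; b \<in> I\<rbrakk> \<Longrightarrow> a \<otimes> b \<in> I"
  shows "left_module R (ideal_module R I)"
proof -
  interpret ring R by fact
  have neg: "\<ominus> a \<in> I" if "a \<in> I" for a
    using mult[of "\<ominus> \<one>" a] that sub by (auto simp: l_minus)
  have c: "x \<in> carrier R" if "x \<in> I" for x using that sub by auto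
  have inv: "\<exists>y\<in>I. y \<oplus> x = \<zero>" "\<exists>y\<in>I. x \<oplus> y = \<zero>" if "x \<in> I" for x
    using neg[OF that] c[OF that] by (auto intro!: bexI[of _ "\<ominus> x"] simp: l_neg r_neg)
  show ?thesis
  proof (rule left_moduleI)
    show "abelian_group (ideal_module R I)"
      by (rule abelian_groupI)
        (auto simp: ideal_module_def add \<open>\<zero> \<in> I\<close> c a_ac inv)
  qed (auto simp: ideal_module_def mult c l_distr r_distr m_assoc \<open>ring R\<close>)
qed

lemma lmod_homD:
  assumes "h \<in> lmod_hom R A B"
  shows "\<And>x. x \<in> carrier A \<Longrightarrow> h x \<in> carrier B"
    and "\<And>x y. \<lbrakk>x \<in> carrier A; y \<in> carrier A\<rbrakk> \<Longrightarrow> h (x \<oplus>\<^bsub>A\<^esub> y) = h x \<oplus>\<^bsub>B\<^esub> h y"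
    and "\<And>r x. \<lbrakk>r \<in> carrier R; x \<in> carrier A\<rbrakk> \<Longrightarrow> h (r \<odot>\<^bsub>A\<^esub> x) = r \<odot>\<^bsub>B\<^esub> h x"
  using assms by (auto simp: lmod_hom_def)

lemma lmod_hom_zero:
  assumes "left_module R A" "left_module R B" "h \<in> lmod_hom R A B"
  shows "h \<zero>\<^bsub>A\<^esub> = \<zero>\<^bsub>B\<^esub>"
proof -
  interpret A: left_module R A by fact
  interpret B: left_module R B by fact
  have "h (\<zero>\<^bsub>R\<^esub> \<odot>\<^bsub>A\<^esub> \<zero>\<^bsub>A\<^esub>) = \<zero>\<^bsub>R\<^esub> \<odot>\<^bsub>B\<^esub> h \<zero>\<^bsub>A\<^esub>"
    by (rule lmod_homD(3)[OF assms(3)]) auto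
  then show ?thesis using lmod_homD(1)[OF assms(3), of "\<zero>\<^bsub>A\<^esub>"] by simp
qed

lemma injective_module_any_type:
  fixes R :: "('r, 'z) ring_scheme" (structure) and W :: "('r, 'w) module"
  assumes inj: "injective_module R W"
  shows "injective_wrt TYPE('a) TYPE('b) R W"
proof -
  have ext: "\<exists>g\<in>lmod_hom R B W. \<forall>x\<in>carrier A. g (i x) = f x"
    if "left_module R A" "left_module R B" "i \<in> lmod_hom R A B" "inj_on i (carrier A)"
      "f \<in> lmod_hom R A W" for A B :: "('r, 'r) module" and i f
    using inj that unfolding injective_module_def injective_wrt_def by blast
  have W: "left_module R W"
    using inj unfolding injective_module_def injective_wrt_def by blast
  interpret W: left_module R W by fact
  have "\<exists>g\<in>lmod_hom R B W. \<forall>x\<in>carrier A. g (i x) = f x"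
    if lA: "left_module R A" and lB: "left_module R B" and i: "i \<in> lmod_hom R A B"
      and inj: "inj_on i (carrier A)" and f: "f \<in> lmod_hom R A W"
    for A :: "('r, 'a) module" and B :: "('r, 'b) module" and i f
  proof -
    interpret A: left_module R A by fact
    interpret B: left_module R B by fact
    (* graphs of partial homomorphisms from B to W extending f *)
    define ok where "ok G \<longleftrightarrow> G \<subseteq> carrier B \<times> carrier W \<and> (\<lambda>a. (i a, f a)) ` carrier A \<subseteq> G \<and>
      (\<forall>x y x' y'. (x, y) \<in> G \<longrightarrow> (x', y') \<in> G \<longrightarrow> (x \<oplus>\<^bsub>B\<^esub> x', y \<oplus>\<^bsub>W\<^esub> y') \<in> G) \<and>
      (\<forall>r x y. r \<in> carrier R \<longrightarrow> (x, y) \<in> G \<longrightarrow> (r \<odot>\<^bsub>B\<^esub> x, r \<odot>\<^bsub>W\<^esub> y) \<in> G) \<and>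
      (\<forall>y. (\<zero>\<^bsub>B\<^esub>, y) \<in> G \<longrightarrow> y = \<zero>\<^bsub>W\<^esub>)" for G
    have okD: "ok G \<Longrightarrow> G \<subseteq> carrier B \<times> carrier W"
      "\<And>a. \<lbrakk>ok G; a \<in> carrier A\<rbrakk> \<Longrightarrow> (i a, f a) \<in> G"
      "\<And>x y x' y'. \<lbrakk>ok G; (x, y) \<in> G; (x', y') \<in> G\<rbrakk> \<Longrightarrow> (x \<oplus>\<^bsub>B\<^esub> x', y \<oplus>\<^bsub>W\<^esub> y') \<in> G"
      "\<And>r x y. \<lbrakk>ok G; r \<in> carrier R; (x, y) \<in> G\<rbrakk> \<Longrightarrow> (r \<odot>\<^bsub>B\<^esub> x, r \<odot>\<^bsub>W\<^esub> y) \<in> G"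
      "\<And>y. \<lbrakk>ok G; (\<zero>\<^bsub>B\<^esub>, y) \<in> G\<rbrakk> \<Longrightarrow> y = \<zero>\<^bsub>W\<^esub>" for G
      unfolding ok_def by auto
    have ok0: "ok ((\<lambda>a. (i a, f a)) ` carrier A)"
      unfolding ok_def
    proof (intro conjI allI impI)
      fix y assume "(\<zero>\<^bsub>B\<^esub>, y) \<in> (\<lambda>a. (i a, f a)) ` carrier A"
      then obtain a where a: "a \<in> carrier A" "i a = \<zero>\<^bsub>B\<^esub>" "y = f a" by auto
      have "a = \<zero>\<^bsub>A\<^esub>"
        using inj_onD[OF inj, of a "\<zero>\<^bsub>A\<^esub>"] a lmod_hom_zero[OF lA lB i] by simp
      then show "y = \<zero>\<^bsub>W\<^esub>" using a lmod_hom_zero[OF lA W f] by simp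
    next
      fix x y x' y'
      assume "(x, y) \<in> (\<lambda>a. (i a, f a)) ` carrier A" "(x', y') \<in> (\<lambda>a. (i a, f a)) ` carrier A"
      then obtain a a' where a: "a \<in> carrier A" "x = i a" "y = f a"
        "a' \<in> carrier A" "x' = i a'" "y' = f a'" by auto
      have "(x \<oplus>\<^bsub>B\<^esub> x', y \<oplus>\<^bsub>W\<^esub> y') = (i (a \<oplus>\<^bsub>A\<^esub> a'), f (a \<oplus>\<^bsub>A\<^esub> a'))"
        using a by (simp add: lmod_homD(2)[OF i] lmod_homD(2)[OF f])
      then show "(x \<oplus>\<^bsub>B\<^esub> x', y \<oplus>\<^bsub>W\<^esub> y') \<in> (\<lambda>a. (i a, f a)) ` carrier A" using a by blast
    next
      fix r x y
      assume r: "r \<in> carrier R" and "(x, y) \<in> (\<lambda>a. (i a, f a)) ` carrier A"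
      then obtain a where a: "a \<in> carrier A" "x = i a" "y = f a" by auto
      have "(r \<odot>\<^bsub>B\<^esub> x, r \<odot>\<^bsub>W\<^esub> y) = (i (r \<odot>\<^bsub>A\<^esub> a), f (r \<odot>\<^bsub>A\<^esub> a))"
        using a r by (simp add: lmod_homD(3)[OF i] lmod_homD(3)[OF f])
      then show "(r \<odot>\<^bsub>B\<^esub> x, r \<odot>\<^bsub>W\<^esub> y) \<in> (\<lambda>a. (i a, f a)) ` carrier A" using a r by blast
    qed (auto simp: lmod_homD(1)[OF i] lmod_homD(1)[OF f])
    have "\<exists>G\<in>{G. ok G}. \<forall>X\<in>{G. ok G}. G \<subseteq> X \<longrightarrow> X = G"
    proof (rule subset_Zorn_nonempty)
      show "{G. ok G} \<noteq> {}" using ok0 by blast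
    next
      fix C assume C: "C \<noteq> {}" "subset.chain {G. ok G} C"
      have okC: "ok G" if "G \<in> C" for G
        using C(2) that by (auto simp: subset.chain_def)
      have common: "\<exists>G\<in>C. p \<in> G \<and> q \<in> G" if pq: "p \<in> \<Union>C" "q \<in> \<Union>C" for p q
      proof -
        obtain X Y where XY: "X \<in> C" "Y \<in> C" "p \<in> X" "q \<in> Y" using pq by auto
        then have "X \<subseteq> Y \<or> Y \<subseteq> X" using C(2) unfolding subset_chain_def by blast
        then show ?thesis using XY by (metis subsetD)
      qed
      have "ok (\<Union>C)"
        unfolding ok_def[of "\<Union>C"]
      proof (intro conjI allI impI)
        show "\<Union>C \<subseteq> carrier B \<times> carrier W"
          by (rule Union_least) (use okC okD(1) in blast)
        obtain X where "X \<in> C" using C(1) by auto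
        then show "(\<lambda>a. (i a, f a)) ` carrier A \<subseteq> \<Union>C"
          using okD(2)[OF okC] by (meson UnionI image_subsetI)
      next
        fix x y x' y' assume "(x, y) \<in> \<Union>C" "(x', y') \<in> \<Union>C"
        then obtain G where "G \<in> C" "(x, y) \<in> G" "(x', y') \<in> G" using common by meson
        then show "(x \<oplus>\<^bsub>B\<^esub> x', y \<oplus>\<^bsub>W\<^esub> y') \<in> \<Union>C" using okD(3)[OF okC] by (meson UnionI)
      next
        fix r x y assume "r \<in> carrier R" "(x, y) \<in> \<Union>C"
        then show "(r \<odot>\<^bsub>B\<^esub> x, r \<odot>\<^bsub>W\<^esub> y) \<in> \<Union>C" using okD(4)[OF okC] by (meson UnionE UnionI)
      next
        fix y assume "(\<zero>\<^bsub>B\<^esub>, y) \<in> \<Union>C"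
        then show "y = \<zero>\<^bsub>W\<^esub>" using okD(5)[OF okC] by (meson UnionE)
      qed
      then show "\<Union>C \<in> {G. ok G}" by simp
    qed
    then obtain G where G: "ok G" and max: "\<And>X. ok X \<Longrightarrow> G \<subseteq> X \<Longrightarrow> X = G" by blast
    have Gsub: "x \<in> carrier B" "y \<in> carrier W" if "(x, y) \<in> G" for x y
      using okD(1)[OF G] that by auto
    note Gext = okD(2)[OF G] and Gadd = okD(3)[OF G] and Gsm = okD(4)[OF G] and G0 = okD(5)[OF G]
    have Gneg: "(\<ominus>\<^bsub>B\<^esub> x, \<ominus>\<^bsub>W\<^esub> y) \<in> G" if "(x, y) \<in> G" for x y
      using Gsm[of "\<ominus> \<one>" x y] that Gsub[OF that] by (simp add: B.smult_l_minus W.smult_l_minus)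
    have Gsv: "y = y'" if "(x, y) \<in> G" "(x, y') \<in> G" for x y y'
    proof -
      have "(x \<oplus>\<^bsub>B\<^esub> \<ominus>\<^bsub>B\<^esub> x, y \<oplus>\<^bsub>W\<^esub> \<ominus>\<^bsub>W\<^esub> y') \<in> G" using Gadd[OF that(1) Gneg[OF that(2)]] .
      then have "y \<oplus>\<^bsub>W\<^esub> \<ominus>\<^bsub>W\<^esub> y' = \<zero>\<^bsub>W\<^esub>"
        using G0 Gsub[OF that(1)] by (simp add: B.r_neg)
      then show ?thesis
        using Gsub[OF that(1)] Gsub[OF that(2)]
        by (metis W.M.add.inv_closed W.M.add.inv_equality W.M.minus_minus)
    qed
    have G00: "(\<zero>\<^bsub>B\<^esub>, \<zero>\<^bsub>W\<^esub>) \<in> G"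
      using Gext[of "\<zero>\<^bsub>A\<^esub>"] lmod_hom_zero[OF lA lB i] lmod_hom_zero[OF lA W f] by simp
    have total: "\<exists>y. (b, y) \<in> G" if b: "b \<in> carrier B" for b
    proof -
      define I where "I = {r \<in> carrier R. \<exists>y. (r \<odot>\<^bsub>B\<^esub> b, y) \<in> G}"
      define h where "h r = (THE y. (r \<odot>\<^bsub>B\<^esub> b, y) \<in> G)" for r
      have hI: "h r = y" if "(r \<odot>\<^bsub>B\<^esub> b, y) \<in> G" for r y
        unfolding h_def using that Gsv by blast
      have hG: "(r \<odot>\<^bsub>B\<^esub> b, h r) \<in> G" if "r \<in> I" for r
        using that hI unfolding I_def by blast
      have addI: "r \<oplus> s \<in> I \<and> h (r \<oplus> s) = h r \<oplus>\<^bsub>W\<^esub> h s" if "r \<in> I" "s \<in> I" for r s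
      proof -
        have rs: "r \<in> carrier R" "s \<in> carrier R" using that unfolding I_def by auto
        have "((r \<oplus> s) \<odot>\<^bsub>B\<^esub> b, h r \<oplus>\<^bsub>W\<^esub> h s) \<in> G"
          using Gadd[OF hG[OF that(1)] hG[OF that(2)]] rs b by (simp add: B.smult_l_distr)
        then show ?thesis using hI rs unfolding I_def by blast
      qed
      have multI: "r \<otimes> s \<in> I \<and> h (r \<otimes> s) = r \<odot>\<^bsub>W\<^esub> h s" if "r \<in> carrier R" "s \<in> I" for r s
      proof -
        have rs: "s \<in> carrier R" using that unfolding I_def by auto
        have "((r \<otimes> s) \<odot>\<^bsub>B\<^esub> b, r \<odot>\<^bsub>W\<^esub> h s) \<in> G"
          using Gsm[OF that(1) hG[OF that(2)]] rs that b by (simp add: B.smult_assoc)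
        then show ?thesis using hI rs that unfolding I_def by blast
      qed
      have zI: "\<zero> \<in> I" using G00 b unfolding I_def by auto
      have lI: "left_module R (ideal_module R I)"
        by (rule left_module_ideal_module)
          (use W.R.ring_axioms zI addI multI in \<open>auto simp: I_def\<close>)
      have lR: "left_module R (ideal_module R (carrier R))"
        by (rule left_module_ideal_module) (use W.R.ring_axioms in auto)
      have idh: "id \<in> lmod_hom R (ideal_module R I) (ideal_module R (carrier R))"
        by (auto simp: lmod_hom_def ideal_module_def I_def)
      have hh: "h \<in> lmod_hom R (ideal_module R I) W"
        using Gsub(2)[OF hG] addI multI by (auto simp: lmod_hom_def ideal_module_def)
      obtain g where g: "g \<in> lmod_hom R (ideal_module R (carrier R)) W"
        and gh: "\<And>x. x \<in> I \<Longrightarrow> g x = h x"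
        using ext[OF lI lR idh _ hh] by (auto simp: ideal_module_def)
      define w where "w = g \<one>"
      have w: "w \<in> carrier W"
        using lmod_homD(1)[OF g, of \<one>] by (simp add: w_def ideal_module_def)
      have hw: "h r = r \<odot>\<^bsub>W\<^esub> w" if "r \<in> I" for r
        using lmod_homD(3)[OF g, of r \<one>] gh[OF that] that
        by (simp add: w_def ideal_module_def I_def)
      define G' where "G' = {(x \<oplus>\<^bsub>B\<^esub> r \<odot>\<^bsub>B\<^esub> b, y \<oplus>\<^bsub>W\<^esub> r \<odot>\<^bsub>W\<^esub> w) |x y r. (x, y) \<in> G \<and> r \<in> carrier R}"
      have G'I: "(x \<oplus>\<^bsub>B\<^esub> r \<odot>\<^bsub>B\<^esub> b, y \<oplus>\<^bsub>W\<^esub> r \<odot>\<^bsub>W\<^esub> w) \<in> G'"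
        if "(x, y) \<in> G" "r \<in> carrier R" for x y r
        unfolding G'_def using that by blast
      have "G \<subseteq> G'"
      proof
        fix p assume p: "p \<in> G"
        obtain x y where xy: "p = (x, y)" by force
        have "p = (x \<oplus>\<^bsub>B\<^esub> \<zero> \<odot>\<^bsub>B\<^esub> b, y \<oplus>\<^bsub>W\<^esub> \<zero> \<odot>\<^bsub>W\<^esub> w)"
          using Gsub[of x y] p xy b w by simp
        then show "p \<in> G'" using G'I[of x y \<zero>] p xy by simp
      qed
      moreover have "ok G'"
        unfolding ok_def[of G']
      proof (intro conjI allI impI)
        show "G' \<subseteq> carrier B \<times> carrier W" unfolding G'_def using Gsub b w by auto
        show "(\<lambda>a. (i a, f a)) ` carrier A \<subseteq> G'" using Gext \<open>G \<subseteq> G'\<close> by auto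
      next
        fix x y x' y' assume "(x, y) \<in> G'" "(x', y') \<in> G'"
        then obtain u v r u' v' r' where
          1: "x = u \<oplus>\<^bsub>B\<^esub> r \<odot>\<^bsub>B\<^esub> b" "y = v \<oplus>\<^bsub>W\<^esub> r \<odot>\<^bsub>W\<^esub> w" "(u, v) \<in> G" "r \<in> carrier R" and
          2: "x' = u' \<oplus>\<^bsub>B\<^esub> r' \<odot>\<^bsub>B\<^esub> b" "y' = v' \<oplus>\<^bsub>W\<^esub> r' \<odot>\<^bsub>W\<^esub> w" "(u', v') \<in> G" "r' \<in> carrier R"
          unfolding G'_def by blast
        have "x \<oplus>\<^bsub>B\<^esub> x' = (u \<oplus>\<^bsub>B\<^esub> u') \<oplus>\<^bsub>B\<^esub> (r \<oplus> r') \<odot>\<^bsub>B\<^esub> b"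
          using 1 2 b Gsub[OF 1(3)] Gsub[OF 2(3)] by (simp add: B.smult_l_distr B.M.a_ac)
        moreover have "y \<oplus>\<^bsub>W\<^esub> y' = (v \<oplus>\<^bsub>W\<^esub> v') \<oplus>\<^bsub>W\<^esub> (r \<oplus> r') \<odot>\<^bsub>W\<^esub> w"
          using 1 2 w Gsub[OF 1(3)] Gsub[OF 2(3)] by (simp add: W.smult_l_distr W.M.a_ac)
        ultimately show "(x \<oplus>\<^bsub>B\<^esub> x', y \<oplus>\<^bsub>W\<^esub> y') \<in> G'"
          using G'I[OF Gadd[OF 1(3) 2(3)], of "r \<oplus> r'"] 1(4) 2(4) by simp
      next
        fix s x y assume s: "s \<in> carrier R" and "(x, y) \<in> G'"
        then obtain u v r where
          1: "x = u \<oplus>\<^bsub>B\<^esub> r \<odot>\<^bsub>B\<^esub> b" "y = v \<oplus>\<^bsub>W\<^esub> r \<odot>\<^bsub>W\<^esub> w" "(u, v) \<in> G" "r \<in> carrier R"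
          unfolding G'_def by blast
        have "s \<odot>\<^bsub>B\<^esub> x = s \<odot>\<^bsub>B\<^esub> u \<oplus>\<^bsub>B\<^esub> (s \<otimes> r) \<odot>\<^bsub>B\<^esub> b"
          using 1 s b Gsub[OF 1(3)] by (simp add: B.smult_r_distr B.smult_assoc)
        moreover have "s \<odot>\<^bsub>W\<^esub> y = s \<odot>\<^bsub>W\<^esub> v \<oplus>\<^bsub>W\<^esub> (s \<otimes> r) \<odot>\<^bsub>W\<^esub> w"
          using 1 s w Gsub[OF 1(3)] by (simp add: W.smult_r_distr W.smult_assoc)
        ultimately show "(s \<odot>\<^bsub>B\<^esub> x, s \<odot>\<^bsub>W\<^esub> y) \<in> G'"
          using G'I[OF Gsm[OF s 1(3)], of "s \<otimes> r"] 1(4) s by simp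
      next
        fix y assume "(\<zero>\<^bsub>B\<^esub>, y) \<in> G'"
        then obtain u v r where
          1: "\<zero>\<^bsub>B\<^esub> = u \<oplus>\<^bsub>B\<^esub> r \<odot>\<^bsub>B\<^esub> b" "y = v \<oplus>\<^bsub>W\<^esub> r \<odot>\<^bsub>W\<^esub> w" "(u, v) \<in> G" "r \<in> carrier R"
          unfolding G'_def by blast
        have "r \<odot>\<^bsub>B\<^esub> b = \<ominus>\<^bsub>B\<^esub> u"
          using 1 Gsub[OF 1(3)] b
          by (metis B.M.a_comm B.M.minus_equality B.smult_closed)
        then have "(r \<odot>\<^bsub>B\<^esub> b, \<ominus>\<^bsub>W\<^esub> v) \<in> G" using Gneg[OF 1(3)] by simp
        then have "r \<in> I" "h r = \<ominus>\<^bsub>W\<^esub> v" using hI 1(4) unfolding I_def by auto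
        then show "y = \<zero>\<^bsub>W\<^esub>" using 1 hw[of r] Gsub[OF 1(3)] by (simp add: W.M.r_neg)
      qed
      ultimately have "G' = G" using max by blast
      moreover have "(b, w) \<in> G'"
      proof -
        have "(b, w) = (\<zero>\<^bsub>B\<^esub> \<oplus>\<^bsub>B\<^esub> \<one> \<odot>\<^bsub>B\<^esub> b, \<zero>\<^bsub>W\<^esub> \<oplus>\<^bsub>W\<^esub> \<one> \<odot>\<^bsub>W\<^esub> w)" using b w by simp
        then show ?thesis using G'I[OF G00, of \<one>] by simp
      qed
      ultimately show ?thesis by blast
    qed
    define g where "g b = (THE y. (b, y) \<in> G)" for b
    have gI: "g b = y" if "(b, y) \<in> G" for b y
      unfolding g_def using that Gsv by blast
    have gG: "(b, g b) \<in> G" if "b \<in> carrier B" for b using total[OF that] gI by blast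
    have "g \<in> lmod_hom R B W"
      unfolding lmod_hom_def
    proof (safe)
      fix x assume "x \<in> carrier B"
      then show "g x \<in> carrier W" using gG Gsub(2) by blast
    next
      fix x y assume "x \<in> carrier B" "y \<in> carrier B"
      then show "g (x \<oplus>\<^bsub>B\<^esub> y) = g x \<oplus>\<^bsub>W\<^esub> g y" by (intro gI Gadd gG)
    next
      fix r x assume "r \<in> carrier R" "x \<in> carrier B"
      then show "g (r \<odot>\<^bsub>B\<^esub> x) = r \<odot>\<^bsub>W\<^esub> g x" by (intro gI Gsm gG)
    qed
    moreover have "\<forall>x\<in>carrier A. g (i x) = f x" using Gext gI by blast
    ultimately show ?thesis by blast
  qed
  then show ?thesis unfolding injective_wrt_def using W by blast
qed

definition free_module :: "('r, 'z) ring_scheme \<Rightarrow> 'p set \<Rightarrow> ('r, 'p \<Rightarrow> 'r) module" where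
  "free_module R X = \<lparr>
     carrier = {c. (\<forall>x. c x \<in> carrier R) \<and> finite {x. c x \<noteq> zero R} \<and> {x. c x \<noteq> zero R} \<subseteq> X},
     monoid.mult = (\<lambda>c d. c), one = (\<lambda>x. zero R), zero = (\<lambda>x. zero R),
     add = (\<lambda>c d x. add R (c x) (d x)), smult = (\<lambda>r c x. monoid.mult R r (c x))\<rparr>"

lemma left_module_free_module:
  fixes R :: "('r, 'z) ring_scheme" and X :: "'p set"
  assumes "ring R" shows "left_module R (free_module R X)"
proof -
  interpret ring R by fact
  have fin_add: "finite {x. c x \<oplus>\<^bsub>R\<^esub> d x \<noteq> \<zero>\<^bsub>R\<^esub>}"
    if "finite {x. c x \<noteq> \<zero>\<^bsub>R\<^esub>}" "finite {x. d x \<noteq> \<zero>\<^bsub>R\<^esub>}" for c d :: "'p \<Rightarrow> 'r"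
    by (rule finite_subset[OF _ finite_UnI[OF that]]) auto
  have zz: "{x. c x \<oplus>\<^bsub>R\<^esub> d x \<noteq> \<zero>\<^bsub>R\<^esub>} \<subseteq> X"
    if "{x. c x \<noteq> \<zero>\<^bsub>R\<^esub>} \<subseteq> X" "{x. d x \<noteq> \<zero>\<^bsub>R\<^esub>} \<subseteq> X" for c d :: "'p \<Rightarrow> 'r"
    by (rule subset_trans[OF _ Un_least[OF that]]) auto
  have fin_sm: "finite {x. r \<otimes>\<^bsub>R\<^esub> c x \<noteq> \<zero>\<^bsub>R\<^esub>}"
    if "finite {x. c x \<noteq> \<zero>\<^bsub>R\<^esub>}" "r \<in> carrier R" for r and c :: "'p \<Rightarrow> 'r"
    by (rule finite_subset[OF _ that(1)]) (use that in auto)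
  have neg: "\<exists>d\<in>carrier (free_module R X). d \<oplus>\<^bsub>free_module R X\<^esub> c = \<zero>\<^bsub>free_module R X\<^esub>"
    if "c \<in> carrier (free_module R X)" for c
  proof (rule bexI[of _ "\<lambda>x. \<ominus>\<^bsub>R\<^esub> c x"])
    have "{x. \<ominus>\<^bsub>R\<^esub> c x \<noteq> \<zero>\<^bsub>R\<^esub>} \<subseteq> {x. c x \<noteq> \<zero>\<^bsub>R\<^esub>}" by auto
    with that show "(\<lambda>x. \<ominus>\<^bsub>R\<^esub> c x) \<in> carrier (free_module R X)"
      unfolding free_module_def by (auto intro: finite_subset)
  qed (use that in \<open>auto simp: free_module_def l_neg\<close>)
  show ?thesis
  proof (rule left_moduleI)
    show "abelian_group (free_module R X)"
    proof (rule abelian_groupI)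
      fix x assume "x \<in> carrier (free_module R X)"
      then show "\<exists>y\<in>carrier (free_module R X). y \<oplus>\<^bsub>free_module R X\<^esub> x = \<zero>\<^bsub>free_module R X\<^esub>"
        by (rule neg)
    next
      fix c d
      assume "c \<in> carrier (free_module R X)" "d \<in> carrier (free_module R X)"
      then show "c \<oplus>\<^bsub>free_module R X\<^esub> d \<in> carrier (free_module R X)"
        using fin_add[of c d] zz[of c d] unfolding free_module_def by simp
    qed (auto simp: free_module_def a_ac)
  next
    fix r c assume "r \<in> carrier R" "c \<in> carrier (free_module R X)"
    then show "r \<odot>\<^bsub>free_module R X\<^esub> c \<in> carrier (free_module R X)"
      using fin_sm[of c r] by (auto simp: free_module_def)
  qed (auto simp: free_module_def l_distr r_distr m_assoc \<open>ring R\<close>)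
qed

definition free_eval ::
  "('r, 'z) ring_scheme \<Rightarrow> ('r, 'b) module \<Rightarrow> ('p \<Rightarrow> 'b) \<Rightarrow> ('p \<Rightarrow> 'r) \<Rightarrow> 'b" where
  "free_eval R B v c = (\<Oplus>\<^bsub>B\<^esub>x\<in>{x. c x \<noteq> zero R}. c x \<odot>\<^bsub>B\<^esub> v x)"

lemma free_eval_superset:
  assumes "left_module R B" and v: "v \<in> X \<rightarrow> carrier B" and c: "c \<in> carrier (free_module R X)"
    and S: "finite S" "{x. c x \<noteq> zero R} \<subseteq> S" "S \<subseteq> X"
  shows "free_eval R B v c = (\<Oplus>\<^bsub>B\<^esub>x\<in>S. c x \<odot>\<^bsub>B\<^esub> v x)"
proof -
  interpret B: left_module R B by fact
  have cR: "c x \<in> carrier R" for x using c by (auto simp: free_module_def)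
  show ?thesis
    unfolding free_eval_def
    by (rule B.M.add.finprod_mono_neutral_cong_left) (use S v cR in \<open>auto simp: Pi_def subset_iff\<close>)
qed

lemma free_eval_hom:
  assumes lB: "left_module R B" and v: "v \<in> X \<rightarrow> carrier B"
  shows "free_eval R B v \<in> lmod_hom R (free_module R X) B"
proof -
  interpret B: left_module R B by fact
  let ?F = "free_module R X"
  interpret F: left_module R ?F by (rule left_module_free_module) (rule B.R.ring_axioms)
  have cR: "c x \<in> carrier R" and fin: "finite {x. c x \<noteq> zero R}" and sub: "{x. c x \<noteq> zero R} \<subseteq> X"
    if "c \<in> carrier ?F" for c x
    using that by (auto simp: free_module_def)
  have vB: "v x \<in> carrier B" if "x \<in> X" for x using v that by auto
  show ?thesis
    unfolding lmod_hom_def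
  proof (intro CollectI conjI ballI funcsetI)
    fix c assume c: "c \<in> carrier ?F"
    show "free_eval R B v c \<in> carrier B"
      unfolding free_eval_def
      by (rule B.M.finsum_closed) (use cR[OF c] sub[OF c] vB in auto)
  next
    fix c d assume c: "c \<in> carrier ?F" and d: "d \<in> carrier ?F"
    define S where "S = {x. c x \<noteq> zero R} \<union> {x. d x \<noteq> zero R}"
    have S: "finite S" "S \<subseteq> X" using fin[OF c] fin[OF d] sub[OF c] sub[OF d] by (auto simp: S_def)
    have cd: "c \<oplus>\<^bsub>?F\<^esub> d \<in> carrier ?F" using c d by simp
    have e: "(c \<oplus>\<^bsub>?F\<^esub> d) x = c x \<oplus>\<^bsub>R\<^esub> d x" for x by (simp add: free_module_def)
    have "{x. (c \<oplus>\<^bsub>?F\<^esub> d) x \<noteq> zero R} \<subseteq> S" by (auto simp: e S_def)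
    then have "free_eval R B v (c \<oplus>\<^bsub>?F\<^esub> d) = (\<Oplus>\<^bsub>B\<^esub>x\<in>S. (c \<oplus>\<^bsub>?F\<^esub> d) x \<odot>\<^bsub>B\<^esub> v x)"
      by (intro free_eval_superset[OF lB v cd S(1) _ S(2)])
    also have "\<dots> = (\<Oplus>\<^bsub>B\<^esub>x\<in>S. c x \<odot>\<^bsub>B\<^esub> v x \<oplus>\<^bsub>B\<^esub> d x \<odot>\<^bsub>B\<^esub> v x)"
      by (rule B.M.finsum_cong')
        (use S vB cR[OF c] cR[OF d] in \<open>auto simp: e B.smult_l_distr subset_iff\<close>)
    also have "\<dots> = (\<Oplus>\<^bsub>B\<^esub>x\<in>S. c x \<odot>\<^bsub>B\<^esub> v x) \<oplus>\<^bsub>B\<^esub> (\<Oplus>\<^bsub>B\<^esub>x\<in>S. d x \<odot>\<^bsub>B\<^esub> v x)"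
      by (rule B.M.finsum_addf) (use S vB cR[OF c] cR[OF d] in auto)
    also have "(\<Oplus>\<^bsub>B\<^esub>x\<in>S. c x \<odot>\<^bsub>B\<^esub> v x) = free_eval R B v c"
      by (rule free_eval_superset[OF lB v c S(1) _ S(2), symmetric]) (auto simp: S_def)
    also have "(\<Oplus>\<^bsub>B\<^esub>x\<in>S. d x \<odot>\<^bsub>B\<^esub> v x) = free_eval R B v d"
      by (rule free_eval_superset[OF lB v d S(1) _ S(2), symmetric]) (auto simp: S_def)
    finally show "free_eval R B v (c \<oplus>\<^bsub>?F\<^esub> d) = free_eval R B v c \<oplus>\<^bsub>B\<^esub> free_eval R B v d" .
  next
    fix r c assume r: "r \<in> carrier R" and c: "c \<in> carrier ?F"
    define S where "S = {x. c x \<noteq> zero R}"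
    have S: "finite S" "S \<subseteq> X" using fin[OF c] sub[OF c] by (auto simp: S_def)
    have rc: "r \<odot>\<^bsub>?F\<^esub> c \<in> carrier ?F" using r c by simp
    have e: "(r \<odot>\<^bsub>?F\<^esub> c) x = r \<otimes>\<^bsub>R\<^esub> c x" for x by (simp add: free_module_def)
    have "{x. (r \<odot>\<^bsub>?F\<^esub> c) x \<noteq> zero R} \<subseteq> S" using r by (auto simp: e S_def)
    then have "free_eval R B v (r \<odot>\<^bsub>?F\<^esub> c) = (\<Oplus>\<^bsub>B\<^esub>x\<in>S. (r \<odot>\<^bsub>?F\<^esub> c) x \<odot>\<^bsub>B\<^esub> v x)"
      by (intro free_eval_superset[OF lB v rc S(1) _ S(2)])
    also have "\<dots> = (\<Oplus>\<^bsub>B\<^esub>x\<in>S. r \<odot>\<^bsub>B\<^esub> (c x \<odot>\<^bsub>B\<^esub> v x))"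
      by (rule B.M.finsum_cong')
        (use S vB cR[OF c] r in \<open>auto simp: e B.smult_assoc subset_iff\<close>)
    also have "\<dots> = r \<odot>\<^bsub>B\<^esub> (\<Oplus>\<^bsub>B\<^esub>x\<in>S. c x \<odot>\<^bsub>B\<^esub> v x)"
    proof -
      have cl: "(\<lambda>x. c x \<odot>\<^bsub>B\<^esub> v x) \<in> S \<rightarrow> carrier B" using S vB cR[OF c] by auto
      from S(1) cl show ?thesis
      proof (induction S rule: finite_induct)
        case empty then show ?case using r by simp
      next
        case (insert x T) then show ?case using r by (simp add: Pi_def B.smult_r_distr)
      qed
    qed
    finally show "free_eval R B v (r \<odot>\<^bsub>?F\<^esub> c) = r \<odot>\<^bsub>B\<^esub> free_eval R B v c"
      by (simp add: free_eval_def S_def)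
  qed
qed

lemma hom_free_eval:
  assumes lA: "left_module R A" and lB: "left_module R B" and p: "p \<in> lmod_hom R A B"
    and v: "v \<in> X \<rightarrow> carrier A" and c: "c \<in> carrier (free_module R X)"
  shows "p (free_eval R A v c) = free_eval R B (\<lambda>x. p (v x)) c"
proof -
  interpret A: left_module R A by fact
  interpret B: left_module R B by fact
  define S where "S = {x. c x \<noteq> zero R}"
  have cR: "c x \<in> carrier R" for x using c by (auto simp: free_module_def)
  have S: "finite S" "S \<subseteq> X" using c by (auto simp: free_module_def S_def)
  have vA: "v x \<in> carrier A" if "x \<in> X" for x using v that by auto
  have "p (\<Oplus>\<^bsub>A\<^esub>x\<in>S. c x \<odot>\<^bsub>A\<^esub> v x) = (\<Oplus>\<^bsub>B\<^esub>x\<in>S. c x \<odot>\<^bsub>B\<^esub> p (v x))"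
    using S
  proof (induction S rule: finite_induct)
    case empty then show ?case using lmod_hom_zero[OF lA lB p] by simp
  next
    case (insert x T)
    then show ?case
      using vA cR by (simp add: Pi_def subset_iff lmod_homD[OF p])
  qed
  then show ?thesis by (simp add: free_eval_def S_def)
qed

lemma projective_module_any_type:
  fixes R :: "('r, 'z) ring_scheme" and P :: "('r, 'p) module"
  assumes proj: "projective_module R P"
  shows "projective_wrt TYPE('a) TYPE('b) R P"
proof -
  have lP: "left_module R P"
    using proj unfolding projective_module_def projective_wrt_def by blast
  interpret P: left_module R P by fact
  let ?F = "free_module R (carrier P)" and ?e = "free_eval R P (\<lambda>x. x)"
  have lF: "left_module R ?F" by (rule left_module_free_module) (rule P.R.ring_axioms)
  have e: "?e \<in> lmod_hom R ?F P" by (rule free_eval_hom[OF lP]) auto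
  have "?e ` carrier ?F = carrier P"
  proof
    show "?e ` carrier ?F \<subseteq> carrier P" using lmod_homD(1)[OF e] by auto
    show "carrier P \<subseteq> ?e ` carrier ?F"
    proof
      fix x assume x: "x \<in> carrier P"
      define c where "c y = (if y = x then \<one>\<^bsub>R\<^esub> else \<zero>\<^bsub>R\<^esub>)" for y
      have sup: "{y. c y \<noteq> \<zero>\<^bsub>R\<^esub>} \<subseteq> {x}" by (auto simp: c_def)
      then have c: "c \<in> carrier ?F"
        using x finite_subset[OF sup] by (auto simp: free_module_def c_def)
      have "?e c = (\<Oplus>\<^bsub>P\<^esub>y\<in>{x}. c y \<odot>\<^bsub>P\<^esub> y)"
        by (rule free_eval_superset[OF lP _ c _ sup]) (use x in auto)
      also have "\<dots> = x" using x by (simp add: c_def)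
      finally show "x \<in> ?e ` carrier ?F" using c by (metis imageI)
    qed
  qed
  moreover have "(\<lambda>x. x) \<in> lmod_hom R P P" by (auto simp: lmod_hom_def)
  ultimately obtain s where s: "s \<in> lmod_hom R P ?F" and es: "\<And>x. x \<in> carrier P \<Longrightarrow> ?e (s x) = x"
    using proj lF lP e unfolding projective_module_def projective_wrt_def by meson
  have "\<exists>g\<in>lmod_hom R P A. \<forall>x\<in>carrier P. p (g x) = f x"
    if lA: "left_module R A" and lB: "left_module R B" and p: "p \<in> lmod_hom R A B"
      and sur: "p ` carrier A = carrier B" and f: "f \<in> lmod_hom R P B"
    for A :: "('r, 'a) module" and B :: "('r, 'b) module" and p f
  proof -
    have "\<forall>x\<in>carrier P. \<exists>a\<in>carrier A. p a = f x"
      using lmod_homD(1)[OF f] sur by (metis imageE)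
    then obtain v where v: "\<And>x. x \<in> carrier P \<Longrightarrow> v x \<in> carrier A"
      and pv: "\<And>x. x \<in> carrier P \<Longrightarrow> p (v x) = f x" by metis
    have vP: "v \<in> carrier P \<rightarrow> carrier A" using v by auto
    let ?g = "\<lambda>x. free_eval R A v (s x)"
    have ev: "free_eval R A v \<in> lmod_hom R ?F A" by (rule free_eval_hom[OF lA vP])
    have "?g \<in> lmod_hom R P A"
      using lmod_homD[OF s] lmod_homD[OF ev] by (auto simp: lmod_hom_def)
    moreover have "p (?g x) = f x" if x: "x \<in> carrier P" for x
    proof -
      have sx: "s x \<in> carrier ?F" by (rule lmod_homD(1)[OF s x])
      have "p (?g x) = free_eval R B (\<lambda>y. p (v y)) (s x)"
        by (rule hom_free_eval[OF lA lB p vP sx])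
      also have "\<dots> = free_eval R B (\<lambda>y. f y) (s x)"
      proof -
        interpret B: left_module R B by fact
        show ?thesis unfolding free_eval_def
          by (rule B.M.finsum_cong')
            (use sx lmod_homD(1)[OF f] pv in \<open>auto simp: free_module_def subset_iff\<close>)
      qed
      also have "\<dots> = f (?e (s x))"
        by (rule hom_free_eval[OF lP lB f _ sx, symmetric]) auto
      finally show ?thesis using es[OF x] by simp
    qed
    ultimately show ?thesis by (intro bexI[of _ ?g] ballI)
  qed
  then show ?thesis unfolding projective_wrt_def using lP by blast
qed

(* Elements are the finitely supported functions vanishing outside the carrier of M;
   f stands for the formal sum of the f x * x. *)

definition monoid_algebra :: "'k itself \<Rightarrow> ('m, 'z) monoid_scheme \<Rightarrow> ('m \<Rightarrow> 'k :: field) ring" where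
  "monoid_algebra TK M = \<lparr>
     carrier = {f. finite {x. f x \<noteq> 0} \<and> {x. f x \<noteq> 0} \<subseteq> carrier M},
     monoid.mult = (\<lambda>f g x. \<Sum>a\<in>{a. f a \<noteq> 0}. \<Sum>b\<in>{b. g b \<noteq> 0}.
                            if a \<otimes>\<^bsub>M\<^esub> b = x then f a * g b else 0),
     one = (\<lambda>x. if x = \<one>\<^bsub>M\<^esub> then 1 else 0),
     zero = (\<lambda>x. 0),
     add = (\<lambda>f g x. f x + g x)\<rparr>"

lemma monoid_algebra_mult_superset:
  assumes "finite S" "{a. f a \<noteq> 0} \<subseteq> S" "finite T" "{b. g b \<noteq> 0} \<subseteq> T"
  shows "(f \<otimes>\<^bsub>monoid_algebra TK M\<^esub> g) x =
    (\<Sum>a\<in>S. \<Sum>b\<in>T. if a \<otimes>\<^bsub>M\<^esub> b = x then f a * g b else 0)"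
proof -
  have "(f \<otimes>\<^bsub>monoid_algebra TK M\<^esub> g) x =
    (\<Sum>a\<in>{a. f a \<noteq> 0}. \<Sum>b\<in>{b. g b \<noteq> 0}. if a \<otimes>\<^bsub>M\<^esub> b = x then f a * g b else 0)"
    by (simp add: monoid_algebra_def)
  also have "\<dots> = (\<Sum>a\<in>{a. f a \<noteq> 0}. \<Sum>b\<in>T. if a \<otimes>\<^bsub>M\<^esub> b = x then f a * g b else 0)"
    by (intro sum.cong sum.mono_neutral_left) (use assms in auto)
  also have "\<dots> = (\<Sum>a\<in>S. \<Sum>b\<in>T. if a \<otimes>\<^bsub>M\<^esub> b = x then f a * g b else 0)"
  proof (rule sum.mono_neutral_left)
    show "\<forall>a\<in>S - {a. f a \<noteq> 0}. (\<Sum>b\<in>T. if a \<otimes>\<^bsub>M\<^esub> b = x then f a * g b else 0) = 0"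
      by (simp cong: if_cong)
  qed (use assms in auto)
  finally show ?thesis .
qed

lemma monoid_algebra_simps [simp]:
  "\<one>\<^bsub>monoid_algebra TK M\<^esub> = (\<lambda>x. if x = \<one>\<^bsub>M\<^esub> then 1 else 0)"
  "\<zero>\<^bsub>monoid_algebra TK M\<^esub> = (\<lambda>x. 0)"
  "f \<oplus>\<^bsub>monoid_algebra TK M\<^esub> g = (\<lambda>x. f x + g x)"
  by (simp_all add: monoid_algebra_def)

lemma monoid_algebra_carrier_iff:
  "f \<in> carrier (monoid_algebra TK M) \<longleftrightarrow> finite {x. f x \<noteq> 0} \<and> {x. f x \<noteq> 0} \<subseteq> carrier M"
  by (simp add: monoid_algebra_def)

lemma monoid_algebra_mult_supp:
  fixes TK :: "'k :: field itself"
  shows "{x. (f \<otimes>\<^bsub>monoid_algebra TK M\<^esub> g) x \<noteq> 0} \<subseteq>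
     (\<lambda>(a, b). a \<otimes>\<^bsub>M\<^esub> b) ` ({a. f a \<noteq> 0} \<times> {b. g b \<noteq> 0})"
proof (rule subsetI, rule ccontr)
  fix x assume x: "x \<in> {x. (f \<otimes>\<^bsub>monoid_algebra TK M\<^esub> g) x \<noteq> 0}"
    and n: "x \<notin> (\<lambda>(a, b). a \<otimes>\<^bsub>M\<^esub> b) ` ({a. f a \<noteq> 0} \<times> {b. g b \<noteq> 0})"
  have "(f \<otimes>\<^bsub>monoid_algebra TK M\<^esub> g) x = 0"
    unfolding monoid_algebra_def by (auto intro!: sum.neutral) (use n in force)
  with x show False by simp
qed

lemma ring_monoid_algebra:
  fixes M :: "('m, 'z) monoid_scheme" (structure)
  assumes "Group.monoid M"
  shows "ring (monoid_algebra TYPE('k :: field) M)"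
proof -
  interpret Group.monoid M by fact
  let ?K = "monoid_algebra TYPE('k) M"
  note iff = monoid_algebra_carrier_iff
  have add: "(\<lambda>x. f x + g x) \<in> carrier ?K" if "f \<in> carrier ?K" "g \<in> carrier ?K" for f g
  proof -
    have "{x. f x + g x \<noteq> 0} \<subseteq> {x. f x \<noteq> 0} \<union> {x. g x \<noteq> 0}" by auto
    then show ?thesis using that unfolding iff
      by (meson Un_least finite_UnI finite_subset subset_trans)
  qed
  have mult: "f \<otimes>\<^bsub>?K\<^esub> g \<in> carrier ?K" if "f \<in> carrier ?K" "g \<in> carrier ?K" for f g
  proof -
    have "finite ((\<lambda>(a, b). a \<otimes> b) ` ({a. f a \<noteq> 0} \<times> {b. g b \<noteq> 0}))"
      "(\<lambda>(a, b). a \<otimes> b) ` ({a. f a \<noteq> 0} \<times> {b. g b \<noteq> 0}) \<subseteq> carrier M"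
      using that unfolding iff by auto
    then show ?thesis unfolding iff
      using monoid_algebra_mult_supp[where f = f and g = g and M = M and TK = "TYPE('k)"]
      by (meson finite_subset subset_trans)
  qed
  have one: "\<one>\<^bsub>?K\<^esub> \<in> carrier ?K"
    unfolding iff by (auto intro: finite_subset[of _ "{\<one>}"])
  have neg: "\<exists>g\<in>carrier ?K. g \<oplus>\<^bsub>?K\<^esub> f = \<zero>\<^bsub>?K\<^esub>" if "f \<in> carrier ?K" for f
    by (rule bexI[of _ "\<lambda>x. - f x"]) (use that in \<open>auto simp: iff\<close>)
  have assoc: "(f \<otimes>\<^bsub>?K\<^esub> g) \<otimes>\<^bsub>?K\<^esub> h = f \<otimes>\<^bsub>?K\<^esub> (g \<otimes>\<^bsub>?K\<^esub> h)"
    if f: "f \<in> carrier ?K" and g: "g \<in> carrier ?K" and h: "h \<in> carrier ?K" for f g h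
  proof
    fix x
    define A where "A = {a. f a \<noteq> 0}"
    define B where "B = {a. g a \<noteq> 0}"
    define C where "C = {a. h a \<noteq> 0}"
    define U where "U = (\<lambda>(a, b). a \<otimes> b) ` (A \<times> B)"
    define V where "V = (\<lambda>(a, b). a \<otimes> b) ` (B \<times> C)"
    have fin: "finite A" "finite B" "finite C" "finite U" "finite V"
      and sub: "A \<subseteq> carrier M" "B \<subseteq> carrier M" "C \<subseteq> carrier M"
      using f g h unfolding iff A_def B_def C_def U_def V_def by auto
    have U: "{x. (f \<otimes>\<^bsub>?K\<^esub> g) x \<noteq> 0} \<subseteq> U" and V: "{x. (g \<otimes>\<^bsub>?K\<^esub> h) x \<noteq> 0} \<subseteq> V"
      unfolding U_def V_def A_def B_def C_def by (rule monoid_algebra_mult_supp)+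
    have "((f \<otimes>\<^bsub>?K\<^esub> g) \<otimes>\<^bsub>?K\<^esub> h) x =
        (\<Sum>u\<in>U. \<Sum>c\<in>C. if u \<otimes> c = x then (f \<otimes>\<^bsub>?K\<^esub> g) u * h c else 0)"
      by (rule monoid_algebra_mult_superset) (use fin U in \<open>auto simp: C_def\<close>)
    also have "\<dots> = (\<Sum>u\<in>U. \<Sum>c\<in>C. \<Sum>a\<in>A. \<Sum>b\<in>B.
        if a \<otimes> b = u then (if u \<otimes> c = x then f a * g b * h c else 0) else 0)"
    proof (intro sum.cong refl)
      fix u c
      have "(f \<otimes>\<^bsub>?K\<^esub> g) u = (\<Sum>a\<in>A. \<Sum>b\<in>B. if a \<otimes> b = u then f a * g b else 0)"
        by (rule monoid_algebra_mult_superset) (use fin in \<open>auto simp: A_def B_def\<close>)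
      then show "(if u \<otimes> c = x then (f \<otimes>\<^bsub>?K\<^esub> g) u * h c else 0) = (\<Sum>a\<in>A. \<Sum>b\<in>B.
        if a \<otimes> b = u then (if u \<otimes> c = x then f a * g b * h c else 0) else 0)"
        by (cases "u \<otimes> c = x") (auto simp: sum_distrib_right cong: if_cong intro!: sum.cong)
    qed
    also have "\<dots> = (\<Sum>c\<in>C. \<Sum>a\<in>A. \<Sum>b\<in>B. \<Sum>u\<in>U.
        if a \<otimes> b = u then (if u \<otimes> c = x then f a * g b * h c else 0) else 0)"
      by (subst sum.swap, rule sum.cong[OF refl], subst sum.swap, rule sum.cong[OF refl],
          subst sum.swap, rule refl)
    also have "\<dots> = (\<Sum>c\<in>C. \<Sum>a\<in>A. \<Sum>b\<in>B. if a \<otimes> b \<otimes> c = x then f a * g b * h c else 0)"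
      by (intro sum.cong refl) (use fin in \<open>auto simp: sum.delta' sum.delta U_def\<close>)
    also have "\<dots> = (\<Sum>a\<in>A. \<Sum>b\<in>B. \<Sum>c\<in>C. if a \<otimes> b \<otimes> c = x then f a * g b * h c else 0)"
      by (subst sum.swap, rule sum.cong[OF refl], subst sum.swap, rule refl)
    also have "\<dots> = (\<Sum>a\<in>A. \<Sum>b\<in>B. \<Sum>c\<in>C. if a \<otimes> (b \<otimes> c) = x then f a * (g b * h c) else 0)"
      by (intro sum.cong refl) (use sub in \<open>auto simp: m_assoc subset_iff mult.assoc\<close>)
    also have "\<dots> = (\<Sum>a\<in>A. \<Sum>b\<in>B. \<Sum>c\<in>C. \<Sum>v\<in>V.
        if b \<otimes> c = v then (if a \<otimes> v = x then f a * (g b * h c) else 0) else 0)"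
      by (intro sum.cong refl) (use fin in \<open>auto simp: sum.delta' sum.delta V_def\<close>)
    also have "\<dots> = (\<Sum>a\<in>A. \<Sum>b\<in>B. \<Sum>v\<in>V. \<Sum>c\<in>C.
        if b \<otimes> c = v then (if a \<otimes> v = x then f a * (g b * h c) else 0) else 0)"
      by (rule sum.cong[OF refl], rule sum.cong[OF refl], subst sum.swap, rule refl)
    also have "\<dots> = (\<Sum>a\<in>A. \<Sum>v\<in>V. \<Sum>b\<in>B. \<Sum>c\<in>C.
        if b \<otimes> c = v then (if a \<otimes> v = x then f a * (g b * h c) else 0) else 0)"
      by (rule sum.cong[OF refl], subst sum.swap, rule refl)
    also have "\<dots> = (\<Sum>a\<in>A. \<Sum>v\<in>V. if a \<otimes> v = x then f a * (g \<otimes>\<^bsub>?K\<^esub> h) v else 0)"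
    proof (intro sum.cong refl)
      fix a v
      have "(g \<otimes>\<^bsub>?K\<^esub> h) v = (\<Sum>b\<in>B. \<Sum>c\<in>C. if b \<otimes> c = v then g b * h c else 0)"
        by (rule monoid_algebra_mult_superset) (use fin in \<open>auto simp: B_def C_def\<close>)
      then show "(\<Sum>b\<in>B. \<Sum>c\<in>C.
        if b \<otimes> c = v then (if a \<otimes> v = x then f a * (g b * h c) else 0) else 0) =
        (if a \<otimes> v = x then f a * (g \<otimes>\<^bsub>?K\<^esub> h) v else 0)"
        by (cases "a \<otimes> v = x") (auto simp: sum_distrib_left cong: if_cong intro!: sum.cong)
    qed
    also have "\<dots> = (f \<otimes>\<^bsub>?K\<^esub> (g \<otimes>\<^bsub>?K\<^esub> h)) x"
      by (rule monoid_algebra_mult_superset[symmetric]) (use fin V in \<open>auto simp: A_def\<close>)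
    finally show "((f \<otimes>\<^bsub>?K\<^esub> g) \<otimes>\<^bsub>?K\<^esub> h) x = (f \<otimes>\<^bsub>?K\<^esub> (g \<otimes>\<^bsub>?K\<^esub> h)) x" .
  qed
  have l_one: "\<one>\<^bsub>?K\<^esub> \<otimes>\<^bsub>?K\<^esub> f = f" if f: "f \<in> carrier ?K" for f
  proof
    fix x
    have sub: "a \<in> carrier M" if "f a \<noteq> 0" for a using f that unfolding iff by auto
    have fin: "finite {a. f a \<noteq> 0}" using f unfolding iff by auto
    have "(\<one>\<^bsub>?K\<^esub> \<otimes>\<^bsub>?K\<^esub> f) x =
        (\<Sum>a\<in>{\<one>}. \<Sum>b\<in>{a. f a \<noteq> 0}. if a \<otimes> b = x then \<one>\<^bsub>?K\<^esub> a * f b else 0)"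
      by (rule monoid_algebra_mult_superset) (use fin in auto)
    also have "\<dots> = (\<Sum>b\<in>{a. f a \<noteq> 0}. if b = x then f b else 0)"
      by simp (intro sum.cong refl, use sub in auto)
    also have "\<dots> = f x" using fin by (auto simp: sum.delta sum.delta')
    finally show "(\<one>\<^bsub>?K\<^esub> \<otimes>\<^bsub>?K\<^esub> f) x = f x" .
  qed
  have r_one: "f \<otimes>\<^bsub>?K\<^esub> \<one>\<^bsub>?K\<^esub> = f" if f: "f \<in> carrier ?K" for f
  proof
    fix x
    have sub: "a \<in> carrier M" if "f a \<noteq> 0" for a using f that unfolding iff by auto
    have fin: "finite {a. f a \<noteq> 0}" using f unfolding iff by auto
    have "(f \<otimes>\<^bsub>?K\<^esub> \<one>\<^bsub>?K\<^esub>) x =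
        (\<Sum>a\<in>{a. f a \<noteq> 0}. \<Sum>b\<in>{\<one>}. if a \<otimes> b = x then f a * \<one>\<^bsub>?K\<^esub> b else 0)"
      by (rule monoid_algebra_mult_superset) (use fin in auto)
    also have "\<dots> = (\<Sum>b\<in>{a. f a \<noteq> 0}. if b = x then f b else 0)"
      by simp (intro sum.cong refl, use sub in auto)
    also have "\<dots> = f x" using fin by (auto simp: sum.delta sum.delta')
    finally show "(f \<otimes>\<^bsub>?K\<^esub> \<one>\<^bsub>?K\<^esub>) x = f x" .
  qed
  have distr: "(f \<oplus>\<^bsub>?K\<^esub> g) \<otimes>\<^bsub>?K\<^esub> h = f \<otimes>\<^bsub>?K\<^esub> h \<oplus>\<^bsub>?K\<^esub> g \<otimes>\<^bsub>?K\<^esub> h"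
      "h \<otimes>\<^bsub>?K\<^esub> (f \<oplus>\<^bsub>?K\<^esub> g) = h \<otimes>\<^bsub>?K\<^esub> f \<oplus>\<^bsub>?K\<^esub> h \<otimes>\<^bsub>?K\<^esub> g"
    if f: "f \<in> carrier ?K" and g: "g \<in> carrier ?K" and h: "h \<in> carrier ?K" for f g h
  proof -
    define S where "S = {a. f a \<noteq> 0} \<union> {a. g a \<noteq> 0}"
    define T where "T = {a. h a \<noteq> 0}"
    have fin: "finite S" "finite T" using f g h unfolding iff S_def T_def by auto
    have s: "{a. f a \<noteq> 0} \<subseteq> S" "{a. g a \<noteq> 0} \<subseteq> S" "{a. f a + g a \<noteq> 0} \<subseteq> S" "{a. h a \<noteq> 0} \<subseteq> T"
      by (auto simp: S_def T_def)
    show "(f \<oplus>\<^bsub>?K\<^esub> g) \<otimes>\<^bsub>?K\<^esub> h = f \<otimes>\<^bsub>?K\<^esub> h \<oplus>\<^bsub>?K\<^esub> g \<otimes>\<^bsub>?K\<^esub> h"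
      by (rule ext) (simp add: monoid_algebra_mult_superset[OF fin(1) s(1) fin(2) s(4)]
          monoid_algebra_mult_superset[OF fin(1) s(2) fin(2) s(4)]
          monoid_algebra_mult_superset[OF fin(1) s(3) fin(2) s(4)] sum.distrib[symmetric]
          distrib_right if_distrib cong: if_cong sum.cong)
    show "h \<otimes>\<^bsub>?K\<^esub> (f \<oplus>\<^bsub>?K\<^esub> g) = h \<otimes>\<^bsub>?K\<^esub> f \<oplus>\<^bsub>?K\<^esub> h \<otimes>\<^bsub>?K\<^esub> g"
      by (rule ext) (simp add: monoid_algebra_mult_superset[OF fin(2) s(4) fin(1) s(1)]
          monoid_algebra_mult_superset[OF fin(2) s(4) fin(1) s(2)]
          monoid_algebra_mult_superset[OF fin(2) s(4) fin(1) s(3)] sum.distrib[symmetric]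
          distrib_left if_distrib cong: if_cong sum.cong)
  qed
  show ?thesis
  proof (rule ringI)
    show "abelian_group ?K"
      by (rule abelian_groupI) (use add neg in \<open>auto simp: iff ac_simps\<close>)
    show "Group.monoid ?K"
      by (rule Group.monoidI) (use mult one assoc l_one r_one in auto)
  qed (use distr in auto)
qed

(* The algebra of the group of units of M consists of functions on the same type as that of M,
   vanishing outside Units M. Letting the non-units act as 0 is restricting f to Units M. *)

definition Ind ::
  "('m, 'z) monoid_scheme \<Rightarrow> ('m \<Rightarrow> 'k :: field, 'w) module \<Rightarrow> ('m \<Rightarrow> 'k, 'w) module" where
  "Ind M W = W\<lparr>smult := (\<lambda>f w. (\<lambda>x. if x \<in> Units M then f x else 0) \<odot>\<^bsub>W\<^esub> w)\<rparr>"

lemma finite_monoid_Units_factor: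
  fixes M (structure)
  assumes "Group.monoid M" "finite (carrier M)" and a: "a \<in> carrier M" and b: "b \<in> carrier M"
    and u: "a \<otimes> b \<in> Units M"
  shows "a \<in> Units M" "b \<in> Units M"
proof -
  interpret Group.monoid M by fact
  have one_sided: "y \<otimes> x = \<one>" if x: "x \<in> carrier M" and y: "y \<in> carrier M" and xy: "x \<otimes> y = \<one>" for x y
  proof -
    have inj: "inj_on (\<lambda>z. y \<otimes> z) (carrier M)"
    proof (rule inj_onI)
      fix z z' assume "z \<in> carrier M" "z' \<in> carrier M" "y \<otimes> z = y \<otimes> z'"
      then show "z = z'" using x y xy by (metis l_one m_assoc)
    qed
    have "(\<lambda>z. y \<otimes> z) ` carrier M = carrier M"
      by (rule endo_inj_surj) (use y inj assms(2) in auto)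
    then obtain z where z: "z \<in> carrier M" "y \<otimes> z = \<one>" by (metis imageE one_closed)
    then have "z = x" using x y xy by (metis l_one m_assoc r_one)
    with z show ?thesis by simp
  qed
  let ?v = "inv (a \<otimes> b)"
  have v: "?v \<in> carrier M" "(a \<otimes> b) \<otimes> ?v = \<one>" "?v \<otimes> (a \<otimes> b) = \<one>" using u by auto
  have "a \<otimes> (b \<otimes> ?v) = \<one>" "(?v \<otimes> a) \<otimes> b = \<one>" using v a b by (simp_all add: m_assoc)
  then show "a \<in> Units M" "b \<in> Units M"
    using one_sided[of a "b \<otimes> ?v"] one_sided[of "?v \<otimes> a" b] a b v unfolding Units_def by auto
qed

lemma left_module_Ind:
  fixes M (structure)
  assumes M: "Group.monoid M" and fin: "finite (carrier M)"
    and W: "left_module (monoid_algebra TYPE('k :: field) (units_of M)) W"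
  shows "left_module (monoid_algebra TYPE('k) M) (Ind M W)"
proof -
  interpret Group.monoid M by fact
  let ?K = "monoid_algebra TYPE('k) M" and ?G = "monoid_algebra TYPE('k) (units_of M)"
  interpret W: left_module ?G W by fact
  define \<rho> :: "('a \<Rightarrow> 'k) \<Rightarrow> 'a \<Rightarrow> 'k" where "\<rho> f = (\<lambda>x. if x \<in> Units M then f x else 0)" for f
  have sm: "f \<odot>\<^bsub>Ind M W\<^esub> w = \<rho> f \<odot>\<^bsub>W\<^esub> w" for f w by (simp add: Ind_def \<rho>_def)
  have cl: "\<rho> f \<in> carrier ?G" if "f \<in> carrier ?K" for f
  proof -
    have "{x. \<rho> f x \<noteq> 0} \<subseteq> {x. f x \<noteq> 0}" by (auto simp: \<rho>_def)
    moreover have "{x. \<rho> f x \<noteq> 0} \<subseteq> Units M" by (auto simp: \<rho>_def)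
    ultimately show ?thesis
      using that by (auto simp: monoid_algebra_carrier_iff units_of_carrier intro: finite_subset)
  qed
  have add: "\<rho> (f \<oplus>\<^bsub>?K\<^esub> g) = \<rho> f \<oplus>\<^bsub>?G\<^esub> \<rho> g" for f g by (auto simp: \<rho>_def)
  have one: "\<rho> \<one>\<^bsub>?K\<^esub> = \<one>\<^bsub>?G\<^esub>" by (auto simp: \<rho>_def units_of_one)
  have mult: "\<rho> (f \<otimes>\<^bsub>?K\<^esub> g) = \<rho> f \<otimes>\<^bsub>?G\<^esub> \<rho> g" if f: "f \<in> carrier ?K" and g: "g \<in> carrier ?K" for f g
  proof
    fix x
    have sub: "{a. f a \<noteq> 0} \<subseteq> carrier M" "{a. g a \<noteq> 0} \<subseteq> carrier M"
      using f g by (auto simp: monoid_algebra_carrier_iff)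
    have "(\<rho> f \<otimes>\<^bsub>?G\<^esub> \<rho> g) x =
        (\<Sum>a\<in>carrier M. \<Sum>b\<in>carrier M. if a \<otimes>\<^bsub>units_of M\<^esub> b = x then \<rho> f a * \<rho> g b else 0)"
      by (rule monoid_algebra_mult_superset) (use fin in \<open>auto simp: \<rho>_def\<close>)
    also have "\<dots> = (\<Sum>a\<in>carrier M. \<Sum>b\<in>carrier M.
        if a \<otimes> b = x then (if x \<in> Units M then f a * g b else 0) else 0)"
    proof (intro sum.cong refl)
      fix a b assume ab: "a \<in> carrier M" "b \<in> carrier M"
      have "a \<otimes> b \<in> Units M \<longleftrightarrow> a \<in> Units M \<and> b \<in> Units M"
        using finite_monoid_Units_factor[OF M fin ab] by auto
      then show "(if a \<otimes>\<^bsub>units_of M\<^esub> b = x then \<rho> f a * \<rho> g b else 0) =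
          (if a \<otimes> b = x then (if x \<in> Units M then f a * g b else 0) else 0)"
        by (auto simp: \<rho>_def units_of_mult)
    qed
    also have "\<dots> = (if x \<in> Units M then (f \<otimes>\<^bsub>?K\<^esub> g) x else 0)"
      using monoid_algebra_mult_superset[OF fin sub(1) fin sub(2), of "TYPE('k)" M x]
      by (cases "x \<in> Units M") (simp_all cong: if_cong)
    finally show "\<rho> (f \<otimes>\<^bsub>?K\<^esub> g) x = (\<rho> f \<otimes>\<^bsub>?G\<^esub> \<rho> g) x" by (simp add: \<rho>_def)
  qed
  have Ind: "carrier (Ind M W) = carrier W" "\<zero>\<^bsub>Ind M W\<^esub> = \<zero>\<^bsub>W\<^esub>"
    "x \<oplus>\<^bsub>Ind M W\<^esub> y = x \<oplus>\<^bsub>W\<^esub> y" for x y by (simp_all add: Ind_def)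
  show ?thesis
  proof (rule left_moduleI)
    show "ring ?K" by (rule ring_monoid_algebra[OF M])
    show "abelian_group (Ind M W)"
    proof (rule abelian_groupI)
      fix x assume "x \<in> carrier (Ind M W)"
      then show "\<exists>y\<in>carrier (Ind M W). y \<oplus>\<^bsub>Ind M W\<^esub> x = \<zero>\<^bsub>Ind M W\<^esub>"
        unfolding Ind by (metis W.M.l_neg W.M.a_inv_closed)
    qed (auto simp: Ind W.M.a_ac)
  qed (use cl in \<open>simp_all only: Ind sm add mult one W.smult_closed W.smult_l_distr
      W.smult_r_distr W.smult_assoc W.smult_one\<close>)
qed

(* For finite M every projective indecomposable kG-module is isomorphic to a left ideal of kG,
   so it is enough to let P have its carrier in the type of kG. *)

definition group_injective :: "'k :: field itself \<Rightarrow> ('m, 'z) monoid_scheme \<Rightarrow> bool" where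
  "group_injective TK M \<longleftrightarrow>
     (\<exists>P :: ('m \<Rightarrow> 'k, 'm \<Rightarrow> 'k) module.
        projective_module (monoid_algebra TK (units_of M)) P \<and>
        indecomposable_module (monoid_algebra TK (units_of M)) P \<and>
        injective_module (monoid_algebra TK M) (Ind M P))"

definition full_linear_monoid :: "'f :: field itself \<Rightarrow> nat \<Rightarrow> 'f mat monoid" where
  "full_linear_monoid TF m = \<lparr>carrier = carrier_mat m m, monoid.mult = (*), one = 1\<^sub>m m\<rparr>"

lemma monoid_full_linear_monoid: "Group.monoid (full_linear_monoid TYPE('f :: field) m)"
  by (rule Group.monoidI) (auto simp: full_linear_monoid_def)

end

theory Submission
  imports Defs "Jordan_Normal_Form.Determinant" "HOL-Library.Function_Algebras"
    "HOL-Number_Theory.Cong"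
begin

text \<open>Let J be the span of the singular matrices in kM. Suppose that J has a left identity e, and let
  \<epsilon> be a primitive idempotent of kG. Then Ind(kG \<epsilon>) is injective: since e acts on it as 0, a
  homomorphism f from a submodule A of B satisfies f(x) = f((1 - e) x). Extend the linear functional
  on A taking x to the coefficient of f(x) at 1 to a functional \<Psi> on B; then mapping b to the
  sum of \<Psi>((1 - e) g^(-1) b) g over g in G, followed by right multiplication with \<epsilon>, extends f,
  and it is kM-linear because (1 - e) J = 0.

  The left identity is Kovacs' theorem. Let \<chi> be a nontrivial additive character of F with values
  in k, which exists because k contains p-th roots of unity for p = char F. The pairing \<chi>(tr(AB)) is
  nondegenerate on matrices, as distinct characters are linearly independent, and by induction on s
  it stays nondegenerate when both sides are restricted to matrices of rank at most s. Hence some e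
  in J pairs with every singular A to \<chi>(tr A), and e is a left identity of J.\<close>

section \<open>Linear equations and characters\<close>

text \<open>The characteristic of k may divide the order of GL_m(F), so neither averaging over the
  group nor semisimplicity of kG is available. Two facts replace them: linear functionals over a
  field always extend, and a homomorphism into kG is recovered from its coefficient at 1 by f(x)(g)
  = (g^(-1) f(x))(1). For e, the obstacle is that the singular matrices are in general not closed
  under addition, so Fourier inversion on all matrices says nothing directly about a pairing
  restricted to them. Hence the induction on the rank bound; it is run for rectangular matrices
  because its step passes to factors of size m x (s + 1) and (s + 1) x (s + 1). Once nondegeneracy
  is known, e solves a square linear system over k. It is a left identity because e X and X have the
  same Fourier transform: for singular X, tr(C B X) = tr((X C) B), and X C is again
  singular.\<close>

lemma fredholm_alternative:
  fixes c :: "'s \<Rightarrow> 't \<Rightarrow> 'k :: field"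
  assumes "finite T" "finite S"
    and "\<And>\<phi>. (\<forall>t\<in>T. (\<Sum>s\<in>S. \<phi> s * c s t) = 0) \<Longrightarrow> (\<Sum>s\<in>S. \<phi> s * y s) = 0"
  shows "\<exists>x. \<forall>s\<in>S. (\<Sum>t\<in>T. c s t * x t) = y s"
  using assms(1,3)
proof (induction T arbitrary: y rule: finite_induct)
  case empty
  have "y s = 0" if "s \<in> S" for s
    using empty[of "\<lambda>r. if r = s then 1 else 0"] that assms(2)
    by (simp add: if_distrib[of "\<lambda>z. z * _"] cong: if_cong)
  then show ?case by simp
next
  case (insert t T)
  show ?case
  \<comment> \<open>If every row relation on \<open>T\<close> also annihilates column
    \<open>t\<close>, the unknown at \<open>t\<close> can be set to 0. Otherwise some relation
    \<open>\<phi>\<close> on \<open>T\<close> detects column \<open>t\<close>.\<close>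
  proof (cases "\<forall>\<phi>. (\<forall>t\<in>T. (\<Sum>s\<in>S. \<phi> s * c s t) = 0) \<longrightarrow> (\<Sum>s\<in>S. \<phi> s * c s t) = 0")
    case True
    have "\<exists>x. \<forall>s\<in>S. (\<Sum>t\<in>T. c s t * x t) = y s"
    proof (rule insert.IH)
      fix \<phi> assume "\<forall>t\<in>T. (\<Sum>s\<in>S. \<phi> s * c s t) = 0"
      then show "(\<Sum>s\<in>S. \<phi> s * y s) = 0"
        by (intro insert.prems ballI) (use True in auto)
    qed
    then obtain x where x: "\<forall>s\<in>S. (\<Sum>t\<in>T. c s t * x t) = y s" by blast
    have "(\<Sum>r\<in>insert t T. c s r * (x(t := 0)) r) = y s" if "s \<in> S" for s
    proof -
      have "(\<Sum>r\<in>T. c s r * (x(t := 0)) r) = (\<Sum>r\<in>T. c s r * x r)"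
        by (rule sum.cong) (use insert.hyps in auto)
      then show ?thesis using insert.hyps x that by simp
    qed
    then show ?thesis by blast
  next
    case False
    then obtain \<phi> where \<phi>: "\<forall>t\<in>T. (\<Sum>s\<in>S. \<phi> s * c s t) = 0" and a: "(\<Sum>s\<in>S. \<phi> s * c s t) \<noteq> 0"
      by blast
    define a where "a = (\<Sum>s\<in>S. \<phi> s * c s t)"
    \<comment> \<open>Applying \<open>\<phi>\<close> to the equations forces this value of the
      unknown at \<open>t\<close>. The reduced right-hand side stays consistent, because any
      relation \<open>\<theta>\<close> on \<open>T\<close> becomes one on \<open>insert t T\<close>
      after subtracting a multiple of \<open>\<phi>\<close>.\<close>
    define b where "b = (\<Sum>s\<in>S. \<phi> s * y s) / a"
    have "(\<Sum>s\<in>S. \<theta> s * (y s - c s t * b)) = 0"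
      if \<theta>: "\<forall>t\<in>T. (\<Sum>s\<in>S. \<theta> s * c s t) = 0" for \<theta>
    proof -
      define d where "d = (\<Sum>s\<in>S. \<theta> s * c s t) / a"
      have lin: "(\<Sum>s\<in>S. (\<theta> s - d * \<phi> s) * z s) = (\<Sum>s\<in>S. \<theta> s * z s) - d * (\<Sum>s\<in>S. \<phi> s * z s)" for z
        by (simp add: left_diff_distrib sum_subtractf sum_distrib_left mult.assoc)
      have "\<forall>r\<in>insert t T. (\<Sum>s\<in>S. (\<theta> s - d * \<phi> s) * c s r) = 0"
        unfolding lin using \<theta> \<phi> a by (auto simp: d_def a_def)
      then have "(\<Sum>s\<in>S. (\<theta> s - d * \<phi> s) * y s) = 0" by (rule insert.prems)
      then have "(\<Sum>s\<in>S. \<theta> s * y s) = d * (\<Sum>s\<in>S. \<phi> s * y s)" unfolding lin by simp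
      also have "\<dots> = (\<Sum>s\<in>S. \<theta> s * c s t) * b" by (simp add: d_def b_def)
      finally show ?thesis
        by (simp add: right_diff_distrib sum_subtractf sum_distrib_right mult.assoc)
    qed
    from insert.IH[OF this] obtain x where x: "\<forall>s\<in>S. (\<Sum>t\<in>T. c s t * x t) = y s - c s t * b" by blast
    have "(\<Sum>r\<in>insert t T. c s r * (x(t := b)) r) = y s" if "s \<in> S" for s
    proof -
      have "(\<Sum>r\<in>T. c s r * (x(t := b)) r) = (\<Sum>r\<in>T. c s r * x r)"
        by (rule sum.cong) (use insert.hyps in auto)
      then show ?thesis using insert.hyps x that by simp
    qed
    then show ?thesis by blast
  qed
qed

corollary solvable_if_rows_independent:
  fixes c :: "'s \<Rightarrow> 't \<Rightarrow> 'k :: field"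
  assumes "finite T" "finite S"
    and "\<And>\<phi>. (\<forall>t\<in>T. (\<Sum>s\<in>S. \<phi> s * c s t) = 0) \<Longrightarrow> \<forall>s\<in>S. \<phi> s = 0"
  obtains x where "\<And>s. s \<in> S \<Longrightarrow> (\<Sum>t\<in>T. c s t * x t) = y s"
proof -
  have "\<exists>x. \<forall>s\<in>S. (\<Sum>t\<in>T. c s t * x t) = y s"
  proof (rule fredholm_alternative[OF assms(1,2)])
    fix \<phi> assume "\<forall>t\<in>T. (\<Sum>s\<in>S. \<phi> s * c s t) = 0"
    from assms(3)[OF this] show "(\<Sum>s\<in>S. \<phi> s * y s) = 0" by simp
  qed
  with that show ?thesis by blast
qed

text \<open>Dedekind's argument: if h separates i from j, then the relation at \<open>op g h\<close>
  minus \<open>\<chi> j h\<close> times the relation at g has no j-th term, and by induction its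
  coefficient \<open>a i * (\<chi> i h - \<chi> j h)\<close> vanishes.\<close>

lemma characters_independent:
  fixes \<chi> :: "'i \<Rightarrow> 'g \<Rightarrow> 'k :: field"
  assumes "finite I"
    and closed: "\<And>g h. \<lbrakk>g \<in> G; h \<in> G\<rbrakk> \<Longrightarrow> op g h \<in> G"
    and mult: "\<And>i g h. \<lbrakk>i \<in> I; g \<in> G; h \<in> G\<rbrakk> \<Longrightarrow> \<chi> i (op g h) = \<chi> i g * \<chi> i h"
    and nonzero: "\<And>i. i \<in> I \<Longrightarrow> \<exists>g\<in>G. \<chi> i g \<noteq> 0"
    and distinct: "\<And>i j. \<lbrakk>i \<in> I; j \<in> I; i \<noteq> j\<rbrakk> \<Longrightarrow> \<exists>g\<in>G. \<chi> i g \<noteq> \<chi> j g"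
    and rel: "\<And>g. g \<in> G \<Longrightarrow> (\<Sum>i\<in>I. a i * \<chi> i g) = 0"
    and "i \<in> I"
  shows "a i = 0"
  using assms(1) mult nonzero distinct rel \<open>i \<in> I\<close>
proof (induction I arbitrary: a i rule: finite_induct)
  case empty
  then show ?case by simp
next
  case (insert j I)
  have zero: "a i = 0" if i: "i \<in> I" for i
  proof -
    have "i \<noteq> j" using i insert.hyps by auto
    then obtain h where h: "h \<in> G" "\<chi> i h \<noteq> \<chi> j h" using insert.prems(3) i by blast
    have "(\<Sum>i\<in>I. a i * (\<chi> i h - \<chi> j h) * \<chi> i g) = 0" if g: "g \<in> G" for g
    proof -
      have "(\<Sum>i\<in>I. a i * (\<chi> i h - \<chi> j h) * \<chi> i g)
          = (\<Sum>i\<in>insert j I. a i * (\<chi> i h - \<chi> j h) * \<chi> i g)"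
        using insert.hyps by simp
      also have "\<dots> = (\<Sum>i\<in>insert j I. a i * \<chi> i (op g h) - \<chi> j h * (a i * \<chi> i g))"
        by (intro sum.cong refl) (use g h insert.prems(1) in \<open>auto simp: algebra_simps\<close>)
      also have "\<dots> = 0"
        unfolding sum_subtractf sum_distrib_left[symmetric]
        using insert.prems(4)[OF g] insert.prems(4)[OF closed[OF g h(1)]] by simp
      finally show ?thesis .
    qed
    then have "a i * (\<chi> i h - \<chi> j h) = 0"
      using insert.IH[of "\<lambda>i. a i * (\<chi> i h - \<chi> j h)" i] insert.prems(1,2,3) i by blast
    with h show ?thesis by simp
  qed
  obtain g where g: "g \<in> G" "\<chi> j g \<noteq> 0" using insert.prems(2) by blast
  have "a j = 0" using insert.prems(4)[OF g(1)] zero insert.hyps g by simp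
  with zero insert.prems(5) show ?case by blast
qed

section \<open>Roots of unity and a nontrivial additive character of F\<close>

lemma ex_root_of_unity:
  assumes p: "prime p" "p \<noteq> CHAR('k :: alg_closed_field)"
  shows "\<exists>\<zeta> :: 'k. \<zeta> ^ p = 1 \<and> \<zeta> \<noteq> 1"
proof -
  have "p - 1 > 0" using prime_gt_1_nat[OF p(1)] by simp
  \<comment> \<open>A root of 1 + X + ... + X^(p-1) rather than of X^p - 1: it can equal 1 only if p
    = 0 in k.\<close>
  then obtain \<zeta> :: 'k where z: "(\<Sum>k\<le>p - 1. \<zeta> ^ k) = 0"
    using alg_closed[of "p - 1" "\<lambda>_. 1 :: 'k"] by auto
  have "{..p - 1} = {..<p}" using prime_gt_0_nat[OF p(1)] by auto
  with z have s: "(\<Sum>k<p. \<zeta> ^ k) = 0" by simp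
  have "\<zeta> ^ p - 1 = (\<zeta> - 1) * (\<Sum>k<p. \<zeta> ^ k)" by (rule power_diff_1_eq)
  with s have "\<zeta> ^ p = 1" by simp
  moreover have "\<zeta> \<noteq> 1"
  proof
    assume "\<zeta> = 1"
    with s have "(of_nat p :: 'k) = 0" by simp
    then have "CHAR('k) dvd p" by (simp add: of_nat_eq_0_iff_char_dvd)
    then have "CHAR('k) = 1 \<or> CHAR('k) = p" using p(1) unfolding prime_nat_iff by blast
    with p(2) show False using CHAR_not_1[where 'a = 'k] by simp
  qed
  ultimately show ?thesis by blast
qed

text \<open>For a maximal proper additive subgroup \<open>H\<close> and \<open>a\<close> outside it,
  every element of F has the form h + n a with h in \<open>H\<close>. Here n is determined modulo p,
  so h + n a may be sent to \<open>\<zeta> ^ n\<close>.\<close>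

lemma ex_additive_character:
  assumes "CHAR('f :: {field, finite}) \<noteq> CHAR('k :: alg_closed_field)"
  shows "\<exists>\<chi> :: 'f \<Rightarrow> 'k. (\<forall>a b. \<chi> (a + b) = \<chi> a * \<chi> b) \<and> \<chi> 0 = 1 \<and> (\<exists>a. \<chi> a \<noteq> 1)"
proof -
  define p where "p = CHAR('f)"
  have p: "prime p" unfolding p_def
    by (rule prime_CHAR_semidom) (simp add: finite_imp_CHAR_pos)
  obtain \<zeta> :: 'k where \<zeta>: "\<zeta> ^ p = 1" "\<zeta> \<noteq> 1"
    using ex_root_of_unity[OF p] assms unfolding p_def by metis
  have p0: "(of_nat p :: 'f) = 0" unfolding p_def by simp
  define sub where "sub H \<longleftrightarrow> 0 \<in> H \<and> (\<forall>x\<in>H. \<forall>y\<in>H. x + y \<in> H) \<and> (\<forall>x\<in>H. - x \<in> H)" for H :: "'f set"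
  have fin: "finite {H. sub H \<and> H \<noteq> UNIV}" by (rule finite_subset[of _ UNIV]) auto
  have "sub {0}" by (auto simp: sub_def)
  moreover have "{0} \<noteq> (UNIV :: 'f set)" by (metis UNIV_I singletonD zero_neq_one)
  ultimately have "{H. sub H \<and> H \<noteq> UNIV} \<noteq> {}" by blast
  then obtain H where H: "sub H" "H \<noteq> UNIV" and max: "\<And>K. sub K \<Longrightarrow> K \<noteq> UNIV \<Longrightarrow> H \<subseteq> K \<Longrightarrow> K = H"
    using finite_has_maximal[OF fin] by blast
  obtain a where a: "a \<notin> H" using H(2) by auto
  have H0: "0 \<in> H" and Ha: "\<And>x y. x \<in> H \<Longrightarrow> y \<in> H \<Longrightarrow> x + y \<in> H" and Hm: "\<And>x. x \<in> H \<Longrightarrow> - x \<in> H"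
    using H(1) by (auto simp: sub_def)
  have Hn: "of_nat n * x \<in> H" if "x \<in> H" for n x
    by (induction n) (use H0 Ha that in \<open>auto simp: distrib_right\<close>)
  define K where "K = {h + of_nat n * a |h n. h \<in> H}"
  have KI: "h + of_nat n * a \<in> K" if "h \<in> H" for h n using that unfolding K_def by blast
  have "sub K"
    unfolding sub_def
  proof (intro conjI ballI)
    show "0 \<in> K" using KI[OF H0, of 0] by simp
  next
    fix x y assume "x \<in> K" "y \<in> K"
    then obtain h n h' n' where "h \<in> H" "h' \<in> H" "x = h + of_nat n * a" "y = h' + of_nat n' * a"
      unfolding K_def by blast
    then show "x + y \<in> K" using KI[OF Ha[of h h'], of "n + n'"] by (simp add: algebra_simps)
  next
    fix x assume "x \<in> K"
    then obtain h n where h: "h \<in> H" "x = h + of_nat n * a" unfolding K_def by blast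
    \<comment> \<open>\<open>K\<close> is built from natural multiples of \<open>a\<close>, so the
      multiple -n is represented by (p - 1) n.\<close>
    have "(of_nat ((p - 1) * n) :: 'f) = - of_nat n"
      using p0 prime_gt_0_nat[OF p] by (simp add: of_nat_diff)
    then show "- x \<in> K" using KI[OF Hm[OF h(1)], of "(p - 1) * n"] h(2) by (simp add: algebra_simps)
  qed
  moreover have "H \<subseteq> K" using KI[of _ 0] by auto
  moreover have "a \<in> K" using KI[OF H0, of 1] by simp
  ultimately have K: "K = UNIV" using max a by blast
  have ex: "\<exists>n. x - of_nat n * a \<in> H" for x
  proof -
    have "x \<in> K" using K by simp
    then obtain h n where "h \<in> H" "x = h + of_nat n * a" unfolding K_def by blast
    then have "x - of_nat n * a \<in> H" by simp
    then show ?thesis ..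
  qed
  have dvd: "p dvd n" if n: "of_nat n * a \<in> H" for n
  proof (rule ccontr)
    assume "\<not> p dvd n"
    then have "coprime n p" using p by (metis coprime_commute prime_imp_coprime)
    \<comment> \<open>Multiplying n a by an inverse of n modulo p would put \<open>a\<close> itself
      into \<open>H\<close>.\<close>
    then obtain m where "[n * m = 1] (mod p)" using cong_solve_coprime_nat by (metis One_nat_def)
    then have "(of_nat (n * m) :: 'f) = of_nat 1"
      unfolding p_def using of_nat_eq_iff_cong_CHAR by blast
    then have "of_nat m * (of_nat n * a) = a" by (simp add: mult.commute mult.left_commute mult.assoc[symmetric])
    with Hn[OF n, of m] a show False by simp
  qed
  \<comment> \<open>Any admissible n may be chosen: two of them differ by a multiple of p, and
    \<open>\<zeta> ^ p = 1\<close>.\<close>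
  define \<chi> where "\<chi> x = \<zeta> ^ (SOME n. x - of_nat n * a \<in> H)" for x
  have *: "\<zeta> ^ n = \<zeta> ^ m" if "x - of_nat n * a \<in> H" "x - of_nat m * a \<in> H" "n \<le> m" for n m x
  proof -
    have "(x - of_nat n * a) + - (x - of_nat m * a) \<in> H" using that Ha Hm by blast
    then have "of_nat (m - n) * a \<in> H" using that(3) by (simp add: of_nat_diff algebra_simps)
    from dvd[OF this] obtain d where "m - n = p * d" by blast
    then have "m = n + p * d" using that(3) by simp
    then show ?thesis by (simp add: power_add power_mult \<zeta>(1))
  qed
  have \<chi>: "\<chi> x = \<zeta> ^ n" if "x - of_nat n * a \<in> H" for x n
    using *[OF that someI_ex[OF ex]] *[OF someI_ex[OF ex] that] unfolding \<chi>_def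
    by (metis nat_le_linear)
  show ?thesis
  proof (intro exI[of _ \<chi>] conjI allI)
    fix x y
    obtain n m where nm: "x - of_nat n * a \<in> H" "y - of_nat m * a \<in> H" using ex by blast
    have xy: "x + y - of_nat (n + m) * a \<in> H" using Ha[OF nm] by (simp add: algebra_simps)
    then show "\<chi> (x + y) = \<chi> x * \<chi> y" using \<chi>[OF xy] \<chi>[OF nm(1)] \<chi>[OF nm(2)] by (simp add: power_add)
  next
    show "\<chi> 0 = 1" using \<chi>[of 0 0] H0 by simp
  next
    have "\<chi> a = \<zeta> ^ 1" by (rule \<chi>) (use H0 in simp)
    then show "\<exists>a. \<chi> a \<noteq> 1" using \<zeta>(2) by auto
  qed
qed

section \<open>The trace pairing on matrices of bounded rank\<close>

lemma finite_carrier_mat: "finite (carrier_mat n m :: 'a :: finite mat set)"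
proof (rule finite_subset)
  let ?F = "PiE ({..<n} \<times> {..<m}) (\<lambda>_. UNIV :: 'a set)"
  show "carrier_mat n m \<subseteq> mat n m ` ?F"
  proof
    fix A :: "'a mat" assume A: "A \<in> carrier_mat n m"
    have "A = mat n m (restrict (\<lambda>p. A $$ p) ({..<n} \<times> {..<m}))"
      by (rule eq_matI) (use A in auto)
    then show "A \<in> mat n m ` ?F" by (simp add: image_eqI[of A "mat n m"])
  qed
  show "finite (mat n m ` ?F)" by (intro finite_imageI finite_PiE) auto
qed

definition tr :: "'a :: comm_ring_1 mat \<Rightarrow> 'a" where
  "tr A = (\<Sum>i<dim_row A. A $$ (i, i))"

lemma tr_mult:
  assumes "A \<in> carrier_mat n m" "B \<in> carrier_mat m n"
  shows "tr (A * B) = (\<Sum>i<n. \<Sum>j<m. A $$ (i, j) * B $$ (j, i))"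
  using assms unfolding tr_def
  by (auto simp: scalar_prod_def lessThan_atLeast0 intro!: sum.cong)

lemma tr_mult_commute:
  assumes "A \<in> carrier_mat n m" "B \<in> carrier_mat m n"
  shows "tr (A * B) = tr (B * A)"
  unfolding tr_mult[OF assms] tr_mult[OF assms(2,1)]
  by (subst sum.swap) (simp add: mult.commute)

lemma tr_add:
  assumes "A \<in> carrier_mat n n" "B \<in> carrier_mat n n"
  shows "tr (A + B) = tr A + tr B"
  using assms by (simp add: tr_def sum.distrib)

text \<open>The matrices of rank at most s, as those factoring through dimension s.\<close>

definition rank_le :: "nat \<Rightarrow> nat \<Rightarrow> nat \<Rightarrow> 'a :: field mat set" where
  "rank_le s n m = {B * E |B E. B \<in> carrier_mat n s \<and> E \<in> carrier_mat s m}"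

lemma rank_leI: "\<lbrakk>B \<in> carrier_mat n s; E \<in> carrier_mat s m\<rbrakk> \<Longrightarrow> B * E \<in> rank_le s n m"
  unfolding rank_le_def by blast

lemma rank_le_carrier: "rank_le s n m \<subseteq> carrier_mat n m"
  unfolding rank_le_def by auto

lemma finite_rank_le: "finite (rank_le s n m :: 'a :: {field, finite} mat set)"
  by (rule finite_subset[OF rank_le_carrier finite_carrier_mat])

lemma rank_le_mult_left:
  assumes "A \<in> rank_le s n m" "D \<in> carrier_mat l n"
  shows "D * A \<in> rank_le s l m"
proof -
  obtain B E where B: "B \<in> carrier_mat n s" "E \<in> carrier_mat s m" "A = B * E"
    using assms(1) unfolding rank_le_def by blast
  then have "D * A = (D * B) * E" using assms(2) by simp
  then show ?thesis using rank_leI[of "D * B" l s E m] B assms(2) by simp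
qed

lemma rank_le_mult_right:
  assumes "A \<in> rank_le s n m" "D \<in> carrier_mat m l"
  shows "A * D \<in> rank_le s n l"
proof -
  obtain B E where B: "B \<in> carrier_mat n s" "E \<in> carrier_mat s m" "A = B * E"
    using assms(1) unfolding rank_le_def by blast
  then have "A * D = B * (E * D)" using assms(2) by simp
  then show ?thesis using rank_leI[of B n s "E * D" l] B assms(2) by simp
qed

text \<open>A zero column and a zero row leave the product unchanged. This raises the inner
  dimension by one, and for n = m = s + 1 it makes both factors square, so that one-sided inverses
  become two-sided.\<close>

lemma mult_mat_zero_padding:
  fixes B E :: "'a :: field mat"
  assumes "B \<in> carrier_mat n s" "E \<in> carrier_mat s m"
  shows "B * E = mat n (Suc s) (\<lambda>(i, j). if j < s then B $$ (i, j) else 0) *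
    mat (Suc s) m (\<lambda>(i, j). if i < s then E $$ (i, j) else 0)"
  using assms by (intro eq_matI) (auto simp: scalar_prod_def intro!: sum.cong)

lemma rank_le_Suc: "rank_le s n m \<subseteq> rank_le (Suc s) n m"
proof
  fix A :: "'a mat" assume "A \<in> rank_le s n m"
  then obtain B E where B: "B \<in> carrier_mat n s" "E \<in> carrier_mat s m" "A = B * E"
    unfolding rank_le_def by blast
  show "A \<in> rank_le (Suc s) n m"
    unfolding B(3) mult_mat_zero_padding[OF B(1,2)] by (rule rank_leI) auto
qed

text \<open>Otherwise the identity would factor through dimension s. The padded square factors would
  then be inverse to each other in both orders, but one of the two products has a zero in its last
  diagonal entry.\<close>

lemma rank_le_not_invertible:
  fixes X :: "'a :: field mat"
  assumes "X \<in> rank_le s (Suc s) (Suc s)" "Y \<in> carrier_mat (Suc s) (Suc s)"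
  shows "X * Y \<noteq> 1\<^sub>m (Suc s)"
proof
  assume XY: "X * Y = 1\<^sub>m (Suc s)"
  have "(1\<^sub>m (Suc s) :: 'a mat) \<in> rank_le s (Suc s) (Suc s)" using rank_le_mult_right[OF assms] XY by simp
  then obtain B E :: "'a mat" where B: "B \<in> carrier_mat (Suc s) s" "E \<in> carrier_mat s (Suc s)"
    and BE: "1\<^sub>m (Suc s) = B * E"
    unfolding rank_le_def by blast
  let ?B = "mat (Suc s) (Suc s) (\<lambda>(i, j). if j < s then B $$ (i, j) else 0)"
  let ?E = "mat (Suc s) (Suc s) (\<lambda>(i, j). if i < s then E $$ (i, j) else 0)"
  have "?B * ?E = 1\<^sub>m (Suc s)" unfolding BE by (rule mult_mat_zero_padding[OF B, symmetric])
  then have EB: "?E * ?B = 1\<^sub>m (Suc s)" by (rule mat_mult_left_right_inverse[rotated 2]) auto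
  have "(?E * ?B) $$ (s, s) = 0" by (simp add: scalar_prod_def)
  then show False unfolding EB by simp
qed

text \<open>If the rows of \<open>E\<close> are independent, \<open>R\<close> is found column by
  column. If not, a relation \<open>\<phi>\<close> with nonzero entry at r expresses row r through
  the other s rows, and \<open>E\<close> factors through dimension s.\<close>

lemma right_inverse_if_not_rank_le:
  fixes E :: "'a :: field mat"
  assumes E: "E \<in> carrier_mat (Suc s) n" and full: "E \<notin> rank_le s (Suc s) n"
  obtains R where "R \<in> carrier_mat n (Suc s)" "E * R = 1\<^sub>m (Suc s)"
proof (cases "\<forall>\<phi>. (\<forall>t\<in>{..<n}. (\<Sum>i\<in>{..<Suc s}. \<phi> i * E $$ (i, t)) = 0) \<longrightarrow> (\<forall>i\<in>{..<Suc s}. \<phi> i = 0)")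
  case True
  have ind: "\<forall>i\<in>{..<Suc s}. \<phi> i = 0" if "\<forall>t\<in>{..<n}. (\<Sum>i\<in>{..<Suc s}. \<phi> i * E $$ (i, t)) = 0" for \<phi>
    using True that by blast
  have "\<exists>x. \<forall>i\<in>{..<Suc s}. (\<Sum>t\<in>{..<n}. E $$ (i, t) * x t) = (if i = j then 1 else 0)" for j
  proof -
    obtain x where "\<And>i. i \<in> {..<Suc s} \<Longrightarrow> (\<Sum>t\<in>{..<n}. E $$ (i, t) * x t) = (if i = j then 1 else 0)"
      using solvable_if_rows_independent[where c = "\<lambda>i t. E $$ (i, t)" and y = "\<lambda>i. if i = j then 1 else 0",
          OF finite_lessThan finite_lessThan ind] by blast
    then show ?thesis by blast
  qed
  then have "\<forall>j. \<exists>x. \<forall>i\<in>{..<Suc s}. (\<Sum>t\<in>{..<n}. E $$ (i, t) * x t) = (if i = j then 1 else 0)" by blast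
  from choice[OF this] obtain x where
    x: "\<And>i j. i < Suc s \<Longrightarrow> (\<Sum>t\<in>{..<n}. E $$ (i, t) * x j t) = (if i = j then 1 else 0)"
    by auto
  show ?thesis
  proof
    show "mat n (Suc s) (\<lambda>(t, j). x j t) \<in> carrier_mat n (Suc s)" by simp
    show "E * mat n (Suc s) (\<lambda>(t, j). x j t) = 1\<^sub>m (Suc s)"
      using E x by (intro eq_matI) (auto simp: scalar_prod_def lessThan_atLeast0)
  qed
next
  case False
  then obtain \<phi> where \<phi>': "\<forall>t\<in>{..<n}. (\<Sum>i<Suc s. \<phi> i * E $$ (i, t)) = 0"
    and "\<not> (\<forall>i\<in>{..<Suc s}. \<phi> i = 0)" by blast
  then obtain r where r: "r < Suc s" "\<phi> r \<noteq> 0" by blast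
  have \<phi>: "(\<Sum>i<Suc s. \<phi> i * E $$ (i, t)) = 0" if "t < n" for t using \<phi>' that by blast
  \<comment> \<open>\<open>\<sigma>\<close> enumerates the row indices other than r.\<close>
  define \<sigma> where "\<sigma> k = (if k < r then k else Suc k)" for k
  have bij: "bij_betw \<sigma> {..<s} ({..<Suc s} - {r})"
    by (rule bij_betw_byWitness[of _ "\<lambda>k. if k < r then k else k - 1"]) (use r in \<open>auto simp: \<sigma>_def\<close>)
  define E' where "E' = mat s n (\<lambda>(i, j). E $$ (\<sigma> i, j))"
  \<comment> \<open>Row r holds the coefficients of the relation solved for row r; each other row
    picks out its own copy in \<open>E'\<close>.\<close>
  define B where "B = mat (Suc s) s (\<lambda>(i, k). if i = r then - \<phi> (\<sigma> k) / \<phi> r else if i = \<sigma> k then 1 else 0)"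
  have reindex: "(\<Sum>k<s. f (\<sigma> k)) = (\<Sum>i\<in>{..<Suc s} - {r}. f i)" for f :: "nat \<Rightarrow> 'a"
    by (rule sum.reindex_bij_betw[OF bij])
  have "E = B * E'"
  proof (rule eq_matI)
    fix i j assume "i < dim_row (B * E')" "j < dim_col (B * E')"
    then have ij: "i < Suc s" "j < n" by (auto simp: B_def E'_def)
    have eq: "(B * E') $$ (i, j) = (\<Sum>k<s. B $$ (i, k) * E $$ (\<sigma> k, j))"
      using ij by (auto simp: B_def E'_def scalar_prod_def lessThan_atLeast0)
    show "E $$ (i, j) = (B * E') $$ (i, j)"
    proof (cases "i = r")
      case True
      have "(B * E') $$ (i, j) = (\<Sum>k<s. - \<phi> (\<sigma> k) / \<phi> r * E $$ (\<sigma> k, j))"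
        unfolding eq by (intro sum.cong refl) (use True ij in \<open>simp add: B_def\<close>)
      also have "\<dots> = - (\<Sum>i\<in>{..<Suc s} - {r}. \<phi> i * E $$ (i, j)) / \<phi> r"
        unfolding reindex[of "\<lambda>i. - \<phi> i / \<phi> r * E $$ (i, j)"]
        by (simp add: sum_divide_distrib sum_negf)
      also have "(\<Sum>i\<in>{..<Suc s} - {r}. \<phi> i * E $$ (i, j)) = - (\<phi> r * E $$ (r, j))"
        using \<phi>[OF ij(2)] r(1) by (simp add: sum.remove[of _ r] add_eq_0_iff del: sum.lessThan_Suc)
      finally show ?thesis using r True by simp
    next
      case False
      have "(B * E') $$ (i, j) = (\<Sum>k<s. (if i = \<sigma> k then E $$ (\<sigma> k, j) else 0))"
        unfolding eq by (intro sum.cong refl) (use False ij in \<open>simp add: B_def\<close>)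
      also have "\<dots> = E $$ (i, j)"
        unfolding reindex[of "\<lambda>k. if i = k then E $$ (k, j) else 0"] using False ij by (simp add: sum.delta)
      finally show ?thesis by simp
    qed
  qed (use E in \<open>auto simp: B_def E'_def\<close>)
  then have "E \<in> rank_le s (Suc s) n"
    using rank_leI[of B "Suc s" s E' n] by (simp add: B_def E'_def)
  with full show ?thesis by contradiction
qed

text \<open>Change of variables for the weight \<open>x\<close> pushed forward along
  \<open>f\<close>; with f = left or right multiplication by a matrix it turns a product inside the
  character into a new variable.\<close>

lemma sum_fibres:
  fixes x :: "'b \<Rightarrow> 'k :: semiring_0"
  assumes "finite S" "finite T" "f ` S \<subseteq> T"
  shows "(\<Sum>Y\<in>T. (\<Sum>B\<in>{B \<in> S. f B = Y}. x B) * g Y) = (\<Sum>B\<in>S. x B * g (f B))"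
proof -
  have "(\<Sum>B\<in>S. x B * g (f B)) = (\<Sum>Y\<in>T. \<Sum>B\<in>{B \<in> S. f B = Y}. x B * g (f B))"
    by (rule sum.group[symmetric]) (use assms in auto)
  then show ?thesis by (simp add: sum_distrib_right)
qed

section \<open>Fourier sums and nondegeneracy of the trace pairing\<close>

locale additive_character =
  fixes \<chi> :: "'f :: {field, finite} \<Rightarrow> 'k :: field"
  assumes \<chi>_add: "\<chi> (a + b) = \<chi> a * \<chi> b"
    and \<chi>_zero: "\<chi> 0 = 1"
    and \<chi>_nontrivial: "\<exists>a. \<chi> a \<noteq> 1"
begin

lemma \<chi>_nonzero: "\<chi> a \<noteq> 0"
  using \<chi>_add[of a "- a"] \<chi>_zero by auto

text \<open>The maps sending C to \<chi>(tr(C B)) are pairwise distinct characters of the additive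
  group of matrices, so \<open>characters_independent\<close> applies to the coefficients z.\<close>

lemma fourier_injective:
  assumes z: "\<And>C. C \<in> carrier_mat n m \<Longrightarrow> (\<Sum>B\<in>carrier_mat m n. z B * \<chi> (tr (C * B))) = 0"
    and "B \<in> carrier_mat m n"
  shows "z B = 0"
proof (rule characters_independent[OF finite_carrier_mat])
  fix B C D :: "'f mat"
  assume "B \<in> carrier_mat m n" "C \<in> carrier_mat n m" "D \<in> carrier_mat n m"
  then show "\<chi> (tr ((C + D) * B)) = \<chi> (tr (C * B)) * \<chi> (tr (D * B))"
    by (simp add: add_mult_distrib_mat tr_add[of _ n] \<chi>_add)
next
  fix B :: "'f mat"
  show "\<exists>C\<in>carrier_mat n m. \<chi> (tr (C * B)) \<noteq> 0" by (rule bexI[of _ "0\<^sub>m n m"]) (auto simp: \<chi>_nonzero)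
next
  fix B B' :: "'f mat"
  assume B: "B \<in> carrier_mat m n" and B': "B' \<in> carrier_mat m n" and "B \<noteq> B'"
  then obtain i j where ij: "i < m" "j < n" "B $$ (i, j) \<noteq> B' $$ (i, j)"
    by (metis carrier_matD eq_matI)
  obtain a where a: "\<chi> a \<noteq> 1" using \<chi>_nontrivial by blast
  \<comment> \<open>\<open>C\<close> below has the single entry d at (j, i), so tr(C D) is d times
    the entry of D at (i, j). The scaling makes the two traces differ by exactly \<open>a\<close>,
    which \<chi> does not send to 1.\<close>
  define d where "d = a / (B $$ (i, j) - B' $$ (i, j))"
  define C where "C = mat n m (\<lambda>(p, q). if p = j then if q = i then d else 0 else 0)"
  have C: "C \<in> carrier_mat n m" by (simp add: C_def)
  have "tr (C * D) = d * D $$ (i, j)" if D: "D \<in> carrier_mat m n" for D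
  proof -
    have "tr (C * D) = (\<Sum>p<n. \<Sum>q<m. if p = j then if q = i then d * D $$ (q, p) else 0 else 0)"
      unfolding tr_mult[OF C D] by (intro sum.cong refl) (auto simp: C_def)
    also have "\<dots> = (\<Sum>p<n. if p = j then d * D $$ (i, p) else 0)"
      by (intro sum.cong refl) (use ij in \<open>auto simp: sum.delta\<close>)
    finally show ?thesis using ij by (simp add: sum.delta)
  qed
  then have t: "tr (C * B) = d * B $$ (i, j)" "tr (C * B') = d * B' $$ (i, j)" using B B' by auto
  have "d * B $$ (i, j) = a + d * B' $$ (i, j)"
    using ij(3) by (simp add: d_def field_simps)
  then have "\<chi> (tr (C * B)) \<noteq> \<chi> (tr (C * B'))"
    using a \<chi>_nonzero by (simp add: t \<chi>_add)
  with C show "\<exists>C\<in>carrier_mat n m. \<chi> (tr (C * B)) \<noteq> \<chi> (tr (C * B'))" by blast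
qed (use assms in auto)

text \<open>The fibre sums are the push-forward of \<open>x\<close> along left multiplication by
  \<open>C\<close>, and the assumption says that its Fourier transform vanishes.\<close>

lemma fibre_sums_zero:
  fixes S :: "'f mat set"
  assumes S: "S \<subseteq> carrier_mat m n" and C: "C \<in> carrier_mat t m"
    and z: "\<And>D. D \<in> carrier_mat n t \<Longrightarrow> (\<Sum>B\<in>S. x B * \<chi> (tr (D * (C * B)))) = 0"
    and "Y \<in> carrier_mat t n"
  shows "(\<Sum>B\<in>{B \<in> S. C * B = Y}. x B) = 0"
proof (rule fourier_injective[of n t "\<lambda>Y. \<Sum>B\<in>{B \<in> S. C * B = Y}. x B"])
  fix D :: "'f mat" assume D: "D \<in> carrier_mat n t"
  show "(\<Sum>Y\<in>carrier_mat t n. (\<Sum>B\<in>{B \<in> S. C * B = Y}. x B) * \<chi> (tr (D * Y))) = 0"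
    by (subst sum_fibres) (use S C z[OF D] finite_subset[OF S] in \<open>auto simp: finite_carrier_mat\<close>)
qed fact

text \<open>Suppose x is orthogonal to all matrices of rank at most s + 1. Its values on the matrices of
  rank s + 1 with a given row space form a function y on injective maps, all of whose fibre sums
  over invertible matrices vanish. By induction, y extends to a function z on all maps that is
  orthogonal to the non-surjective ones; the image of z under any C is then supported on singular
  matrices and orthogonal to them, hence zero by induction, so z = 0.\<close>

lemma trace_pairing_nondegenerate:
  assumes "\<And>A. A \<in> rank_le s n m \<Longrightarrow> (\<Sum>B\<in>rank_le s m n. x B * \<chi> (tr (A * B))) = 0"
    and "B \<in> rank_le s m n"
  shows "x B = 0"
  using assms
proof (induction s arbitrary: n m x B)
  case 0
  have zero: "P * E = 0\<^sub>m m n" if "P \<in> carrier_mat m 0" "E \<in> carrier_mat 0 n" for P E :: "'f mat"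
    using that by (intro eq_matI) (auto simp: scalar_prod_def)
  have "rank_le 0 m n = {0\<^sub>m m n :: 'f mat}"
    using zero rank_leI[of "0\<^sub>m m 0 :: 'f mat" m 0 "0\<^sub>m 0 n" n] unfolding rank_le_def by auto
  moreover have "0\<^sub>m n m \<in> (rank_le 0 n m :: 'f mat set)"
    using rank_leI[of "0\<^sub>m n 0" n 0 "0\<^sub>m 0 m" m] by simp
  moreover have "tr (0\<^sub>m n m * 0\<^sub>m m n :: 'f mat) = 0" by (simp add: tr_def)
  ultimately show ?case using 0 by (force simp: \<chi>_zero)
next
  case (Suc s)
  let ?t = "Suc s"
  \<comment> \<open>The values at rank exactly s + 1 come first. Once they vanish, the sums over
    \<open>rank_le ?t m n\<close> reduce to \<open>rank_le s m n\<close>, where the induction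
    hypothesis finishes.\<close>
  have top: "x B0 = 0" if B0: "B0 \<in> rank_le ?t m n" "B0 \<notin> rank_le s m n" for B0
  proof -
    obtain P E where P: "P \<in> carrier_mat m ?t" and E: "E \<in> carrier_mat ?t n" and B0_eq: "B0 = P * E"
      using B0(1) unfolding rank_le_def by blast
    have Pfull: "P \<notin> rank_le s m ?t" using rank_le_mult_right[OF _ E] B0(2) B0_eq by blast
    have Efull: "E \<notin> rank_le s ?t n" using rank_le_mult_left[OF _ P] B0(2) B0_eq by blast
    obtain R where R: "R \<in> carrier_mat n ?t" "E * R = 1\<^sub>m ?t"
      using right_inverse_if_not_rank_le[OF E Efull] by blast
    have cancel: "B * E * R = B" if "B \<in> carrier_mat l ?t" for B l
      using that E R by simp
    define y where "y B = x (B * E)" for B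
    have y_fibre: "(\<Sum>B\<in>{B \<in> carrier_mat m ?t. C * B = g}. y B) = 0"
      if C: "C \<in> carrier_mat ?t m" and g: "g \<in> carrier_mat ?t ?t" "g \<notin> rank_le s ?t ?t" for C g
    proof -
      obtain g' where g': "g' \<in> carrier_mat ?t ?t" "g * g' = 1\<^sub>m ?t"
        using right_inverse_if_not_rank_le[OF g] by blast
      have gE: "g * E \<notin> rank_le s ?t n"
        using rank_le_mult_right[OF _ R(1)] cancel[OF g(1)] g(2) by force
      have "bij_betw (\<lambda>B. B * E) {B \<in> carrier_mat m ?t. C * B = g} {B \<in> rank_le ?t m n. C * B = g * E}"
      proof (rule bij_betw_byWitness[of _ "\<lambda>B. B * R"])
        show "\<forall>B\<in>{B \<in> carrier_mat m ?t. C * B = g}. B * E * R = B" using cancel by blast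
        show "(\<lambda>B. B * E) ` {B \<in> carrier_mat m ?t. C * B = g} \<subseteq> {B \<in> rank_le ?t m n. C * B = g * E}"
          using C E by (auto intro: rank_leI)
        \<comment> \<open>The fibre over \<open>g * E\<close> contains only matrices with the row
          space of \<open>E\<close>: writing \<open>B = B1 * E1\<close>, the square matrix
          \<open>C * B1\<close> has full rank because \<open>g * E\<close> does, and inverting it
          exhibits \<open>E1\<close> as a left multiple of \<open>E\<close>.\<close>
        have *: "B * R * E = B" "C * (B * R) = g" if B: "B \<in> rank_le ?t m n" "C * B = g * E" for B
        proof -
          obtain B1 E1 where B1: "B1 \<in> carrier_mat m ?t" and E1: "E1 \<in> carrier_mat ?t n" and B_eq: "B = B1 * E1"
            using B(1) unfolding rank_le_def by blast
          have CB1: "C * B1 \<in> carrier_mat ?t ?t" using C B1 by simp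
          have CB1E1: "C * B1 * E1 = g * E" using B(2) C B1 E1 by (simp add: B_eq)
          have "C * B1 \<notin> rank_le s ?t ?t" using rank_le_mult_right[OF _ E1] CB1E1 gE by force
          then obtain h where h: "h \<in> carrier_mat ?t ?t" "C * B1 * h = 1\<^sub>m ?t"
            using right_inverse_if_not_rank_le[OF CB1] by blast
          have h': "h * (C * B1) = 1\<^sub>m ?t" by (rule mat_mult_left_right_inverse[OF CB1 h])
          have "E1 = h * (C * B1) * E1" using E1 h' by simp
          also have "\<dots> = h * (C * B1 * E1)" using h(1) CB1 E1 by (rule assoc_mult_mat)
          also have "\<dots> = h * g * E" using CB1E1 h(1) g(1) E by simp
          finally have E1_eq: "E1 = h * g * E" .
          have k: "h * g \<in> carrier_mat ?t ?t" using h(1) g(1) by simp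
          have B_eq': "B = B1 * (h * g) * E"
            unfolding B_eq E1_eq by (rule assoc_mult_mat[OF B1 k E, symmetric])
          have BR: "B * R = B1 * (h * g)"
            unfolding B_eq' by (rule cancel[of _ m]) (use B1 k in simp)
          show "B * R * E = B" using BR B_eq' by simp
          have "C * (B1 * (h * g)) = C * B1 * (h * g)" by (rule assoc_mult_mat[OF C B1 k, symmetric])
          also have "\<dots> = C * B1 * h * g" by (rule assoc_mult_mat[OF CB1 h(1) g(1), symmetric])
          finally show "C * (B * R) = g" using BR h(2) g(1) by simp
        qed
        then show "\<forall>B\<in>{B \<in> rank_le ?t m n. C * B = g * E}. B * R * E = B" by blast
        show "(\<lambda>B. B * R) ` {B \<in> rank_le ?t m n. C * B = g * E} \<subseteq> {B \<in> carrier_mat m ?t. C * B = g}"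
          using * R(1) rank_le_carrier by fastforce
      qed
      then have "(\<Sum>B\<in>{B \<in> carrier_mat m ?t. C * B = g}. y B) = (\<Sum>B\<in>{B \<in> rank_le ?t m n. C * B = g * E}. x B)"
        unfolding y_def by (rule sum.reindex_bij_betw)
      also have "\<dots> = 0"
      \<comment> \<open>\<open>D * C\<close> factors through dimension \<open>?t\<close>, so it is
        among the matrices to which \<open>x\<close> is orthogonal.\<close>
      proof (rule fibre_sums_zero[OF rank_le_carrier C])
        fix D :: "'f mat" assume D: "D \<in> carrier_mat n ?t"
        have "(\<Sum>B\<in>rank_le ?t m n. x B * \<chi> (tr (D * (C * B)))) = (\<Sum>B\<in>rank_le ?t m n. x B * \<chi> (tr (D * C * B)))"
        proof (intro sum.cong refl)
          fix B :: "'f mat" assume "B \<in> rank_le ?t m n"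
          then have "B \<in> carrier_mat m n" using rank_le_carrier by blast
          then show "x B * \<chi> (tr (D * (C * B))) = x B * \<chi> (tr (D * C * B))"
            using D C by simp
        qed
        also have "\<dots> = 0" by (rule Suc.prems(1)[OF rank_leI[OF D C]])
        finally show "(\<Sum>B\<in>rank_le ?t m n. x B * \<chi> (tr (D * (C * B)))) = 0" .
      qed (use g(1) E in simp)
      finally show ?thesis .
    qed
    \<comment> \<open>The correction needed to extend \<open>y\<close> to \<open>z\<close>. The
      system is solvable because the induction hypothesis, with the factors under the trace
      exchanged, makes its rows independent.\<close>
    obtain w where w: "\<And>C. C \<in> rank_le s ?t m \<Longrightarrow> (\<Sum>B\<in>rank_le s m ?t. \<chi> (tr (C * B)) * w B) =
        - (\<Sum>B\<in>carrier_mat m ?t - rank_le s m ?t. y B * \<chi> (tr (C * B)))"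
    proof (rule solvable_if_rows_independent[of "rank_le s m ?t" "rank_le s ?t m" "\<lambda>C B. \<chi> (tr (C * B))"
          "\<lambda>C. - (\<Sum>B\<in>carrier_mat m ?t - rank_le s m ?t. y B * \<chi> (tr (C * B)))"])
      fix \<phi> assume \<phi>: "\<forall>B\<in>rank_le s m ?t. (\<Sum>C\<in>rank_le s ?t m. \<phi> C * \<chi> (tr (C * B))) = 0"
      show "\<forall>C\<in>rank_le s ?t m. \<phi> C = 0"
      proof
        fix C0 :: "'f mat" assume C0: "C0 \<in> rank_le s ?t m"
        show "\<phi> C0 = 0"
        proof (rule Suc.IH[of m ?t, OF _ C0])
          fix B :: "'f mat" assume B: "B \<in> rank_le s m ?t"
          have "(\<Sum>C\<in>rank_le s ?t m. \<phi> C * \<chi> (tr (B * C))) = (\<Sum>C\<in>rank_le s ?t m. \<phi> C * \<chi> (tr (C * B)))"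
            by (intro sum.cong refl)
              (simp add: tr_mult_commute[OF subsetD[OF rank_le_carrier B] subsetD[OF rank_le_carrier]])
          with \<phi> B show "(\<Sum>C\<in>rank_le s ?t m. \<phi> C * \<chi> (tr (B * C))) = 0" by simp
        qed
      qed
    qed (auto simp: finite_rank_le)
    define z where "z B = (if B \<in> rank_le s m ?t then w B else y B)" for B
    have z_low: "(\<Sum>B\<in>carrier_mat m ?t. z B * \<chi> (tr (C * B))) = 0" if C: "C \<in> rank_le s ?t m" for C
    proof -
      have "(\<Sum>B\<in>carrier_mat m ?t. z B * \<chi> (tr (C * B))) =
          (\<Sum>B\<in>carrier_mat m ?t - rank_le s m ?t. z B * \<chi> (tr (C * B))) + (\<Sum>B\<in>rank_le s m ?t. z B * \<chi> (tr (C * B)))"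
        by (rule sum.subset_diff[OF rank_le_carrier finite_carrier_mat])
      also have "(\<Sum>B\<in>rank_le s m ?t. z B * \<chi> (tr (C * B))) = (\<Sum>B\<in>rank_le s m ?t. \<chi> (tr (C * B)) * w B)"
        by (intro sum.cong refl) (simp add: z_def)
      also have "\<dots> = - (\<Sum>B\<in>carrier_mat m ?t - rank_le s m ?t. y B * \<chi> (tr (C * B)))" by (rule w[OF C])
      also have "(\<Sum>B\<in>carrier_mat m ?t - rank_le s m ?t. z B * \<chi> (tr (C * B))) =
          (\<Sum>B\<in>carrier_mat m ?t - rank_le s m ?t. y B * \<chi> (tr (C * B)))"
        by (intro sum.cong refl) (simp add: z_def)
      finally show ?thesis by simp
    qed
    have "z P = 0"
    proof (rule fourier_injective[OF _ P])
      fix C :: "'f mat" assume C: "C \<in> carrier_mat ?t m"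
      define v where "v Y = (\<Sum>B\<in>{B \<in> carrier_mat m ?t. C * B = Y}. z B)" for Y
      have fib: "(\<Sum>Y\<in>carrier_mat ?t ?t. v Y * g Y) = (\<Sum>B\<in>carrier_mat m ?t. z B * g (C * B))" for g
        unfolding v_def by (rule sum_fibres) (use C in \<open>auto simp: finite_carrier_mat\<close>)
      \<comment> \<open>A matrix of rank at most s is never sent by \<open>C\<close> to a full-rank
        \<open>Y\<close>, so the correction \<open>w\<close> does not enter these fibre
        sums.\<close>
      have v_full: "v Y = 0" if Y: "Y \<in> carrier_mat ?t ?t" "Y \<notin> rank_le s ?t ?t" for Y
      proof -
        have "v Y = (\<Sum>B\<in>{B \<in> carrier_mat m ?t. C * B = Y}. y B)"
          unfolding v_def
          by (intro sum.cong refl) (use Y(2) rank_le_mult_left[OF _ C] in \<open>auto simp: z_def\<close>)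
        with y_fibre[OF C Y] show ?thesis by simp
      qed
      \<comment> \<open>Since \<open>v\<close> is supported on \<open>rank_le s ?t ?t\<close>, the
        sums there are full sums; they vanish because \<open>A * C\<close> has rank at most s and
        \<open>z\<close> is orthogonal to such matrices.\<close>
      have v_low: "v Y = 0" if "Y \<in> rank_le s ?t ?t" for Y
      proof (rule Suc.IH[of ?t ?t, OF _ that])
        fix A :: "'f mat" assume A: "A \<in> rank_le s ?t ?t"
        then have Ac: "A \<in> carrier_mat ?t ?t" using rank_le_carrier by blast
        have "(\<Sum>Y\<in>rank_le s ?t ?t. v Y * \<chi> (tr (A * Y))) = (\<Sum>Y\<in>carrier_mat ?t ?t. v Y * \<chi> (tr (A * Y)))"
          by (rule sum.mono_neutral_left[OF finite_carrier_mat rank_le_carrier]) (use v_full in auto)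
        also have "\<dots> = (\<Sum>B\<in>carrier_mat m ?t. z B * \<chi> (tr (A * (C * B))))" by (rule fib)
        also have "\<dots> = (\<Sum>B\<in>carrier_mat m ?t. z B * \<chi> (tr (A * C * B)))"
          by (intro sum.cong refl) (use Ac C in simp)
        also have "\<dots> = 0" by (rule z_low[OF rank_le_mult_right[OF A C]])
        finally show "(\<Sum>Y\<in>rank_le s ?t ?t. v Y * \<chi> (tr (A * Y))) = 0" .
      qed
      have "(\<Sum>B\<in>carrier_mat m ?t. z B * \<chi> (tr (C * B))) = (\<Sum>Y\<in>carrier_mat ?t ?t. v Y * \<chi> (tr Y))"
        by (rule fib[of "\<lambda>Y. \<chi> (tr Y)", symmetric])
      also have "\<dots> = 0" by (intro sum.neutral) (use v_full v_low in auto)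
      finally show "(\<Sum>B\<in>carrier_mat m ?t. z B * \<chi> (tr (C * B))) = 0" .
    qed
    then show ?thesis using Pfull by (simp add: z_def y_def B0_eq)
  qed
  show ?case
  proof (cases "B \<in> rank_le s m n")
    case False
    with top Suc.prems(2) show ?thesis by blast
  next
    case True
    show ?thesis
    proof (rule Suc.IH[of n m, OF _ True])
      fix A :: "'f mat" assume "A \<in> rank_le s n m"
      then have A: "A \<in> rank_le ?t n m" using rank_le_Suc by blast
      have "(\<Sum>B\<in>rank_le s m n. x B * \<chi> (tr (A * B))) = (\<Sum>B\<in>rank_le ?t m n. x B * \<chi> (tr (A * B)))"
        by (rule sum.mono_neutral_left[OF finite_rank_le rank_le_Suc]) (use top in auto)
      also have "\<dots> = 0" by (rule Suc.prems(1)[OF A])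
      finally show "(\<Sum>B\<in>rank_le s m n. x B * \<chi> (tr (A * B))) = 0" .
    qed
  qed
qed

text \<open>The conclusion is e X = X in the monoid algebra, read off coefficient by coefficient in
  the shape of \<open>mult_single_apply\<close>.\<close>

lemma ex_left_identity_rank_le:
  obtains e where "\<And>X Y :: 'f mat. \<lbrakk>X \<in> rank_le s m m; Y \<in> carrier_mat m m\<rbrakk> \<Longrightarrow>
    (\<Sum>B\<in>{B \<in> rank_le s m m. B * X = Y}. e B) = (if X = Y then 1 else 0 :: 'k)"
proof -
  \<comment> \<open>The right-hand side is what the pairing returns for the identity matrix: tested
    against matrices of rank at most s, e cannot be told from 1.\<close>
  obtain e where e: "\<And>A. A \<in> rank_le s m m \<Longrightarrow> (\<Sum>B\<in>rank_le s m m. \<chi> (tr (A * B)) * e B) = \<chi> (tr A)"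
  proof (rule solvable_if_rows_independent[of "rank_le s m m" "rank_le s m m" "\<lambda>A B. \<chi> (tr (A * B))" "\<lambda>A. \<chi> (tr A)"])
    fix \<phi> assume \<phi>: "\<forall>B\<in>rank_le s m m. (\<Sum>A\<in>rank_le s m m. \<phi> A * \<chi> (tr (A * B))) = 0"
    show "\<forall>A\<in>rank_le s m m. \<phi> A = 0"
    proof
      fix A0 :: "'f mat" assume A0: "A0 \<in> rank_le s m m"
      show "\<phi> A0 = 0"
      proof (rule trace_pairing_nondegenerate[OF _ A0])
        fix B :: "'f mat" assume B: "B \<in> rank_le s m m"
        have "(\<Sum>A\<in>rank_le s m m. \<phi> A * \<chi> (tr (B * A))) = (\<Sum>A\<in>rank_le s m m. \<phi> A * \<chi> (tr (A * B)))"
          by (intro sum.cong refl)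
              (simp add: tr_mult_commute[OF subsetD[OF rank_le_carrier B] subsetD[OF rank_le_carrier]])
        with \<phi> B show "(\<Sum>A\<in>rank_le s m m. \<phi> A * \<chi> (tr (B * A))) = 0" by simp
      qed
    qed
  qed (auto simp: finite_rank_le)
  show ?thesis
  proof
    fix X Y :: "'f mat" assume X: "X \<in> rank_le s m m" and Y: "Y \<in> carrier_mat m m"
    have Xc: "X \<in> carrier_mat m m" using X rank_le_carrier by blast
    \<comment> \<open>The coefficient of e X - X at \<open>Y\<close>.\<close>
    define v where "v Y = (\<Sum>B\<in>{B \<in> rank_le s m m. B * X = Y}. e B) - (if X = Y then 1 else 0)" for Y
    have "v Y = 0"
    proof (rule fourier_injective[OF _ Y])
      fix C :: "'f mat" assume C: "C \<in> carrier_mat m m"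
      have "(\<Sum>Y\<in>carrier_mat m m. v Y * \<chi> (tr (C * Y))) =
          (\<Sum>Y\<in>carrier_mat m m. (\<Sum>B\<in>{B \<in> rank_le s m m. B * X = Y}. e B) * \<chi> (tr (C * Y))) -
          (\<Sum>Y\<in>carrier_mat m m. if X = Y then \<chi> (tr (C * Y)) else 0)"
        unfolding v_def left_diff_distrib sum_subtractf by (simp add: if_distrib[of "\<lambda>z. z * _"] cong: if_cong)
      also have "(\<Sum>Y\<in>carrier_mat m m. if X = Y then \<chi> (tr (C * Y)) else 0) = \<chi> (tr (C * X))"
        using Xc by (simp add: finite_carrier_mat)
      also have "(\<Sum>Y\<in>carrier_mat m m. (\<Sum>B\<in>{B \<in> rank_le s m m. B * X = Y}. e B) * \<chi> (tr (C * Y))) =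
          (\<Sum>B\<in>rank_le s m m. e B * \<chi> (tr (C * (B * X))))"
        by (rule sum_fibres) (use Xc rank_le_carrier[of s m m] in \<open>auto simp: finite_carrier_mat finite_rank_le\<close>)
      also have "\<dots> = (\<Sum>B\<in>rank_le s m m. \<chi> (tr (X * C * B)) * e B)"
      proof (intro sum.cong refl)
        fix B :: "'f mat" assume "B \<in> rank_le s m m"
        then have B: "B \<in> carrier_mat m m" using rank_le_carrier by blast
        have "tr (C * (B * X)) = tr (C * B * X)" using B C Xc by simp
        also have "\<dots> = tr (X * (C * B))" by (rule tr_mult_commute) (use B C Xc in auto)
        finally show "e B * \<chi> (tr (C * (B * X))) = \<chi> (tr (X * C * B)) * e B" using B C Xc by simp
      qed
      also have "\<dots> = \<chi> (tr (X * C))" by (rule e[OF rank_le_mult_right[OF X C]])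
      also have "\<dots> = \<chi> (tr (C * X))" using tr_mult_commute[OF Xc C] by simp
      finally show "(\<Sum>Y\<in>carrier_mat m m. v Y * \<chi> (tr (C * Y))) = 0" by simp
    qed
    then show "(\<Sum>B\<in>{B \<in> rank_le s m m. B * X = Y}. e B) = (if X = Y then 1 else 0)"
      by (simp add: v_def)
  qed
qed

end

section \<open>Monoid algebras\<close>

definition single :: "'m \<Rightarrow> 'k :: zero \<Rightarrow> 'm \<Rightarrow> 'k" where
  "single a c = (\<lambda>x. if x = a then c else 0)"

lemma single_closed:
  "a \<in> carrier M \<Longrightarrow> single a c \<in> carrier (monoid_algebra TYPE('k :: field) M)"
  unfolding monoid_algebra_carrier_iff single_def by (auto intro: finite_subset[of _ "{a}"])

lemma single_mult_apply:
  fixes g :: "'m \<Rightarrow> 'k :: field"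
  assumes "finite T" "{b. g b \<noteq> 0} \<subseteq> T"
  shows "(single a c \<otimes>\<^bsub>monoid_algebra TYPE('k) M\<^esub> g) x = (\<Sum>b\<in>T. if a \<otimes>\<^bsub>M\<^esub> b = x then c * g b else 0)"
  by (subst monoid_algebra_mult_superset[of "{a}" _ T]) (use assms in \<open>auto simp: single_def cong: if_cong\<close>)

lemma mult_single_apply:
  fixes f :: "'m \<Rightarrow> 'k :: field"
  assumes "finite S" "{b. f b \<noteq> 0} \<subseteq> S"
  shows "(f \<otimes>\<^bsub>monoid_algebra TYPE('k) M\<^esub> single b c) x = (\<Sum>a\<in>S. if a \<otimes>\<^bsub>M\<^esub> b = x then f a * c else 0)"
  by (subst monoid_algebra_mult_superset[of S _ "{b}"]) (use assms in \<open>auto simp: single_def cong: if_cong\<close>)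

lemma single_mult_single:
  "single a c \<otimes>\<^bsub>monoid_algebra TYPE('k :: field) M\<^esub> single b d = single (a \<otimes>\<^bsub>M\<^esub> b) (c * d)"
  by (rule ext) (subst mult_single_apply[of "{a}"], auto simp: single_def)

lemma monoid_algebra_induct [consumes 1, case_names zero add]:
  fixes f :: "'m \<Rightarrow> 'k :: field"
  assumes "f \<in> carrier (monoid_algebra TYPE('k) M)"
    and "Q (\<lambda>_. 0)"
    and "\<And>f a c. \<lbrakk>f \<in> carrier (monoid_algebra TYPE('k) M); a \<in> carrier M; Q f\<rbrakk> \<Longrightarrow> Q (\<lambda>x. f x + single a c x)"
  shows "Q f"
proof -
  have "Q f" if "finite S" "S \<subseteq> carrier M" "{x. f x \<noteq> 0} \<subseteq> S" for S f
    using that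
  proof (induction S arbitrary: f rule: finite_induct)
    case empty
    then have "f = (\<lambda>_. 0)" by auto
    with assms(2) show ?case by simp
  next
    case (insert a S)
    have sub: "{x. (f(a := 0)) x \<noteq> 0} \<subseteq> S" using insert.prems(2) by auto
    then have "f(a := 0) \<in> carrier (monoid_algebra TYPE('k) M)"
      unfolding monoid_algebra_carrier_iff
      using finite_subset[OF sub insert.hyps(1)] subset_trans[OF sub] insert.prems(1) by blast
    then have "Q (\<lambda>x. (f(a := 0)) x + single a (f a) x)"
      using insert.IH[OF _ sub] insert.prems(1) assms(3) by blast
    moreover have "(\<lambda>x. (f(a := 0)) x + single a (f a) x) = f" by (auto simp: single_def)
    ultimately show ?case by simp
  qed
  then show ?thesis using assms(1) unfolding monoid_algebra_carrier_iff by blast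
qed

context Group.monoid
begin

text \<open>Scalars act on the algebra through the elements \<open>single \<one> c\<close>; together
  with \<open>mult_scalar\<close> this shows that they are central.\<close>

lemma scalar_mult:
  assumes "f \<in> carrier (monoid_algebra TYPE('k :: field) G)"
  shows "single \<one> c \<otimes>\<^bsub>monoid_algebra TYPE('k) G\<^esub> f = (\<lambda>x. c * f x)"
proof
  fix x
  have f: "finite {b. f b \<noteq> 0}" "{b. f b \<noteq> 0} \<subseteq> carrier G"
    using assms by (auto simp: monoid_algebra_carrier_iff)
  have "(single \<one> c \<otimes>\<^bsub>monoid_algebra TYPE('k) G\<^esub> f) x = (\<Sum>b\<in>{b. f b \<noteq> 0}. if \<one> \<otimes> b = x then c * f b else 0)"
    by (rule single_mult_apply) (use f in auto)
  also have "\<dots> = (\<Sum>b\<in>{b. f b \<noteq> 0}. if b = x then c * f b else 0)"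
    by (intro sum.cong refl) (use f in auto)
  finally show "(single \<one> c \<otimes>\<^bsub>monoid_algebra TYPE('k) G\<^esub> f) x = c * f x" using f by (simp add: sum.delta)
qed

lemma mult_scalar:
  assumes "f \<in> carrier (monoid_algebra TYPE('k :: field) G)"
  shows "f \<otimes>\<^bsub>monoid_algebra TYPE('k) G\<^esub> single \<one> c = (\<lambda>x. c * f x)"
proof
  fix x
  have f: "finite {b. f b \<noteq> 0}" "{b. f b \<noteq> 0} \<subseteq> carrier G"
    using assms by (auto simp: monoid_algebra_carrier_iff)
  have "(f \<otimes>\<^bsub>monoid_algebra TYPE('k) G\<^esub> single \<one> c) x = (\<Sum>b\<in>{b. f b \<noteq> 0}. if b \<otimes> \<one> = x then f b * c else 0)"
    by (rule mult_single_apply) (use f in auto)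
  also have "\<dots> = (\<Sum>b\<in>{b. f b \<noteq> 0}. if b = x then c * f b else 0)"
    by (intro sum.cong refl) (use f in \<open>auto simp: mult.commute\<close>)
  finally show "(f \<otimes>\<^bsub>monoid_algebra TYPE('k) G\<^esub> single \<one> c) x = c * f x" using f by (simp add: sum.delta)
qed

text \<open>Left multiplication by a unit permutes coefficients. For h = g^(-1) and x = 1 it
  expresses the coefficient at g as a coefficient at 1, which is how a functional can determine a
  map into kG.\<close>

lemma single_unit_mult_apply:
  assumes "f \<in> carrier (monoid_algebra TYPE('k :: field) G)" "h \<in> Units G" "x \<in> carrier G"
  shows "(single h c \<otimes>\<^bsub>monoid_algebra TYPE('k) G\<^esub> f) x = c * f (inv h \<otimes> x)"
proof -
  have f: "finite {b. f b \<noteq> 0}" "{b. f b \<noteq> 0} \<subseteq> carrier G"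
    using assms by (auto simp: monoid_algebra_carrier_iff)
  have "(single h c \<otimes>\<^bsub>monoid_algebra TYPE('k) G\<^esub> f) x = (\<Sum>b\<in>{b. f b \<noteq> 0}. if h \<otimes> b = x then c * f b else 0)"
    by (rule single_mult_apply) (use f in auto)
  also have "\<dots> = (\<Sum>b\<in>{b. f b \<noteq> 0}. if b = inv h \<otimes> x then c * f b else 0)"
  proof (intro sum.cong refl)
    fix b assume "b \<in> {b. f b \<noteq> 0}"
    then have "b \<in> carrier G" using f by blast
    then have "h \<otimes> b = x \<longleftrightarrow> b = inv h \<otimes> x"
      using assms(2,3) by (metis Units_closed Units_inv_closed Units_l_inv Units_r_inv l_one m_assoc)
    then show "(if h \<otimes> b = x then c * f b else 0) = (if b = inv h \<otimes> x then c * f b else 0)" by simp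
  qed
  finally show ?thesis using f by (simp add: sum.delta)
qed

end

lemma mult_units_of_algebra:
  "f \<otimes>\<^bsub>monoid_algebra TK (units_of M)\<^esub> g = f \<otimes>\<^bsub>monoid_algebra TK M\<^esub> g"
  by (simp add: monoid_algebra_def units_of_def)

lemma carrier_units_of_algebra:
  fixes M (structure)
  assumes "Group.monoid M"
  shows "carrier (monoid_algebra TK (units_of M)) \<subseteq> carrier (monoid_algebra TK M)"
proof -
  interpret Group.monoid M by fact
  show ?thesis by (auto simp: monoid_algebra_carrier_iff units_of_carrier subset_iff)
qed

section \<open>Vector spaces as modules over \<open>field_ring\<close>, and extension of
  functionals\<close>

definition field_ring :: "'k :: field ring" where
  "field_ring = \<lparr>carrier = UNIV, monoid.mult = (*), one = 1, zero = 0, add = (+)\<rparr>"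

lemma field_ring_simps [simp]:
  "carrier field_ring = UNIV" "a \<otimes>\<^bsub>field_ring\<^esub> b = a * b" "\<one>\<^bsub>field_ring\<^esub> = 1"
  "\<zero>\<^bsub>field_ring\<^esub> = 0" "a \<oplus>\<^bsub>field_ring\<^esub> b = a + b"
  by (simp_all add: field_ring_def)

lemma ring_field_ring: "ring (field_ring :: 'k :: field ring)"
proof (rule ringI)
  show "abelian_group (field_ring :: 'k ring)"
    by (rule abelian_groupI) (auto simp: ac_simps intro: exI[of _ "- _"])
  show "Group.monoid (field_ring :: 'k ring)" by (rule Group.monoidI) (auto simp: mult.assoc)
qed (auto simp: algebra_simps)

text \<open>Bases are only available for vector spaces on a whole type, so the functional is extended
  on the free vector space over the carrier, where the relations have value 0.\<close>

lemma functional_extension: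
  fixes V :: "('k :: field, 'v) module" and \<theta> :: "'v \<Rightarrow> 'k"
  assumes V: "left_module field_ring V" and H: "H \<subseteq> carrier V" "\<zero>\<^bsub>V\<^esub> \<in> H"
    and H_add: "\<And>x y. \<lbrakk>x \<in> H; y \<in> H\<rbrakk> \<Longrightarrow> x \<oplus>\<^bsub>V\<^esub> y \<in> H \<and> \<theta> (x \<oplus>\<^bsub>V\<^esub> y) = \<theta> x + \<theta> y"
    and H_smult: "\<And>c x. x \<in> H \<Longrightarrow> c \<odot>\<^bsub>V\<^esub> x \<in> H \<and> \<theta> (c \<odot>\<^bsub>V\<^esub> x) = c * \<theta> x"
  shows "\<exists>\<Psi>. (\<forall>x\<in>carrier V. \<forall>y\<in>carrier V. \<Psi> (x \<oplus>\<^bsub>V\<^esub> y) = \<Psi> x + \<Psi> y) \<and>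
    (\<forall>c. \<forall>x\<in>carrier V. \<Psi> (c \<odot>\<^bsub>V\<^esub> x) = c * \<Psi> x) \<and> (\<forall>x\<in>H. \<Psi> x = \<theta> x)"
proof -
  interpret V: left_module field_ring V by fact
  let ?F = "free_module (field_ring :: 'k ring) (carrier V)"
  interpret F: left_module field_ring ?F by (rule left_module_free_module[OF ring_field_ring])
  define ev where "ev = free_eval field_ring V (\<lambda>x. x)"
  have ev: "ev \<in> lmod_hom field_ring ?F V"
    unfolding ev_def by (rule free_eval_hom[OF V]) simp
  note ev_closed = lmod_homD(1)[OF ev] and ev_add = lmod_homD(2)[OF ev] and ev_smult = lmod_homD(3)[OF ev, simplified]
  have F_add: "p \<oplus>\<^bsub>?F\<^esub> q = p + q" for p q by (auto simp: free_module_def)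
  have F_smult: "c \<odot>\<^bsub>?F\<^esub> p = (\<lambda>x. c * p x)" for c p by (auto simp: free_module_def)
  have F_zero: "\<zero>\<^bsub>?F\<^esub> = 0" by (auto simp: free_module_def)
  let ?s = "\<lambda>c (p :: 'v \<Rightarrow> 'k) x. c * p x"
  interpret vs: vector_space ?s by unfold_locales (auto simp: fun_eq_iff algebra_simps)
  interpret self: vector_space "(*) :: 'k \<Rightarrow> 'k \<Rightarrow> 'k" by unfold_locales (auto simp: algebra_simps)
  interpret pair: vector_space_pair ?s "(*) :: 'k \<Rightarrow> 'k \<Rightarrow> 'k" ..
  \<comment> \<open>The preimage of \<open>H\<close> in the free space. It contains the kernel of
    \<open>ev\<close>, because \<open>H\<close> contains zero, and \<open>\<theta>\<close> composed
    with \<open>ev\<close> is linear on it and zero on that kernel.\<close>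
  define L where "L = {p \<in> carrier ?F. ev p \<in> H}"
  have ev_zero: "ev 0 = \<zero>\<^bsub>V\<^esub>" using lmod_hom_zero[OF F.left_module_axioms V ev] unfolding F_zero .
  have L0: "0 \<in> L" using F.M.zero_closed ev_zero H(2) unfolding L_def F_zero by simp
  have La: "p + q \<in> L \<and> \<theta> (ev (p + q)) = \<theta> (ev p) + \<theta> (ev q)" if "p \<in> L" "q \<in> L" for p q
    using that H_add F.M.a_closed[of p q] ev_add[of p q] unfolding L_def F_add by simp
  have Ls: "?s c p \<in> L \<and> \<theta> (ev (?s c p)) = c * \<theta> (ev p)" if "p \<in> L" for c p
    using that H_smult F.smult_closed[of c p] ev_smult[of p c] unfolding L_def F_smult by simp
  \<comment> \<open>\<open>B\<close> is a basis of \<open>L\<close> inside the space of all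
    functions; a linear map \<open>g\<close> on the whole type with the prescribed values on
    \<open>B\<close> agrees with \<open>\<theta>\<close> after \<open>ev\<close> on all of
    \<open>L\<close>.\<close>
  obtain B where B: "B \<subseteq> L" "vs.independent B" "L \<subseteq> vs.span B" by (rule vs.maximal_independent_subset)
  from pair.linear_independent_extend[OF B(2), of "\<lambda>p. \<theta> (ev p)"]
  obtain g where g: "Vector_Spaces.linear ?s (*) g" and gB: "\<forall>p\<in>B. g p = \<theta> (ev p)" by blast
  interpret g: Vector_Spaces.linear ?s "(*)" g by fact
  have \<theta>0: "\<theta> \<zero>\<^bsub>V\<^esub> = 0" using H_smult[OF H(2), of 0] H(2) by simp
  have gL: "g p = \<theta> (ev p)" if "p \<in> L" for p
  proof -
    have "p \<in> vs.span B" using that B(3) by blast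
    then have "p \<in> L \<and> g p = \<theta> (ev p)"
    proof (rule vs.span_induct)
      show "vs.subspace {p. p \<in> L \<and> g p = \<theta> (ev p)}"
        unfolding vs.subspace_def using L0 La Ls ev_zero \<theta>0 by (auto simp: g.add g.scale)
    qed (use B(1) gB in auto)
    then show ?thesis by blast
  qed
  \<comment> \<open>\<open>g\<close> vanishes on the kernel of \<open>ev\<close>, so it descends to
    the space \<open>V\<close>.\<close>
  have g_eq: "g p = g q" if pq: "p \<in> carrier ?F" "q \<in> carrier ?F" "ev p = ev q" for p q
  proof -
    define d where "d = p \<ominus>\<^bsub>?F\<^esub> q"
    have d: "d \<in> carrier ?F" using pq by (simp add: d_def)
    have dq: "d \<oplus>\<^bsub>?F\<^esub> q = p" using pq by (simp add: d_def a_minus_def F.M.a_assoc F.M.l_neg)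
    have "ev d \<oplus>\<^bsub>V\<^esub> ev q = ev q" using ev_add[OF d pq(2)] pq(3) dq by simp
    then have "ev d = \<zero>\<^bsub>V\<^esub>" using ev_closed d pq(2) by (simp add: V.M.add.r_cancel_one)
    then have "d \<in> L" "g d = 0" using d gL[of d] \<theta>0 H(2) by (auto simp: L_def)
    then show ?thesis using dq g.add[of d q] unfolding F_add by simp
  qed
  have \<delta>: "single x 1 \<in> carrier ?F" "ev (single x 1) = x" if x: "x \<in> carrier V" for x
  proof -
    have sub: "{y. single x (1 :: 'k) y \<noteq> \<zero>\<^bsub>field_ring\<^esub>} \<subseteq> {x}" by (auto simp: single_def)
    then show c: "single x 1 \<in> carrier ?F"
      using x finite_subset[OF sub] by (auto simp: free_module_def single_def)
    have "ev (single x 1) = (\<Oplus>\<^bsub>V\<^esub>y\<in>{x}. single x 1 y \<odot>\<^bsub>V\<^esub> y)"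
      unfolding ev_def by (rule free_eval_superset[OF V _ c _ sub]) (use x in auto)
    then show "ev (single x 1) = x" using x V.smult_one by (simp add: single_def)
  qed
  define \<Psi> where "\<Psi> x = g (single x 1)" for x
  show ?thesis
  proof (intro exI[of _ \<Psi>] conjI ballI allI)
    fix x y assume xy: "x \<in> carrier V" "y \<in> carrier V"
    have "g (single (x \<oplus>\<^bsub>V\<^esub> y) 1) = g (single x 1 \<oplus>\<^bsub>?F\<^esub> single y 1)"
      by (rule g_eq) (use xy \<delta> in \<open>simp_all add: ev_add\<close>)
    then show "\<Psi> (x \<oplus>\<^bsub>V\<^esub> y) = \<Psi> x + \<Psi> y" unfolding F_add by (simp add: \<Psi>_def g.add)
  next
    fix c x assume x: "x \<in> carrier V"
    have "g (single (c \<odot>\<^bsub>V\<^esub> x) 1) = g (c \<odot>\<^bsub>?F\<^esub> single x 1)"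
    proof (rule g_eq)
      show "c \<odot>\<^bsub>?F\<^esub> single x 1 \<in> carrier ?F" using \<delta>(1)[OF x] F.smult_closed by simp
      show "single (c \<odot>\<^bsub>V\<^esub> x) 1 \<in> carrier ?F" using \<delta>(1) V.smult_closed x by simp
      show "ev (single (c \<odot>\<^bsub>V\<^esub> x) 1) = ev (c \<odot>\<^bsub>?F\<^esub> single x 1)"
        using \<delta> V.smult_closed x by (simp add: ev_smult)
    qed
    then show "\<Psi> (c \<odot>\<^bsub>V\<^esub> x) = c * \<Psi> x" unfolding F_smult by (simp add: \<Psi>_def g.scale)
  next
    fix x assume "x \<in> H"
    then have "single x 1 \<in> L" "ev (single x 1) = x" using \<delta> H(1) by (auto simp: L_def)
    then show "\<Psi> x = \<theta> x" using gL by (simp add: \<Psi>_def)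
  qed
qed

section \<open>Modules generated by idempotents\<close>

lemma left_module_left_ideal:
  fixes R (structure)
  assumes "ring R" "\<epsilon> \<in> carrier R"
  shows "left_module R (ideal_module R {x \<otimes> \<epsilon> |x. x \<in> carrier R})"
proof -
  interpret ring R by fact
  show ?thesis
  proof (rule left_module_ideal_module[OF assms(1)])
    show "\<zero> \<in> {x \<otimes> \<epsilon> |x. x \<in> carrier R}" using assms(2) by (auto intro!: exI[of _ \<zero>])
  next
    fix a b assume "a \<in> {x \<otimes> \<epsilon> |x. x \<in> carrier R}" "b \<in> {x \<otimes> \<epsilon> |x. x \<in> carrier R}"
    then obtain x y where *: "x \<in> carrier R" "y \<in> carrier R" "a = x \<otimes> \<epsilon>" "b = y \<otimes> \<epsilon>" by blast
    then have "a \<oplus> b = (x \<oplus> y) \<otimes> \<epsilon>" using assms(2) by (simp add: l_distr)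
    with * show "a \<oplus> b \<in> {x \<otimes> \<epsilon> |x. x \<in> carrier R}" by blast
  next
    fix a b assume a: "a \<in> carrier R" and "b \<in> {x \<otimes> \<epsilon> |x. x \<in> carrier R}"
    then obtain x where *: "x \<in> carrier R" "b = x \<otimes> \<epsilon>" by blast
    then have "a \<otimes> b = (a \<otimes> x) \<otimes> \<epsilon>" using a assms(2) by (simp add: m_assoc)
    with a * show "a \<otimes> b \<in> {x \<otimes> \<epsilon> |x. x \<in> carrier R}" by blast
  qed (use assms(2) in auto)
qed

text \<open>The extension problem is moved from modules to vector spaces and back: take the
  coefficient at 1, extend it as a functional, and rebuild a map from its values on all translates.
  The rebuilt map commutes with units by reindexing the group and with nonunits because 1 - e
  annihilates them.\<close>

lemma injective_Ind_left_ideal: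
  fixes M :: "('m, 'z) monoid_scheme" (structure) and e :: "'m \<Rightarrow> 'k :: field"
  defines "K \<equiv> monoid_algebra TYPE('k) M" and "KG \<equiv> monoid_algebra TYPE('k) (units_of M)"
  assumes M: "Group.monoid M" and fin: "finite (carrier M)"
    and e: "e \<in> carrier K" "\<And>x. x \<in> Units M \<Longrightarrow> e x = 0"
      "\<And>a. \<lbrakk>a \<in> carrier M; a \<notin> Units M\<rbrakk> \<Longrightarrow> e \<otimes>\<^bsub>K\<^esub> single a 1 = single a 1"
    and \<epsilon>: "\<epsilon> \<in> carrier KG" "\<epsilon> \<otimes>\<^bsub>KG\<^esub> \<epsilon> = \<epsilon>"
  shows "injective_module K (Ind M (ideal_module KG {x \<otimes>\<^bsub>KG\<^esub> \<epsilon> |x. x \<in> carrier KG}))"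
proof -
  interpret M: Group.monoid M by fact
  have "Group.group (units_of M)" by (rule M.units_group)
  then have G: "Group.monoid (units_of M)" by (rule group.is_monoid)
  interpret K: ring K unfolding K_def by (rule ring_monoid_algebra[OF M])
  interpret KG: ring KG unfolding KG_def by (rule ring_monoid_algebra[OF G])
  define I where "I = {x \<otimes>\<^bsub>KG\<^esub> \<epsilon> |x. x \<in> carrier KG}"
  define W where "W = Ind M (ideal_module KG I)"
  have I_sub: "I \<subseteq> carrier KG" using \<epsilon>(1) by (auto simp: I_def)
  have I_I: "x \<otimes>\<^bsub>KG\<^esub> \<epsilon> \<in> I" if "x \<in> carrier KG" for x using that by (auto simp: I_def)
  have I_fix: "x \<otimes>\<^bsub>KG\<^esub> \<epsilon> = x" if "x \<in> I" for x
    using that \<epsilon> by (auto simp: I_def KG.m_assoc)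
  have lP: "left_module KG (ideal_module KG I)"
    unfolding I_def by (rule left_module_left_ideal[OF KG.ring_axioms \<epsilon>(1)])
  have lW: "left_module K W"
    unfolding K_def W_def by (rule left_module_Ind[OF M fin]) (use lP in \<open>simp add: KG_def\<close>)
  have K_iff: "f \<in> carrier K \<longleftrightarrow> finite {x. f x \<noteq> 0} \<and> {x. f x \<noteq> 0} \<subseteq> carrier M" for f
    by (simp add: K_def monoid_algebra_carrier_iff)
  have KG_iff: "f \<in> carrier KG \<longleftrightarrow> finite {x. f x \<noteq> 0} \<and> {x. f x \<noteq> 0} \<subseteq> Units M" for f
    by (simp add: KG_def monoid_algebra_carrier_iff units_of_carrier)
  have KG_K: "f \<in> carrier K" if "f \<in> carrier KG" for f
    using that carrier_units_of_algebra[OF M] unfolding K_def KG_def by blast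
  have KG_mult: "f \<otimes>\<^bsub>KG\<^esub> g = f \<otimes>\<^bsub>K\<^esub> g" for f g
    by (simp add: K_def KG_def mult_units_of_algebra)
  have add_eq: "f \<oplus>\<^bsub>K\<^esub> g = (\<lambda>x. f x + g x)" "f \<oplus>\<^bsub>KG\<^esub> g = (\<lambda>x. f x + g x)" for f g
    by (simp_all add: K_def KG_def)
  have zero_eq: "\<zero>\<^bsub>K\<^esub> = (\<lambda>x. 0)" "\<zero>\<^bsub>KG\<^esub> = (\<lambda>x. 0)" by (simp_all add: K_def KG_def)
  have one: "\<one>\<^bsub>K\<^esub> = single \<one> 1" "\<one>\<^bsub>KG\<^esub> = single \<one> 1"
    by (simp_all add: K_def KG_def single_def units_of_one)
  have single: "single a c \<in> carrier K" if "a \<in> carrier M" for a c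
    using single_closed[OF that] by (simp add: K_def)
  have single_mult: "single a c \<otimes>\<^bsub>K\<^esub> single b d = single (a \<otimes> b) (c * d)" for a b c d
    by (simp add: K_def single_mult_single)
  have scalar_comm: "f \<otimes>\<^bsub>K\<^esub> single \<one> c = single \<one> c \<otimes>\<^bsub>K\<^esub> f" if "f \<in> carrier K" for f c
    using M.scalar_mult[OF that[unfolded K_def], of c] M.mult_scalar[OF that[unfolded K_def], of c]
    by (simp add: K_def)
  define res where "res f = (\<lambda>x. if x \<in> Units M then f x else 0)" for f :: "'m \<Rightarrow> 'k"
  have W_simps: "carrier W = I" "f \<odot>\<^bsub>W\<^esub> w = res f \<otimes>\<^bsub>KG\<^esub> w" "w \<oplus>\<^bsub>W\<^esub> w' = w \<oplus>\<^bsub>KG\<^esub> w'" for f w w'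
    by (simp_all add: W_def Ind_def ideal_module_def res_def)
  have res_closed: "res f \<in> carrier KG" for f
    unfolding KG_iff by (auto simp: res_def intro: finite_subset[OF _ fin])
  have res_unit: "res (single a c) = single a c" if "a \<in> Units M" for a c
    using that by (auto simp: res_def single_def)
  have res_nonunit: "res (single a c) = (\<lambda>_. 0)" if "a \<notin> Units M" for a c
    using that by (auto simp: res_def single_def)
  \<comment> \<open>\<open>u\<close> = 1 - e annihilates the nonunits from the left, yet acts as the
    identity on \<open>W\<close>, since e has no coefficients at units.\<close>
  define u where "u = (\<lambda>x. single \<one> 1 x - e x)"
  have "{x. u x \<noteq> 0} \<subseteq> insert \<one> {x. e x \<noteq> 0}" by (auto simp: u_def single_def)
  then have "{x. u x \<noteq> 0} \<subseteq> carrier M" using e(1) unfolding K_iff by blast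
  then have u: "u \<in> carrier K" unfolding K_iff using finite_subset[OF _ fin] by blast
  have u_e: "u \<oplus>\<^bsub>K\<^esub> e = \<one>\<^bsub>K\<^esub>" by (simp add: add_eq one u_def)
  have res_u: "res u = single \<one> 1" using e(2) by (auto simp: res_def u_def single_def)
  have u_nonunit: "u \<otimes>\<^bsub>K\<^esub> single a c = \<zero>\<^bsub>K\<^esub>" if a: "a \<in> carrier M" "a \<notin> Units M" for a c
  proof -
    have "u \<otimes>\<^bsub>K\<^esub> single a 1 \<oplus>\<^bsub>K\<^esub> single a 1 = (u \<oplus>\<^bsub>K\<^esub> e) \<otimes>\<^bsub>K\<^esub> single a 1"
      using e(3)[OF a] K.l_distr[OF u e(1) single[OF a(1)]] by simp
    also have "\<dots> = single a 1" using u_e single[OF a(1)] by simp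
    finally have *: "u \<otimes>\<^bsub>K\<^esub> single a 1 = \<zero>\<^bsub>K\<^esub>"
      using u single[OF a(1)] by (simp add: K.add.r_cancel_one)
    have "single a c = single a 1 \<otimes>\<^bsub>K\<^esub> single \<one> c" using a(1) by (simp add: single_mult)
    then have "u \<otimes>\<^bsub>K\<^esub> single a c = u \<otimes>\<^bsub>K\<^esub> single a 1 \<otimes>\<^bsub>K\<^esub> single \<one> c"
      using u single[OF a(1)] single[OF M.one_closed] by (simp add: K.m_assoc)
    then show ?thesis using * single[OF M.one_closed] by simp
  qed
  have "\<exists>g\<in>lmod_hom K B W. \<forall>x\<in>carrier A. g (i x) = f x"
    if lA: "left_module K A" and lB: "left_module K B" and i: "i \<in> lmod_hom K A B"
      and inj: "inj_on i (carrier A)" and f: "f \<in> lmod_hom K A W"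
    for A B :: "('m \<Rightarrow> 'k, 'm \<Rightarrow> 'k) module" and i f
  proof -
    interpret A: left_module K A by fact
    interpret B: left_module K B by fact
    note i_simps = lmod_homD[OF i]
    have f_I: "f x \<in> I" if "x \<in> carrier A" for x using lmod_homD(1)[OF f that] by (simp add: W_simps)
    have f_KG: "f x \<in> carrier KG" if "x \<in> carrier A" for x using f_I[OF that] I_sub by blast
    have f_add: "f (x \<oplus>\<^bsub>A\<^esub> y) = f x \<oplus>\<^bsub>KG\<^esub> f y" if "x \<in> carrier A" "y \<in> carrier A" for x y
      using lmod_homD(2)[OF f that] by (simp add: W_simps)
    have f_smult: "f (r \<odot>\<^bsub>A\<^esub> x) = res r \<otimes>\<^bsub>KG\<^esub> f x" if "r \<in> carrier K" "x \<in> carrier A" for r x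
      using lmod_homD(3)[OF f that] by (simp add: W_simps)
    \<comment> \<open>\<open>B\<close> as a vector space over k, with scalars acting through the
      central elements \<open>single \<one> c\<close>.\<close>
    define V where "V = \<lparr>carrier = carrier B, monoid.mult = monoid.mult B, one = one B, zero = zero B,
      add = add B, smult = \<lambda>(c :: 'k) x. single \<one> c \<odot>\<^bsub>B\<^esub> x\<rparr>"
    have V_simps: "carrier V = carrier B" "\<zero>\<^bsub>V\<^esub> = \<zero>\<^bsub>B\<^esub>" "x \<oplus>\<^bsub>V\<^esub> y = x \<oplus>\<^bsub>B\<^esub> y"
      "c \<odot>\<^bsub>V\<^esub> x = single \<one> c \<odot>\<^bsub>B\<^esub> x" for x y c
      by (simp_all add: V_def)
    have V: "left_module field_ring V"
    proof (rule left_moduleI[OF ring_field_ring])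
      have "\<exists>y\<in>carrier V. y \<oplus>\<^bsub>V\<^esub> x = \<zero>\<^bsub>V\<^esub>" if "x \<in> carrier V" for x
        using that B.M.l_neg B.M.a_inv_closed unfolding V_simps by blast
      then show "abelian_group V"
        by (intro abelian_groupI) (auto simp: V_simps B.M.a_ac)
    next
      fix a b x assume "x \<in> carrier V"
      moreover have "single \<one> (a + b) = single \<one> a \<oplus>\<^bsub>K\<^esub> single \<one> b" by (auto simp: add_eq single_def)
      ultimately show "(a \<oplus>\<^bsub>field_ring\<^esub> b) \<odot>\<^bsub>V\<^esub> x = a \<odot>\<^bsub>V\<^esub> x \<oplus>\<^bsub>V\<^esub> b \<odot>\<^bsub>V\<^esub> x"
        by (simp add: V_simps single B.smult_l_distr)
    next
      fix a b x assume x: "x \<in> carrier V"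
      have "single \<one> (a * b) = single \<one> a \<otimes>\<^bsub>K\<^esub> single \<one> b" by (simp add: single_mult)
      with x show "(a \<otimes>\<^bsub>field_ring\<^esub> b) \<odot>\<^bsub>V\<^esub> x = a \<odot>\<^bsub>V\<^esub> (b \<odot>\<^bsub>V\<^esub> x)"
        by (simp add: V_simps single B.smult_assoc del: M.l_one)
    next
      fix x assume "x \<in> carrier V"
      then show "\<one>\<^bsub>field_ring\<^esub> \<odot>\<^bsub>V\<^esub> x = x" using B.smult_one[of x] by (simp add: V_simps one)
    qed (auto simp: V_simps single B.smult_r_distr)
    \<comment> \<open>The functional has to be prescribed on a subspace of \<open>B\<close>, so it
      is transported from \<open>A\<close> along the injection \<open>i\<close>.\<close>
    define \<theta> where "\<theta> b = f (inv_into (carrier A) i b) \<one>" for b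
    have \<theta>: "\<theta> (i x) = f x \<one>" if "x \<in> carrier A" for x
      using that inj by (simp add: \<theta>_def)
    have "\<exists>\<Psi>. (\<forall>x\<in>carrier V. \<forall>y\<in>carrier V. \<Psi> (x \<oplus>\<^bsub>V\<^esub> y) = \<Psi> x + \<Psi> y) \<and>
      (\<forall>c. \<forall>x\<in>carrier V. \<Psi> (c \<odot>\<^bsub>V\<^esub> x) = c * \<Psi> x) \<and> (\<forall>x\<in>i ` carrier A. \<Psi> x = \<theta> x)"
    proof (rule functional_extension[OF V])
      show "i ` carrier A \<subseteq> carrier V" using i_simps(1) by (auto simp: V_simps)
      show "\<zero>\<^bsub>V\<^esub> \<in> i ` carrier A"
        using lmod_hom_zero[OF lA lB i] by (metis A.M.zero_closed V_simps(2) imageI)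
    next
      fix x y assume "x \<in> i ` carrier A" "y \<in> i ` carrier A"
      then obtain x' y' where *: "x' \<in> carrier A" "y' \<in> carrier A" "x = i x'" "y = i y'" by auto
      then have eq: "x \<oplus>\<^bsub>V\<^esub> y = i (x' \<oplus>\<^bsub>A\<^esub> y')" by (simp add: V_simps i_simps)
      have "\<theta> (x \<oplus>\<^bsub>V\<^esub> y) = \<theta> x + \<theta> y" unfolding eq using * by (simp add: \<theta> f_add add_eq)
      moreover have "x \<oplus>\<^bsub>V\<^esub> y \<in> i ` carrier A" unfolding eq using * by simp
      ultimately show "x \<oplus>\<^bsub>V\<^esub> y \<in> i ` carrier A \<and> \<theta> (x \<oplus>\<^bsub>V\<^esub> y) = \<theta> x + \<theta> y" by blast
    next
      fix c x assume "x \<in> i ` carrier A"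
      then obtain x' where *: "x' \<in> carrier A" "x = i x'" by auto
      have eq: "c \<odot>\<^bsub>V\<^esub> x = i (single \<one> c \<odot>\<^bsub>A\<^esub> x')" using * single by (simp add: V_simps i_simps)
      have "f (single \<one> c \<odot>\<^bsub>A\<^esub> x') \<one> = (single \<one> c \<otimes>\<^bsub>K\<^esub> f x') \<one>"
        using * single by (simp add: f_smult res_unit KG_mult)
      also have "\<dots> = c * f x' \<one>"
        using M.scalar_mult[of "f x'" c] KG_K[OF f_KG[OF *(1)]] by (simp add: K_def)
      finally have "\<theta> (c \<odot>\<^bsub>V\<^esub> x) = c * \<theta> x" unfolding eq using * single by (simp add: \<theta>)
      moreover have "c \<odot>\<^bsub>V\<^esub> x \<in> i ` carrier A" unfolding eq using * single by simp
      ultimately show "c \<odot>\<^bsub>V\<^esub> x \<in> i ` carrier A \<and> \<theta> (c \<odot>\<^bsub>V\<^esub> x) = c * \<theta> x" by blast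
    qed
    then obtain \<Psi> where \<Psi>:
      "\<forall>x\<in>carrier B. \<forall>y\<in>carrier B. \<Psi> (x \<oplus>\<^bsub>B\<^esub> y) = \<Psi> x + \<Psi> y"
      "\<forall>c. \<forall>x\<in>carrier B. \<Psi> (single \<one> c \<odot>\<^bsub>B\<^esub> x) = c * \<Psi> x" "\<forall>x\<in>i ` carrier A. \<Psi> x = \<theta> x"
      unfolding V_simps by blast
    have \<Psi>_add: "\<Psi> (x \<oplus>\<^bsub>B\<^esub> y) = \<Psi> x + \<Psi> y" if "x \<in> carrier B" "y \<in> carrier B" for x y
      using \<Psi>(1) that by blast
    have \<Psi>_smult: "\<Psi> (single \<one> c \<odot>\<^bsub>B\<^esub> x) = c * \<Psi> x" if "x \<in> carrier B" for c x
      using \<Psi>(2) that by blast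
    have \<Psi>_i: "\<Psi> (i x) = f x \<one>" if "x \<in> carrier A" for x using \<Psi>(3) \<theta> that by simp
    have "\<Psi> \<zero>\<^bsub>B\<^esub> + \<Psi> \<zero>\<^bsub>B\<^esub> = \<Psi> \<zero>\<^bsub>B\<^esub> + 0" using \<Psi>_add[of "\<zero>\<^bsub>B\<^esub>" "\<zero>\<^bsub>B\<^esub>"] by simp
    then have \<Psi>_zero: "\<Psi> \<zero>\<^bsub>B\<^esub> = 0" by (rule add_left_imp_eq)
    \<comment> \<open>Each coefficient is a value of \<open>\<Psi>\<close> on a translate of b.
      Since \<open>\<Psi>\<close> is only k-linear, compatibility with the group comes from using
      all translates at once; no division by the group order occurs.\<close>
    define w where "w b = (\<lambda>g. if g \<in> Units M then \<Psi> (u \<odot>\<^bsub>B\<^esub> (single (inv g) 1 \<odot>\<^bsub>B\<^esub> b)) else 0)" for b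
    have inv_K: "single (inv g) c \<in> carrier K" if "g \<in> Units M" for g c
      using that single by simp
    have w_KG: "w b \<in> carrier KG" for b
      unfolding KG_iff by (auto simp: w_def intro: finite_subset[OF _ fin])
    have w_add: "w (b \<oplus>\<^bsub>B\<^esub> b') = w b \<oplus>\<^bsub>KG\<^esub> w b'" if "b \<in> carrier B" "b' \<in> carrier B" for b b'
      using that u inv_K by (auto simp: w_def add_eq B.smult_r_distr \<Psi>_add)
    have w_single: "w (single a c \<odot>\<^bsub>B\<^esub> b) = res (single a c) \<otimes>\<^bsub>KG\<^esub> w b"
      if a: "a \<in> carrier M" and b: "b \<in> carrier B" for a c b
    proof (cases "a \<in> Units M")
      case True
      have "w (single a c \<odot>\<^bsub>B\<^esub> b) g = (single a c \<otimes>\<^bsub>K\<^esub> w b) g" for g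
      proof (cases "g \<in> Units M")
        case g: True
        \<comment> \<open>Multiplying by \<open>a\<close> moves the coefficient at \<open>?h\<close>
          to g. The translate of a b by g^(-1) is the translate of b by the inverse of
          \<open>?h\<close>, and the scalar c passes \<open>u\<close> by centrality.\<close>
        let ?h = "inv a \<otimes> g"
        have h: "?h \<in> Units M" using True g by simp
        have gM: "g \<in> carrier M" using g by (rule M.Units_closed)
        have "?h \<otimes> (inv g \<otimes> a) = inv a \<otimes> (g \<otimes> inv g) \<otimes> a" using True g a gM
          by (simp add: M.m_assoc del: M.Units_r_inv M.Units_l_inv)
        then have "?h \<otimes> (inv g \<otimes> a) = \<one>" using True g a by simp
        then have inv_h: "inv ?h = inv g \<otimes> a"
          using M.inv_unique[of "inv ?h" ?h "inv g \<otimes> a"] h g a True gM M.Units_closed[OF h] by simp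
        have "u \<odot>\<^bsub>B\<^esub> (single (inv g) 1 \<odot>\<^bsub>B\<^esub> (single a c \<odot>\<^bsub>B\<^esub> b))
            = (u \<otimes>\<^bsub>K\<^esub> (single (inv g) 1 \<otimes>\<^bsub>K\<^esub> single a c)) \<odot>\<^bsub>B\<^esub> b"
          using u inv_K[OF g] single[OF a] b by (simp add: B.smult_assoc)
        also have "single (inv g) 1 \<otimes>\<^bsub>K\<^esub> single a c = single \<one> c \<otimes>\<^bsub>K\<^esub> single (inv ?h) 1"
          using g a by (simp add: single_mult inv_h)
        also have "u \<otimes>\<^bsub>K\<^esub> (single \<one> c \<otimes>\<^bsub>K\<^esub> single (inv ?h) 1) = single \<one> c \<otimes>\<^bsub>K\<^esub> (u \<otimes>\<^bsub>K\<^esub> single (inv ?h) 1)"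
          using u inv_K[OF h] single[OF M.one_closed] scalar_comm[OF u, of c] by (simp flip: K.m_assoc)
        also have "\<dots> \<odot>\<^bsub>B\<^esub> b = single \<one> c \<odot>\<^bsub>B\<^esub> (u \<odot>\<^bsub>B\<^esub> (single (inv ?h) 1 \<odot>\<^bsub>B\<^esub> b))"
          using u inv_K[OF h] single[OF M.one_closed] b by (simp add: B.smult_assoc)
        finally have "w (single a c \<odot>\<^bsub>B\<^esub> b) g = c * w b ?h"
          using g h u inv_K[OF h] b by (simp add: w_def \<Psi>_smult)
        then show ?thesis
          using M.single_unit_mult_apply[of "w b" a g c] KG_K[OF w_KG[of b]] True g gM
          unfolding K_def by simp
      next
        case False
        have "single a c \<otimes>\<^bsub>K\<^esub> w b \<in> carrier KG"
          using KG.m_closed[OF res_closed[of "single a c"] w_KG[of b]] res_unit[OF True] by (simp add: KG_mult)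
        with False have "(single a c \<otimes>\<^bsub>K\<^esub> w b) g = 0" unfolding KG_iff by blast
        with False show ?thesis by (simp add: w_def)
      qed
      then show ?thesis by (auto simp: res_unit[OF True] KG_mult)
    next
      case False
      \<comment> \<open>A nonunit \<open>a\<close> stays a nonunit after multiplication by
        \<open>inv g\<close>, so \<open>u\<close> annihilates it.\<close>
      have "u \<odot>\<^bsub>B\<^esub> (single (inv g) 1 \<odot>\<^bsub>B\<^esub> (single a c \<odot>\<^bsub>B\<^esub> b)) = \<zero>\<^bsub>B\<^esub>" if g: "g \<in> Units M" for g
      proof -
        have ga: "inv g \<otimes> a \<in> carrier M" "inv g \<otimes> a \<notin> Units M"
          using g a finite_monoid_Units_factor(2)[OF M fin _ a] False by auto
        have "u \<odot>\<^bsub>B\<^esub> (single (inv g) 1 \<odot>\<^bsub>B\<^esub> (single a c \<odot>\<^bsub>B\<^esub> b))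
            = (u \<otimes>\<^bsub>K\<^esub> (single (inv g) 1 \<otimes>\<^bsub>K\<^esub> single a c)) \<odot>\<^bsub>B\<^esub> b"
          using u inv_K[OF g] single[OF a] b by (simp add: B.smult_assoc)
        then show ?thesis using u_nonunit[OF ga] b by (simp add: single_mult)
      qed
      then have "w (single a c \<odot>\<^bsub>B\<^esub> b) = (\<lambda>_. 0)" by (auto simp: w_def \<Psi>_zero)
      then show ?thesis
        using KG.l_null[OF w_KG[of b]] by (simp add: res_nonunit[OF False] zero_eq)
    qed
    have w_smult: "w (r \<odot>\<^bsub>B\<^esub> b) = res r \<otimes>\<^bsub>KG\<^esub> w b" if r: "r \<in> carrier K" and b: "b \<in> carrier B" for r b
      using r unfolding K_def
    proof (induction rule: monoid_algebra_induct)
      case zero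
      have "u \<odot>\<^bsub>B\<^esub> (single (inv g) 1 \<odot>\<^bsub>B\<^esub> \<zero>\<^bsub>B\<^esub>) = \<zero>\<^bsub>B\<^esub>" if "g \<in> Units M" for g
        using that u inv_K by simp
      then have "w \<zero>\<^bsub>B\<^esub> = (\<lambda>_. 0)" by (auto simp: w_def \<Psi>_zero)
      moreover have "res (\<lambda>_. 0) = (\<lambda>_. 0)" by (auto simp: res_def)
      ultimately show ?case
        using B.smult_l_null[OF b] KG.l_null[OF w_KG[of b]] by (simp add: zero_eq)
    next
      case (add r a c)
      then have r: "r \<in> carrier K" by (simp add: K_def)
      have s: "single a c \<in> carrier K" using add single by simp
      have "w ((r \<oplus>\<^bsub>K\<^esub> single a c) \<odot>\<^bsub>B\<^esub> b) = w (r \<odot>\<^bsub>B\<^esub> b) \<oplus>\<^bsub>KG\<^esub> w (single a c \<odot>\<^bsub>B\<^esub> b)"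
        using r s b by (simp add: B.smult_l_distr w_add)
      also have "\<dots> = (res r \<oplus>\<^bsub>KG\<^esub> res (single a c)) \<otimes>\<^bsub>KG\<^esub> w b"
        using add.IH add.hyps b by (simp add: w_single KG.l_distr res_closed w_KG)
      also have "res r \<oplus>\<^bsub>KG\<^esub> res (single a c) = res (r \<oplus>\<^bsub>K\<^esub> single a c)"
        by (auto simp: add_eq res_def)
      finally show ?case by (simp add: add_eq)
    qed
    \<comment> \<open>Right multiplication with \<open>\<epsilon>\<close> carries kG into
      \<open>I\<close>, fixes \<open>I\<close> and commutes with the left action.\<close>
    define h where "h b = w b \<otimes>\<^bsub>KG\<^esub> \<epsilon>" for b
    have "h \<in> lmod_hom K B W"
      unfolding lmod_hom_def W_simps h_def
    proof (intro CollectI conjI ballI funcsetI)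
      fix b assume "b \<in> carrier B"
      show "w b \<otimes>\<^bsub>KG\<^esub> \<epsilon> \<in> I" by (rule I_I[OF w_KG])
    next
      fix b b' assume "b \<in> carrier B" "b' \<in> carrier B"
      then show "w (b \<oplus>\<^bsub>B\<^esub> b') \<otimes>\<^bsub>KG\<^esub> \<epsilon> = w b \<otimes>\<^bsub>KG\<^esub> \<epsilon> \<oplus>\<^bsub>KG\<^esub> w b' \<otimes>\<^bsub>KG\<^esub> \<epsilon>"
        using w_KG \<epsilon>(1) by (simp add: w_add KG.l_distr)
    next
      fix r b assume "r \<in> carrier K" "b \<in> carrier B"
      then show "w (r \<odot>\<^bsub>B\<^esub> b) \<otimes>\<^bsub>KG\<^esub> \<epsilon> = res r \<otimes>\<^bsub>KG\<^esub> (w b \<otimes>\<^bsub>KG\<^esub> \<epsilon>)"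
        using w_KG res_closed \<epsilon>(1) by (simp add: w_smult KG.m_assoc)
    qed
    moreover have "h (i x) = f x" if x: "x \<in> carrier A" for x
    proof -
      have "w (i x) g = f x g" for g
      proof (cases "g \<in> Units M")
        case True
        have "u \<odot>\<^bsub>B\<^esub> (single (inv g) 1 \<odot>\<^bsub>B\<^esub> i x) = i (u \<odot>\<^bsub>A\<^esub> (single (inv g) 1 \<odot>\<^bsub>A\<^esub> x))"
          using u inv_K[OF True] x by (simp add: i_simps)
        then have "w (i x) g = f (u \<odot>\<^bsub>A\<^esub> (single (inv g) 1 \<odot>\<^bsub>A\<^esub> x)) \<one>"
          using True u inv_K[OF True] x by (simp add: w_def \<Psi>_i)
        \<comment> \<open>Inside \<open>A\<close> the map \<open>f\<close> is already a
          homomorphism, so \<open>u\<close> disappears and only the translate of \<open>f x\<close>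
          remains, whose coefficient at 1 is that of \<open>f x\<close> at g.\<close>
        also have "f (u \<odot>\<^bsub>A\<^esub> (single (inv g) 1 \<odot>\<^bsub>A\<^esub> x)) = \<one>\<^bsub>KG\<^esub> \<otimes>\<^bsub>KG\<^esub> (single (inv g) 1 \<otimes>\<^bsub>KG\<^esub> f x)"
          using True u inv_K[OF True] x by (simp add: f_smult res_u res_unit one)
        also have "\<dots> = single (inv g) 1 \<otimes>\<^bsub>KG\<^esub> f x"
          using KG.m_closed[OF res_closed[of "single (inv g) 1"] f_KG[OF x]] True by (simp add: res_unit)
        also have "\<dots> \<one> = f x g"
          using M.single_unit_mult_apply[of "f x" "inv g" \<one> 1] KG_K[OF f_KG[OF x]] True M.Units_closed[OF True]
          by (simp add: KG_mult K_def)
        finally show ?thesis .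
      next
        case False
        then have "f x g = 0" using f_KG[OF x] unfolding KG_iff by blast
        with False show ?thesis by (simp add: w_def)
      qed
      then have "w (i x) = f x" by auto
      then show ?thesis using I_fix[OF f_I[OF x]] by (simp add: h_def)
    qed
    ultimately show ?thesis by blast
  qed
  then have "injective_module K W"
    unfolding injective_module_def injective_wrt_def using lW by blast
  then show ?thesis unfolding W_def I_def .
qed

section \<open>Primitive idempotents and their projective indecomposable left ideals\<close>

definition orthogonal_idempotents :: "('r, 'z) ring_scheme \<Rightarrow> 'r set \<Rightarrow> bool" where
  "orthogonal_idempotents R E \<longleftrightarrow> E \<subseteq> carrier R \<and> \<zero>\<^bsub>R\<^esub> \<notin> E \<and> (\<forall>a\<in>E. a \<otimes>\<^bsub>R\<^esub> a = a) \<and>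
     (\<forall>a\<in>E. \<forall>b\<in>E. a \<noteq> b \<longrightarrow> a \<otimes>\<^bsub>R\<^esub> b = \<zero>\<^bsub>R\<^esub>)"

definition primitive_idempotent :: "('r, 'z) ring_scheme \<Rightarrow> 'r \<Rightarrow> bool" where
  "primitive_idempotent R \<epsilon> \<longleftrightarrow> \<epsilon> \<in> carrier R \<and> \<epsilon> \<noteq> \<zero>\<^bsub>R\<^esub> \<and> \<epsilon> \<otimes>\<^bsub>R\<^esub> \<epsilon> = \<epsilon> \<and>
     (\<forall>a\<in>carrier R. \<forall>b\<in>carrier R. a \<oplus>\<^bsub>R\<^esub> b = \<epsilon> \<and> a \<otimes>\<^bsub>R\<^esub> a = a \<and> b \<otimes>\<^bsub>R\<^esub> b = b \<and>
        a \<otimes>\<^bsub>R\<^esub> b = \<zero>\<^bsub>R\<^esub> \<and> b \<otimes>\<^bsub>R\<^esub> a = \<zero>\<^bsub>R\<^esub> \<longrightarrow> a = \<zero>\<^bsub>R\<^esub> \<or> b = \<zero>\<^bsub>R\<^esub>)"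

text \<open>A member of an orthogonal family of maximal size is primitive, since splitting it would
  enlarge the family.\<close>

lemma (in ring) ex_primitive_idempotent:
  assumes "\<one> \<noteq> \<zero>"
    and bound: "\<And>E. orthogonal_idempotents R E \<Longrightarrow> finite E \<and> card E \<le> n"
  shows "\<exists>\<epsilon>. primitive_idempotent R \<epsilon>"
proof -
  let ?Q = "\<lambda>k. \<exists>E. orthogonal_idempotents R E \<and> card E = k"
  have "orthogonal_idempotents R {\<one>}" using assms(1) by (auto simp: orthogonal_idempotents_def)
  then have Q1: "?Q 1" by (intro exI[of _ "{\<one>}"]) simp
  have b: "\<And>k. ?Q k \<Longrightarrow> k \<le> n" using bound by blast
  obtain E where E: "orthogonal_idempotents R E" and max: "\<And>E'. orthogonal_idempotents R E' \<Longrightarrow> card E' \<le> card E"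
    using GreatestI_nat[of ?Q, OF Q1 b] Greatest_le_nat[of ?Q, OF _ b] by metis
  have "card E \<ge> 1" using max[OF \<open>orthogonal_idempotents R {\<one>}\<close>] by simp
  then obtain \<epsilon> where \<epsilon>E: "\<epsilon> \<in> E" by fastforce
  have fin: "finite E" using bound[OF E] by blast
  have E_car: "x \<in> carrier R" if "x \<in> E" for x using E that by (auto simp: orthogonal_idempotents_def)
  have E_idem: "x \<otimes> x = x" if "x \<in> E" for x using E that by (auto simp: orthogonal_idempotents_def)
  have E_orth: "x \<otimes> y = \<zero>" if "x \<in> E" "y \<in> E" "x \<noteq> y" for x y
    using E that by (auto simp: orthogonal_idempotents_def)
  have "a = \<zero> \<or> b = \<zero>"
    if ab: "a \<in> carrier R" "b \<in> carrier R" "a \<oplus> b = \<epsilon>" "a \<otimes> a = a" "b \<otimes> b = b" "a \<otimes> b = \<zero>" "b \<otimes> a = \<zero>"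
    for a b
  proof (rule ccontr)
    assume nz: "\<not> (a = \<zero> \<or> b = \<zero>)"
    have part: "c \<otimes> x = \<zero>" "x \<otimes> c = \<zero>" if c: "c \<in> carrier R" "c \<otimes> \<epsilon> = c" "\<epsilon> \<otimes> c = c" and x: "x \<in> E - {\<epsilon>}" for c x
    proof -
      have ne: "\<epsilon> \<noteq> x" "x \<noteq> \<epsilon>" using x by auto
      have "c \<otimes> x = c \<otimes> (\<epsilon> \<otimes> x)" using c x E_car \<epsilon>E by (simp flip: m_assoc)
      then show "c \<otimes> x = \<zero>" using E_orth[OF \<epsilon>E _ ne(1)] x c(1) by simp
      have "x \<otimes> c = (x \<otimes> \<epsilon>) \<otimes> c" using c x E_car \<epsilon>E by (simp add: m_assoc)
      then show "x \<otimes> c = \<zero>" using E_orth[OF _ \<epsilon>E ne(2)] x c(1) by simp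
    qed
    have a: "a \<otimes> \<epsilon> = a" "\<epsilon> \<otimes> a = a" using ab by (auto simp flip: ab(3) simp: l_distr r_distr)
    have b: "b \<otimes> \<epsilon> = b" "\<epsilon> \<otimes> b = b" using ab by (auto simp flip: ab(3) simp: l_distr r_distr)
    note pa = part[OF ab(1) a] and pb = part[OF ab(2) b]
    \<comment> \<open>\<open>a\<close> annihilates all of \<open>E - {\<epsilon>}\<close> but not
      itself, as a a = a is nonzero, and likewise \<open>b\<close>; also a = b would give a = a b =
      0. So one member is replaced by two new ones.\<close>
    have new: "a \<notin> E - {\<epsilon>}" "b \<notin> E - {\<epsilon>}" "a \<noteq> b"
      using pa(1)[of a] pb(1)[of b] ab nz by auto
    let ?E = "insert a (insert b (E - {\<epsilon>}))"
    have "\<zero> \<notin> E" using E by (auto simp: orthogonal_idempotents_def)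
    then have "orthogonal_idempotents R ?E"
      unfolding orthogonal_idempotents_def
      using ab nz pa pb E_car E_idem E_orth by auto
    moreover have "card ?E = Suc (card E)"
      using new fin card_Suc_Diff1[OF fin \<epsilon>E] by simp
    ultimately show False using max[of ?E] by simp
  qed
  moreover have "\<epsilon> \<noteq> \<zero>" using E \<epsilon>E by (auto simp: orthogonal_idempotents_def)
  ultimately have "primitive_idempotent R \<epsilon>"
    unfolding primitive_idempotent_def using E_car[OF \<epsilon>E] E_idem[OF \<epsilon>E] by blast
  then show ?thesis ..
qed

text \<open>A homomorphism on R \<epsilon> is determined by its value at \<epsilon>, because x = x
  \<epsilon> there. Any preimage \<open>a\<close> of \<open>f \<epsilon>\<close> yields the lift x
  \<mapsto> x a.\<close>

lemma projective_left_ideal: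
  fixes R (structure)
  assumes "ring R" and \<epsilon>: "\<epsilon> \<in> carrier R" "\<epsilon> \<otimes> \<epsilon> = \<epsilon>"
  shows "projective_module R (ideal_module R {x \<otimes> \<epsilon> |x. x \<in> carrier R})"
proof -
  interpret ring R by fact
  define I where "I = {x \<otimes> \<epsilon> |x. x \<in> carrier R}"
  let ?P = "ideal_module R I"
  have P_simps: "carrier ?P = I" "r \<odot>\<^bsub>?P\<^esub> x = r \<otimes> x" "x \<oplus>\<^bsub>?P\<^esub> y = x \<oplus> y" for r x y
    by (simp_all add: ideal_module_def)
  have I: "x \<in> carrier R" "x \<otimes> \<epsilon> = x" if "x \<in> I" for x using that \<epsilon> by (auto simp: I_def m_assoc)
  have \<epsilon>I: "\<epsilon> \<in> I" unfolding I_def using \<epsilon> by force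
  have "\<exists>g\<in>lmod_hom R ?P A. \<forall>x\<in>carrier ?P. p (g x) = f x"
    if lA: "left_module R A" and lB: "left_module R B" and p: "p \<in> lmod_hom R A B"
      and sur: "p ` carrier A = carrier B" and f: "f \<in> lmod_hom R ?P B"
    for A :: "('a, 'a \<Rightarrow> 'a) module" and B :: "('a, 'a) module" and p f
  proof -
    interpret A: left_module R A by fact
    have "f \<epsilon> \<in> carrier B" using lmod_homD(1)[OF f] \<epsilon>I by (simp add: P_simps)
    then obtain a where a: "a \<in> carrier A" "p a = f \<epsilon>" using sur by (metis imageE)
    have "(\<lambda>x. x \<odot>\<^bsub>A\<^esub> a) \<in> lmod_hom R ?P A"
      unfolding lmod_hom_def P_simps using I a(1) by (auto simp: A.smult_l_distr A.smult_assoc)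
    moreover have "p (x \<odot>\<^bsub>A\<^esub> a) = f x" if "x \<in> I" for x
      using lmod_homD(3)[OF p, of x a] lmod_homD(3)[OF f, of x \<epsilon>] I[OF that] a \<epsilon>I by (simp add: P_simps)
    ultimately show ?thesis unfolding P_simps by (intro bexI[of _ "\<lambda>x. x \<odot>\<^bsub>A\<^esub> a"]) auto
  qed
  then show ?thesis
    unfolding projective_module_def projective_wrt_def
    using left_module_left_ideal[OF assms(1) \<epsilon>(1)] by (auto simp: I_def)
qed

text \<open>A direct decomposition splits \<epsilon> as a + b with a in U and b in V. Comparing a =
  a \<epsilon> = a a + a b, and the same for b, in the direct sum makes a and b orthogonal
  idempotents, so one is zero; then \<epsilon> lies in the other summand, which is
  everything.\<close>

lemma indecomposable_left_ideal:
  fixes R (structure)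
  assumes "ring R" and \<epsilon>: "primitive_idempotent R \<epsilon>"
  shows "indecomposable_module R (ideal_module R {x \<otimes> \<epsilon> |x. x \<in> carrier R})"
proof -
  interpret ring R by fact
  define I where "I = {x \<otimes> \<epsilon> |x. x \<in> carrier R}"
  let ?P = "ideal_module R I"
  have \<epsilon>R: "\<epsilon> \<in> carrier R" "\<epsilon> \<otimes> \<epsilon> = \<epsilon>" "\<epsilon> \<noteq> \<zero>" using \<epsilon> by (auto simp: primitive_idempotent_def)
  have P_simps: "carrier ?P = I" "r \<odot>\<^bsub>?P\<^esub> x = r \<otimes> x" "x \<oplus>\<^bsub>?P\<^esub> y = x \<oplus> y" "\<zero>\<^bsub>?P\<^esub> = \<zero>" for r x y
    by (simp_all add: ideal_module_def)
  have I: "x \<in> carrier R" "x \<otimes> \<epsilon> = x" if "x \<in> I" for x using that \<epsilon>R by (auto simp: I_def m_assoc)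
  have \<epsilon>I: "\<epsilon> \<in> I" unfolding I_def using \<epsilon>R by force
  have P: "left_module R ?P" unfolding I_def by (rule left_module_left_ideal[OF assms(1) \<epsilon>R(1)])
  interpret P: left_module R ?P by (rule P)
  have "U = {\<zero>} \<or> V = {\<zero>}"
    if U: "submodule U R ?P" and V: "submodule V R ?P"
      and UV: "U <+>\<^bsub>?P\<^esub> V = I" and disj: "U \<inter> V = {\<zero>}" for U V
  proof -
    interpret U: submodule U R ?P by fact
    interpret V: submodule V R ?P by fact
    have sub: "U \<subseteq> I" "V \<subseteq> I" using U.subset V.subset by (simp_all add: P_simps)
    have U_cl: "x \<oplus> y \<in> U" "r \<otimes> x \<in> U" if "x \<in> U" "y \<in> U" "r \<in> carrier R" for x y r
      using U.m_closed[OF that(1,2)] U.smult_closed[OF that(3,1)] by (simp_all add: P_simps)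
    have V_cl: "x \<oplus> y \<in> V" "r \<otimes> x \<in> V" if "x \<in> V" "y \<in> V" "r \<in> carrier R" for x y r
      using V.m_closed[OF that(1,2)] V.smult_closed[OF that(3,1)] by (simp_all add: P_simps)
    have "\<epsilon> \<in> U <+>\<^bsub>?P\<^esub> V" using \<epsilon>I UV by simp
    then obtain a b where ab: "a \<in> U" "b \<in> V" "\<epsilon> = a \<oplus> b"
      unfolding set_add_def' by (auto simp: P_simps)
    have R: "a \<in> carrier R" "b \<in> carrier R" and a: "a \<otimes> \<epsilon> = a" and b: "b \<otimes> \<epsilon> = b"
      using I[OF subsetD[OF sub(1) ab(1)]] I[OF subsetD[OF sub(2) ab(2)]] by simp_all
    have split: "x = \<zero> \<and> y = \<zero>" if xy: "x \<in> U" "y \<in> V" "x \<oplus> y = \<zero>" for x y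
    proof -
      have c: "x \<in> carrier R" "y \<in> carrier R"
        using I(1)[OF subsetD[OF sub(1) xy(1)]] I(1)[OF subsetD[OF sub(2) xy(2)]] by simp_all
      have "\<ominus> x = y" using minus_equality[of y x] xy(3) c by (simp add: a_comm)
      then have "y = (\<ominus> \<one>) \<otimes> x" using c by (simp add: l_minus)
      then have "y \<in> U" using U_cl(2)[OF xy(1,1), of "\<ominus> \<one>"] by simp
      then have "y = \<zero>" using disj xy(2) by blast
      then show "x = \<zero> \<and> y = \<zero>" using xy c by simp
    qed
    have aa: "(a \<otimes> a \<oplus> \<ominus> a) \<oplus> a \<otimes> b = \<zero>"
    proof -
      have "a \<otimes> a \<oplus> a \<otimes> b = a" using a R ab(3) by (simp add: r_distr)
      then have "(a \<otimes> a \<oplus> a \<otimes> b) \<oplus> \<ominus> a = \<zero>" using R by (simp add: r_neg)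
      then show ?thesis using R by (simp add: a_ac)
    qed
    have bb: "b \<otimes> a \<oplus> (b \<otimes> b \<oplus> \<ominus> b) = \<zero>"
    proof -
      have "b \<otimes> a \<oplus> b \<otimes> b = b" using b R ab(3) by (simp add: r_distr)
      then have "(b \<otimes> a \<oplus> b \<otimes> b) \<oplus> \<ominus> b = \<zero>" using R by (simp add: r_neg)
      then show ?thesis using R by (simp add: a_ac)
    qed
    have neg: "\<ominus> a \<in> U" "\<ominus> b \<in> V"
      using U_cl(2)[OF ab(1,1), of "\<ominus> \<one>"] V_cl(2)[OF ab(2,2), of "\<ominus> \<one>"] R by (simp_all add: l_minus)
    have "a \<otimes> a \<oplus> \<ominus> a \<in> U" "b \<otimes> a \<in> U"
      using U_cl(1)[OF U_cl(2)[OF ab(1,1) R(1)] neg(1) R(1)] U_cl(2)[OF ab(1,1) R(2)] by simp_all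
    moreover have "b \<otimes> b \<oplus> \<ominus> b \<in> V" "a \<otimes> b \<in> V"
      using V_cl(1)[OF V_cl(2)[OF ab(2,2) R(2)] neg(2) R(1)] V_cl(2)[OF ab(2,2) R(1)] by simp_all
    ultimately have z: "a \<otimes> a \<oplus> \<ominus> a = \<zero>" "a \<otimes> b = \<zero>" "b \<otimes> a = \<zero>" "b \<otimes> b \<oplus> \<ominus> b = \<zero>"
      using split[of "a \<otimes> a \<oplus> \<ominus> a" "a \<otimes> b"] split[of "b \<otimes> a" "b \<otimes> b \<oplus> \<ominus> b"] aa bb by simp_all
    have "a \<otimes> a = a" "b \<otimes> b = b"
      using minus_equality[OF z(1)] minus_equality[OF z(4)] R by simp_all
    then have "a = \<zero> \<or> b = \<zero>"
      using \<epsilon> R ab(3) z(2,3) unfolding primitive_idempotent_def by blast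
    moreover have "U = {\<zero>}" if "a = \<zero>"
    proof -
      have "\<epsilon> \<in> V" using ab that R by simp
      then have "x \<in> V" if "x \<in> I" for x using V_cl(2)[of \<epsilon> \<epsilon> x] I[OF that] by simp
      then show ?thesis using sub(1) disj by blast
    qed
    moreover have "V = {\<zero>}" if "b = \<zero>"
    proof -
      have "\<epsilon> \<in> U" using ab that R by simp
      then have "x \<in> U" if "x \<in> I" for x using U_cl(2)[of \<epsilon> \<epsilon> x] I[OF that] by simp
      then show ?thesis using sub(2) disj by blast
    qed
    ultimately show ?thesis by blast
  qed
  moreover have "I \<noteq> {\<zero>}" using \<epsilon>I \<epsilon>R(3) by blast
  ultimately have "indecomposable_module R ?P"
    unfolding indecomposable_module_def P_simps using P by blast
  then show ?thesis unfolding I_def .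
qed

text \<open>Multiplying a linear relation among orthogonal idempotents by one of them isolates its
  coefficient. They are therefore independent in a space spanned by the monoid elements.\<close>

lemma orthogonal_idempotents_monoid_algebra_bound:
  fixes M (structure)
  assumes M: "Group.monoid M" and fin: "finite (carrier M)"
    and E: "orthogonal_idempotents (monoid_algebra TYPE('k :: field) M) E"
  shows "finite E \<and> card E \<le> card (carrier M)"
proof -
  interpret M: Group.monoid M by fact
  let ?K = "monoid_algebra TYPE('k) M"
  interpret K: ring ?K by (rule ring_monoid_algebra[OF M])
  let ?s = "\<lambda>c (f :: 'a \<Rightarrow> 'k) x. c * f x"
  interpret vs: vector_space ?s by unfold_locales (auto simp: fun_eq_iff algebra_simps)
  let ?S = "(\<lambda>a. single a (1 :: 'k)) ` carrier M"
  have E_car: "v \<in> carrier ?K" if "v \<in> E" for v using E that by (auto simp: orthogonal_idempotents_def)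
  have zero: "\<zero>\<^bsub>?K\<^esub> = 0" by auto
  have add: "f \<oplus>\<^bsub>?K\<^esub> g = f + g" for f g by auto
  have s_closed: "?s c v \<in> carrier ?K" if "v \<in> carrier ?K" for c v
    using K.m_closed[OF single_closed[of \<one> M c] that] M.scalar_mult[OF that, of c] by simp
  have s_mult: "?s c v \<otimes>\<^bsub>?K\<^esub> w = ?s c (v \<otimes>\<^bsub>?K\<^esub> w)" if "v \<in> carrier ?K" "w \<in> carrier ?K" for c v w
    using K.m_assoc[OF single_closed[of \<one> M c] that] M.scalar_mult[OF that(1), of c]
      M.scalar_mult[OF K.m_closed[OF that], of c] by simp
  have "vs.independent E"
    unfolding vs.independent_explicit_module
  proof (intro allI impI)
    fix t c v assume t: "finite t" "t \<subseteq> E" "(\<Sum>v\<in>t. ?s (c v) v) = 0" and v: "v \<in> t"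
    \<comment> \<open>The conditional lets the induction pass through subsets that do not contain
      \<open>v\<close>.\<close>
    have "(\<Sum>x\<in>t. ?s (c x) x) \<in> carrier ?K \<and>
        (\<Sum>x\<in>t. ?s (c x) x) \<otimes>\<^bsub>?K\<^esub> v = (if v \<in> t then ?s (c v) v else 0)"
      using t(1,2)
    proof (induction t rule: finite_induct)
      case empty
      show ?case using K.zero_closed K.l_null[of v] E_car t(2) v unfolding zero by (auto simp: zero_fun_def)
    next
      case (insert x t)
      have x: "x \<in> carrier ?K" "v \<in> carrier ?K" using insert.prems E_car t(2) v by blast+
      have "x \<otimes>\<^bsub>?K\<^esub> v = (if x = v then v else 0)"
        using E insert.prems t(2) v unfolding orthogonal_idempotents_def zero by auto
      then have "?s (c x) x \<otimes>\<^bsub>?K\<^esub> v = (if x = v then ?s (c v) v else 0)"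
        using s_mult[OF x, of "c x"] by auto
      then show ?case
        using insert K.l_distr[OF s_closed[OF x(1), of "c x"] _ x(2)] K.a_closed[OF s_closed[OF x(1), of "c x"]]
        unfolding add by (auto simp: plus_fun_def zero_fun_def)
    qed
    then have "?s (c v) v = 0 \<otimes>\<^bsub>?K\<^esub> v" using t(3) v by simp
    also have "\<dots> = 0" using K.l_null[of v] E_car t(2) v unfolding zero by blast
    finally have "?s (c v) v = 0" .
    moreover have "v \<noteq> 0" using E t(2) v unfolding orthogonal_idempotents_def zero by blast
    ultimately show "c v = 0" using vs.scale_eq_0_iff by blast
  qed
  moreover have "E \<subseteq> vs.span ?S"
  proof
    fix f assume "f \<in> E"
    then have "f \<in> carrier ?K" by (rule E_car)
    then show "f \<in> vs.span ?S"
    proof (induction rule: monoid_algebra_induct)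
      case zero
      show ?case using vs.span_zero by (simp add: zero_fun_def)
    next
      case (add f a c)
      have "?s c (single a 1) \<in> vs.span ?S" using add.hyps by (intro vs.span_scale vs.span_base) simp
      then have "f + ?s c (single a 1) \<in> vs.span ?S" by (rule vs.span_add[OF add.IH])
      moreover have "f + ?s c (single a 1) = (\<lambda>x. f x + single a c x)" by (auto simp: single_def)
      ultimately show ?case by simp
    qed
  qed
  ultimately have "finite E \<and> card E \<le> card ?S"
    using vs.independent_span_bound[of ?S E] fin by blast
  then show ?thesis using card_image_le[OF fin, of "\<lambda>a. single a (1 :: 'k)"] by linarith
qed

text \<open>This separates module theory from matrices: the latter enter the main result only
  through the construction of e.\<close>

lemma group_injective_if_left_identity:
  fixes M (structure) and e :: "'m \<Rightarrow> 'k :: field"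
  assumes M: "Group.monoid M" and fin: "finite (carrier M)"
    and e: "e \<in> carrier (monoid_algebra TYPE('k) M)" "\<And>x. x \<in> Units M \<Longrightarrow> e x = 0"
      "\<And>a. \<lbrakk>a \<in> carrier M; a \<notin> Units M\<rbrakk> \<Longrightarrow> e \<otimes>\<^bsub>monoid_algebra TYPE('k) M\<^esub> single a 1 = single a 1"
  shows "group_injective TYPE('k) M"
proof -
  interpret M: Group.monoid M by fact
  let ?KG = "monoid_algebra TYPE('k) (units_of M)"
  have G: "Group.monoid (units_of M)" by (rule group.is_monoid[OF M.units_group])
  interpret KG: ring ?KG by (rule ring_monoid_algebra[OF G])
  have finG: "finite (carrier (units_of M))"
    unfolding units_of_carrier by (rule finite_subset[OF _ fin]) auto
  have "\<one>\<^bsub>?KG\<^esub> \<noteq> \<zero>\<^bsub>?KG\<^esub>" by (simp add: fun_eq_iff)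
  from KG.ex_primitive_idempotent[OF this orthogonal_idempotents_monoid_algebra_bound[OF G finG]]
  obtain \<epsilon> where \<epsilon>: "primitive_idempotent ?KG \<epsilon>" by blast
  then have \<epsilon>': "\<epsilon> \<in> carrier ?KG" "\<epsilon> \<otimes>\<^bsub>?KG\<^esub> \<epsilon> = \<epsilon>" by (auto simp: primitive_idempotent_def)
  show ?thesis
    unfolding group_injective_def
    using projective_left_ideal[OF KG.ring_axioms \<epsilon>'] indecomposable_left_ideal[OF KG.ring_axioms \<epsilon>]
      injective_Ind_left_ideal[OF M fin e \<epsilon>'] by blast
qed

section \<open>Singular matrices as the nonunits of the full linear monoid\<close>

lemma Units_full_linear_monoid:
  "Units (full_linear_monoid TYPE('f :: field) (Suc s)) = carrier_mat (Suc s) (Suc s) - rank_le s (Suc s) (Suc s)"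
proof
  let ?M = "full_linear_monoid TYPE('f) (Suc s)"
  show "Units ?M \<subseteq> carrier_mat (Suc s) (Suc s) - rank_le s (Suc s) (Suc s)"
    using rank_le_not_invertible by (fastforce simp: Units_def full_linear_monoid_def)
  show "carrier_mat (Suc s) (Suc s) - rank_le s (Suc s) (Suc s) \<subseteq> Units ?M"
  proof
    fix X :: "'f mat" assume X: "X \<in> carrier_mat (Suc s) (Suc s) - rank_le s (Suc s) (Suc s)"
    then obtain R where R: "R \<in> carrier_mat (Suc s) (Suc s)" "X * R = 1\<^sub>m (Suc s)"
      using right_inverse_if_not_rank_le by blast
    have "R * X = 1\<^sub>m (Suc s)" by (rule mat_mult_left_right_inverse[OF _ R]) (use X in blast)
    with X R show "X \<in> Units ?M" by (auto simp: Units_def full_linear_monoid_def)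
  qed
qed

theorem proposition3p2p11:
  fixes m :: nat
  assumes "CHAR('f :: {field, finite}) \<noteq> CHAR('k :: alg_closed_field)"
    and "m \<ge> 1"
  shows "group_injective TYPE('k) (full_linear_monoid TYPE('f) m)"
proof -
  \<comment> \<open>With m = s + 1 the singular matrices are exactly those of rank at most s, so the
    rank bound of the pairing is one below the size.\<close>
  obtain s where m: "m = Suc s" using assms(2) by (cases m) auto
  let ?M = "full_linear_monoid TYPE('f) m" and ?K = "monoid_algebra TYPE('k) (full_linear_monoid TYPE('f) m)"
  have M_simps: "carrier ?M = carrier_mat m m" "A \<otimes>\<^bsub>?M\<^esub> B = A * B" for A B
    by (simp_all add: full_linear_monoid_def)
  obtain \<chi> :: "'f \<Rightarrow> 'k" where "\<forall>a b. \<chi> (a + b) = \<chi> a * \<chi> b" "\<chi> 0 = 1" "\<exists>a. \<chi> a \<noteq> 1"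
    using ex_additive_character[OF assms(1)] by blast
  then interpret additive_character \<chi> by unfold_locales auto
  obtain e where e: "\<And>X Y :: 'f mat. \<lbrakk>X \<in> rank_le s m m; Y \<in> carrier_mat m m\<rbrakk> \<Longrightarrow>
      (\<Sum>B\<in>{B \<in> rank_le s m m. B * X = Y}. e B) = (if X = Y then 1 else 0 :: 'k)"
    using ex_left_identity_rank_le[of s m] by blast
  \<comment> \<open>\<open>e\<close> is unspecified off \<open>rank_le s m m\<close>; as an element
    of the algebra without unit coefficients it has to be zero there.\<close>
  define e' where "e' B = (if B \<in> rank_le s m m then e B else 0)" for B
  show ?thesis
  proof (rule group_injective_if_left_identity[of _ e'])
    show "Group.monoid ?M" by (rule monoid_full_linear_monoid)
    show "finite (carrier ?M)" by (simp add: M_simps finite_carrier_mat)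
    have sub: "{B. e' B \<noteq> 0} \<subseteq> rank_le s m m" by (auto simp: e'_def)
    then show "e' \<in> carrier ?K"
      unfolding monoid_algebra_carrier_iff M_simps
      using finite_subset[OF sub finite_rank_le] rank_le_carrier by blast
    show "e' X = 0" if "X \<in> Units ?M" for X
      using that Units_full_linear_monoid[of s] unfolding m by (auto simp: e'_def m)
    show "e' \<otimes>\<^bsub>?K\<^esub> single X 1 = single X 1" if "X \<in> carrier ?M" "X \<notin> Units ?M" for X
    proof
      fix Y
      have X: "X \<in> rank_le s m m" "X \<in> carrier_mat m m"
        using that Units_full_linear_monoid[of s] unfolding m M_simps[unfolded m] by auto
      have "(e' \<otimes>\<^bsub>?K\<^esub> single X 1) Y = (\<Sum>B\<in>rank_le s m m. if B * X = Y then e' B * 1 else 0)"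
        using mult_single_apply[OF finite_rank_le sub, of ?M X 1 Y] by (simp add: M_simps)
      also have "\<dots> = (\<Sum>B\<in>{B \<in> rank_le s m m. B * X = Y}. e B)"
        by (simp add: sum.inter_filter finite_rank_le e'_def cong: if_cong)
      also have "\<dots> = single X 1 Y"
      proof (cases "Y \<in> carrier_mat m m")
        case True
        then show ?thesis using e[OF X(1)] by (auto simp: single_def)
      next
        \<comment> \<open>Equality of functions also concerns matrices of other sizes, where no
          product lands and both sides are 0.\<close>
        case False
        then have empty: "{B \<in> rank_le s m m. B * X = Y} = {}"
          using rank_le_carrier[of s m m] X(2) by auto
        show ?thesis unfolding empty using False X(2) by (auto simp: single_def)
      qed
      finally show "(e' \<otimes>\<^bsub>?K\<^esub> single X 1) Y = single X 1 Y" .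
    qed
  qed
qed

end
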